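(* Let $(\Omega,\Sigma,\mu)$ be a finite measure space, let $p:L^\infty(\Omega)\to\mathcal L^\infty(\Omega)$ be a lifting, and let $E$ be a faithful solid subalgebra of $L^0(\Omega)$. For every Banach--Kantorovich algebra $\mathcal U$ over $E$ there exists a unique (up to isomorphism) measurable bundle of Banach algebras $(\mathcal X,L)$ over $\Omega$ with a vector-valued lifting $\ell_{\mathcal X}$ (associated with $p$) such that $\mathcal U$ is isometrically isomorphic to $E(\Omega,\mathcal X)$ and $$\{\ell_{\mathcal X}(x)(\omega): x\in L^\infty(\Omega,\mathcal X)\}=X(\omega)\quad\text{for all }\omega\in\Omega.$$ Moreover, if $\mathcal U$ is a unital algebra, then $X(\omega)$ is also a unital algebra for all $\omega\in\Omega$.
   Context: **Base algebra.** $L^0(\Omega)$ is the algebra of a.e.-equivalence classes of complex measurable functions on $\Omega$, $L^\infty(\Omega)$ the subalgebra of classes of essentially bounded functions, and $\mathcal L^\infty(\Omega)$ the algebra of bounded measurable functions on $\Omega$ (functions, not classes). $\mathbf 1$ is the constant function $1$. A faithful solid subalgebra $E\subset L^0(\Omega)$ is a subalgebra such that $x\in L^0(\Omega)$, $y\in E$, $|x|\le|y|$ imply $x\in E$, and $E^\perp=\{0\}$ (only $0$ is disjoint from all of $E$); it is assumed that $L^\infty(\Omega)\subset E\subset L^0(\Omega)$. **Banach--Kantorovich algebras.** An $E$-valued norm on a complex vector space $X$ is a map $\|\cdot\|:X\to E$ with $\|x\|\ge0$; $\|x\|=0\iff x=0$; $\|\lambda x\|=|\lambda|\|x\|$ for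 $\lambda\in\mathbb C$; $\|x+y\|\le\|x\|+\|y\|$. It is $d$-decomposable if, whenever $\|x\|=\lambda_1+\lambda_2$ with $0\le\lambda_1,\lambda_2\in E$, $\lambda_1\lambda_2=0$, there are $x_1,x_2$ with $x=x_1+x_2$, $\|x_k\|=\lambda_k$. A net $(x_\alpha)$ $(bo)$-converges to $x$ if $\|x-x_\alpha\|\to0$ in order. A Banach--Kantorovich space over $E$ is a space with a $d$-decomposable $E$-valued norm which is complete with respect to $(bo)$-convergence. A Banach--Kantorovich algebra over $E$ is a complex algebra $\mathcal U$ that is an $E$-module with $(au)v=a(uv)=u(av)$ ($a\in E$, $u,v\in\mathcal U$), with an $E$-valued norm making it a Banach--Kantorovich space over $E$, with $\|au\|=|a|\|u\|$ and $\|uv\|\le\|u\|\|v\|$. It is unital if it has a unit $e$ with $\|e\|=\mathbf 1$. "Isometrically isomorphic" means there is a bijective $E$-linear multiplicative map preserving the $E$-valued norms. **Measurable bundles.** Let $\mathcal X$ assign to each $\omega\in\Omega$ a Banach algebra $X(\omega)\ne\{0\}$. A section is a function $u$ defined almost everywhere on $\Omega$ (with domain $\mathrm{dom}\,u$) with $u(\omega)\in X(\omega)$. A pair $(\mathcal X,L)$, $L$ a set of sections, is a measurable bundle of Banach algebras if: (1) $\lambda_1c_1+\lambda_2c_2\in L$ for $\lambda_i\in\mathbb C$, $c_i\in L$ (pointwise on $\mathrm{dom}\,c_1\cap\mathrm{dom}\,c_2$); (2) $\omega\mapsto\|c(\omega)\|_{X(\omega)}$ is measurable for all $c\in L$; (3)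 for every $\omega\in\Omega$ the set $\{c(\omega):c\in L,\ \omega\in\mathrm{dom}\,c\}$ is dense in $X(\omega)$; (4) $uv\in L$ for $u,v\in L$ (pointwise product on the intersection of domains). A section is simple if it has the form $\sum_{i=1}^n\chi_{A_i}c_i$ with $c_i\in L$, $A_i\in\Sigma$; a section $u$ is measurable if there are simple sections $s_n$ with $\|s_n(\omega)-u(\omega)\|_{X(\omega)}\to0$ for almost all $\omega$. $M(\Omega,\mathcal X)$ is the set of measurable sections, $L^0(\Omega,\mathcal X)$ its quotient by a.e. equality, $\hat u$ the class of $u$, $\|\hat u\|\in L^0(\Omega)$ the class of $\omega\mapsto\|u(\omega)\|_{X(\omega)}$, with product $\hat u\hat v=\widehat{u(\omega)v(\omega)}$. Put $E(\Omega,\mathcal X)=\{x\in L^0(\Omega,\mathcal X):\|x\|\in E\}$, $L^\infty(\Omega,\mathcal X)=\{x\in L^0(\Omega,\mathcal X):\|x\|\in L^\infty(\Omega)\}$, $\mathcal L^\infty(\Omega,\mathcal X)=\{u\in M(\Omega,\mathcal X):\|u(\cdot)\|_{X(\cdot)}\in\mathcal L^\infty(\Omega)\}$. **Isomorphism of bundles.** For measurable bundles $\mathcal X,\mathcal Y$ of Banach algebras over $\Omega$, an isomorphism is a family $\omega\mapsto H_\omega$ of injective Banach algebra homomorphisms $H_\omega:X(\omega)\to Y(\omega)$ with $\{\omega\mapsto H_\omega(u(\omega)):u\in M(\Omega,\mathcal X)\}=M(\Omega,\mathcal Y)$. **Liftings.** A lifting $p:L^\infty(\Omega)\to\mathcal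 L^\infty(\Omega)$ is (in the usual sense) a unital, conjugation-preserving algebra homomorphism with $p(\hat f)\in\hat f$, $\mathrm{dom}\,p(\hat f)=\Omega$, and $\|p(\hat f)\|_{\mathcal L^\infty(\Omega)}=\|\hat f\|_{L^\infty(\Omega)}$. A vector-valued lifting associated with $p$ is a map $\ell_{\mathcal X}:L^\infty(\Omega,\mathcal X)\to\mathcal L^\infty(\Omega,\mathcal X)$ such that for all $\hat u,\hat v\in L^\infty(\Omega,\mathcal X)$, $a\in L^\infty(\Omega)$: (1) $\ell_{\mathcal X}(\hat u)\in\hat u$ and $\mathrm{dom}\,\ell_{\mathcal X}(\hat u)=\Omega$; (2) $\|\ell_{\mathcal X}(\hat u)(\omega)\|_{X(\omega)}=p(\|\hat u\|)(\omega)$ for all $\omega$; (3) $\ell_{\mathcal X}(\hat u+\hat v)=\ell_{\mathcal X}(\hat u)+\ell_{\mathcal X}(\hat v)$; (4) $\ell_{\mathcal X}(a\hat u)=p(a)\ell_{\mathcal X}(\hat u)$; (5) $\ell_{\mathcal X}(\hat u\hat v)=\ell_{\mathcal X}(\hat u)\ell_{\mathcal X}(\hat v)$; (6) for every $\omega$ the set $\{\ell_{\mathcal X}(\hat u)(\omega):\hat u\in L^\infty(\Omega,\mathcal X)\}$ is dense in $X(\omega)$.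
   Formalization: Fibres X(ω) may be {0}; they are proved nonzero when no nonzero element of L^0(Ω) is disjoint from all norms of U. Otherwise (e.g. U={0}) nonzero fibres are impossible; uniqueness is proved among bundles with possibly zero fibres. *)

theory Defs
  imports
    "HOL-Probability.Essential_Supremum"
    "HOL-Algebra.Module"
begin

section \<open>The algebra of classes of measurable functions\<close>

text \<open>
  Elements of \<open>L\<^sup>0(\<Omega>)\<close> are sets of functions: the class of \<open>f\<close> consists of all measurable
  functions equal to \<open>f\<close> almost everywhere. Values outside \<^term>\<open>space M\<close> are irrelevant.
\<close>

type_synonym 'a L0_elem = "('a \<Rightarrow> complex) set"

definition L0_class :: "'a measure \<Rightarrow> ('a \<Rightarrow> complex) \<Rightarrow> 'a L0_elem" where
  "L0_class M f = {g \<in> borel_measurable M. AE \<omega> in M. g \<omega> = f \<omega>}"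

definition L0_lift :: "'a measure \<Rightarrow> (complex \<Rightarrow> complex) \<Rightarrow> 'a L0_elem \<Rightarrow> 'a L0_elem" where
  "L0_lift M h a = {g \<in> borel_measurable M. \<exists>f\<in>a. AE \<omega> in M. g \<omega> = h (f \<omega>)}"

definition L0_lift2 ::
  "'a measure \<Rightarrow> (complex \<Rightarrow> complex \<Rightarrow> complex) \<Rightarrow> 'a L0_elem \<Rightarrow> 'a L0_elem \<Rightarrow> 'a L0_elem" where
  "L0_lift2 M h a b =
     {g \<in> borel_measurable M. \<exists>f1\<in>a. \<exists>f2\<in>b. AE \<omega> in M. g \<omega> = h (f1 \<omega>) (f2 \<omega>)}"

definition L0 :: "'a measure \<Rightarrow> (complex, 'a L0_elem) module" where
  "L0 M = \<lparr>carrier = L0_class M ` borel_measurable M,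
           monoid.mult = L0_lift2 M (*), one = L0_class M (\<lambda>_. 1),
           zero = L0_class M (\<lambda>_. 0), add = L0_lift2 M (+),
           smult = (\<lambda>c. L0_lift M (\<lambda>z. c * z))\<rparr>"

definition L0_abs :: "'a measure \<Rightarrow> 'a L0_elem \<Rightarrow> 'a L0_elem" where
  "L0_abs M = L0_lift M (\<lambda>z. complex_of_real (cmod z))"

definition L0_cnj :: "'a measure \<Rightarrow> 'a L0_elem \<Rightarrow> 'a L0_elem" where
  "L0_cnj M = L0_lift M cnj"

text \<open>The order of \<open>L\<^sup>0\<close> as a complex vector lattice: \<open>b - a\<close> is real and nonnegative a.e.\<close>

definition L0_le :: "'a measure \<Rightarrow> 'a L0_elem \<Rightarrow> 'a L0_elem \<Rightarrow> bool" where
  "L0_le M a b \<longleftrightarrow>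
     (\<exists>f\<in>a. \<exists>g\<in>b. AE \<omega> in M. Im (f \<omega>) = Im (g \<omega>) \<and> Re (f \<omega>) \<le> Re (g \<omega>))"

definition L0_disjoint :: "'a measure \<Rightarrow> 'a L0_elem \<Rightarrow> 'a L0_elem \<Rightarrow> bool" where
  "L0_disjoint M a b \<longleftrightarrow>
     L0_lift2 M (\<lambda>s t. complex_of_real (min (cmod s) (cmod t))) a b = \<zero>\<^bsub>L0 M\<^esub>"

definition Linf :: "'a measure \<Rightarrow> 'a L0_elem set" where
  "Linf M = {a \<in> carrier (L0 M). \<exists>f\<in>a. \<exists>C. AE \<omega> in M. cmod (f \<omega>) \<le> C}"

definition bounded_measurable :: "'a measure \<Rightarrow> ('a \<Rightarrow> complex) set" where
  "bounded_measurable M = {f \<in> borel_measurable M. \<exists>C. \<forall>\<omega>\<in>space M. cmod (f \<omega>) \<le> C}"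

definition faithful :: "'a measure \<Rightarrow> 'a L0_elem set \<Rightarrow> bool" where
  "faithful M S \<longleftrightarrow>
     (\<forall>x\<in>carrier (L0 M). (\<forall>y\<in>S. L0_disjoint M x y) \<longrightarrow> x = \<zero>\<^bsub>L0 M\<^esub>)"

definition faithful_solid_subalgebra :: "'a measure \<Rightarrow> 'a L0_elem set \<Rightarrow> bool" where
  "faithful_solid_subalgebra M E \<longleftrightarrow>
     Linf M \<subseteq> E \<and> E \<subseteq> carrier (L0 M) \<and>
     (\<forall>x\<in>E. \<forall>y\<in>E. x \<oplus>\<^bsub>L0 M\<^esub> y \<in> E \<and> x \<otimes>\<^bsub>L0 M\<^esub> y \<in> E) \<and>
     (\<forall>c. \<forall>x\<in>E. c \<odot>\<^bsub>L0 M\<^esub> x \<in> E) \<and>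
     (\<forall>x\<in>carrier (L0 M). \<forall>y\<in>E. L0_le M (L0_abs M x) (L0_abs M y) \<longrightarrow> x \<in> E) \<and>
     faithful M E"

text \<open>\<open>E\<close> as a commutative ring of scalars.\<close>

abbreviation scalars :: "'a measure \<Rightarrow> 'a L0_elem set \<Rightarrow> (complex, 'a L0_elem) module" where
  "scalars M E \<equiv> L0 M\<lparr>carrier := E\<rparr>"

section \<open>Liftings\<close>

text \<open>
  The image \<open>p a\<close> is a genuine function; only its values on \<^term>\<open>space M\<close> carry meaning, so all
  identities between such functions are required on \<^term>\<open>space M\<close>. The essential supremum does
  not depend on the representative \<open>f\<close>.
\<close>

definition is_lifting :: "'a measure \<Rightarrow> ('a L0_elem \<Rightarrow> 'a \<Rightarrow> complex) \<Rightarrow> bool" where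
  "is_lifting M p \<longleftrightarrow>
     (\<forall>a\<in>Linf M. p a \<in> bounded_measurable M \<and> p a \<in> a) \<and>
     (\<forall>a\<in>Linf M. \<forall>b\<in>Linf M. \<forall>\<omega>\<in>space M.
        p (a \<oplus>\<^bsub>L0 M\<^esub> b) \<omega> = p a \<omega> + p b \<omega> \<and>
        p (a \<otimes>\<^bsub>L0 M\<^esub> b) \<omega> = p a \<omega> * p b \<omega>) \<and>
     (\<forall>c. \<forall>a\<in>Linf M. \<forall>\<omega>\<in>space M. p (c \<odot>\<^bsub>L0 M\<^esub> a) \<omega> = c * p a \<omega>) \<and>
     (\<forall>\<omega>\<in>space M. p \<one>\<^bsub>L0 M\<^esub> \<omega> = 1) \<and>
     (\<forall>a\<in>Linf M. \<forall>\<omega>\<in>space M. p (L0_cnj M a) \<omega> = cnj (p a \<omega>)) \<and>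
     (\<forall>a\<in>Linf M. \<forall>f\<in>a.
        (SUP \<omega>\<in>space M. ennreal (cmod (p a \<omega>))) = esssup M (\<lambda>\<omega>. ennreal (cmod (f \<omega>))))"

section \<open>Algebras over a ring of scalars\<close>

text \<open>
  Algebras here are associative but need neither be commutative nor unital, so the locale
  \<open>algebra\<close> of HOL-Algebra does not apply. We use the record type of modules from HOL-Algebra; its
  field \<^const>\<open>one\<close> is never referred to for such algebras.
\<close>

definition complex_ring :: "complex ring" where
  "complex_ring = \<lparr>carrier = UNIV, monoid.mult = (*), one = 1, zero = 0, add = (+)\<rparr>"

definition assoc_algebra :: "('r, 'm) ring_scheme \<Rightarrow> ('r, 'b, 'n) module_scheme \<Rightarrow> bool" where
  "assoc_algebra R A \<longleftrightarrow>
     Module.module R A \<and>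
     (\<forall>x\<in>carrier A. \<forall>y\<in>carrier A. x \<otimes>\<^bsub>A\<^esub> y \<in> carrier A) \<and>
     (\<forall>x\<in>carrier A. \<forall>y\<in>carrier A. \<forall>z\<in>carrier A.
        (x \<otimes>\<^bsub>A\<^esub> y) \<otimes>\<^bsub>A\<^esub> z = x \<otimes>\<^bsub>A\<^esub> (y \<otimes>\<^bsub>A\<^esub> z) \<and>
        (x \<oplus>\<^bsub>A\<^esub> y) \<otimes>\<^bsub>A\<^esub> z = (x \<otimes>\<^bsub>A\<^esub> z) \<oplus>\<^bsub>A\<^esub> (y \<otimes>\<^bsub>A\<^esub> z) \<and>
        z \<otimes>\<^bsub>A\<^esub> (x \<oplus>\<^bsub>A\<^esub> y) = (z \<otimes>\<^bsub>A\<^esub> x) \<oplus>\<^bsub>A\<^esub> (z \<otimes>\<^bsub>A\<^esub> y)) \<and>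
     (\<forall>a\<in>carrier R. \<forall>x\<in>carrier A. \<forall>y\<in>carrier A.
        (a \<odot>\<^bsub>A\<^esub> x) \<otimes>\<^bsub>A\<^esub> y = a \<odot>\<^bsub>A\<^esub> (x \<otimes>\<^bsub>A\<^esub> y) \<and>
        x \<otimes>\<^bsub>A\<^esub> (a \<odot>\<^bsub>A\<^esub> y) = a \<odot>\<^bsub>A\<^esub> (x \<otimes>\<^bsub>A\<^esub> y))"

definition algebra_unit :: "('b, 'n) ring_scheme \<Rightarrow> 'b \<Rightarrow> bool" where
  "algebra_unit A e \<longleftrightarrow>
     e \<in> carrier A \<and> (\<forall>x\<in>carrier A. e \<otimes>\<^bsub>A\<^esub> x = x \<and> x \<otimes>\<^bsub>A\<^esub> e = x)"

section \<open>Banach algebras with a carrier set\<close>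

record 'b normed_alg = "(complex, 'b) module" +
  fnorm :: "'b \<Rightarrow> real"

text \<open>The locale \<^locale>\<open>Metric_space\<close> constrains the distance off the carrier as well.\<close>

definition fdist :: "'b normed_alg \<Rightarrow> 'b \<Rightarrow> 'b \<Rightarrow> real" where
  "fdist A x y = (if x \<in> carrier A \<and> y \<in> carrier A then fnorm A (x \<ominus>\<^bsub>A\<^esub> y) else 0)"

definition banach_alg :: "'b normed_alg \<Rightarrow> bool" where
  "banach_alg A \<longleftrightarrow>
     assoc_algebra complex_ring A \<and>
     (\<forall>x\<in>carrier A. 0 \<le> fnorm A x \<and> (fnorm A x = 0 \<longleftrightarrow> x = \<zero>\<^bsub>A\<^esub>)) \<and>
     (\<forall>c. \<forall>x\<in>carrier A. fnorm A (c \<odot>\<^bsub>A\<^esub> x) = cmod c * fnorm A x) \<and>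
     (\<forall>x\<in>carrier A. \<forall>y\<in>carrier A.
        fnorm A (x \<oplus>\<^bsub>A\<^esub> y) \<le> fnorm A x + fnorm A y \<and>
        fnorm A (x \<otimes>\<^bsub>A\<^esub> y) \<le> fnorm A x * fnorm A y) \<and>
     Metric_space.mcomplete (carrier A) (fdist A)"

definition dense_in_alg :: "'b normed_alg \<Rightarrow> 'b set \<Rightarrow> bool" where
  "dense_in_alg A S \<longleftrightarrow>
     Abstract_Topology.closure_of (Metric_space.mtopology (carrier A) (fdist A)) S = carrier A"

definition unital_banach_alg :: "'b normed_alg \<Rightarrow> bool" where
  "unital_banach_alg A \<longleftrightarrow> banach_alg A \<and> (\<exists>e. algebra_unit A e \<and> fnorm A e = 1)"

definition banach_alg_hom :: "'b normed_alg \<Rightarrow> 'c normed_alg \<Rightarrow> ('b \<Rightarrow> 'c) \<Rightarrow> bool" where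
  "banach_alg_hom A B h \<longleftrightarrow>
     h \<in> carrier A \<rightarrow> carrier B \<and>
     (\<forall>x\<in>carrier A. \<forall>y\<in>carrier A.
        h (x \<oplus>\<^bsub>A\<^esub> y) = h x \<oplus>\<^bsub>B\<^esub> h y \<and> h (x \<otimes>\<^bsub>A\<^esub> y) = h x \<otimes>\<^bsub>B\<^esub> h y) \<and>
     (\<forall>c. \<forall>x\<in>carrier A. h (c \<odot>\<^bsub>A\<^esub> x) = c \<odot>\<^bsub>B\<^esub> h x) \<and>
     (\<exists>K. \<forall>x\<in>carrier A. fnorm B (h x) \<le> K * fnorm A x)"

section \<open>Banach--Kantorovich algebras\<close>

text \<open>
  \<^const>\<open>smult\<close> is the action of \<open>E\<close>, \<open>cscale\<close> the multiplication by complex numbers, \<open>vnorm\<close>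
  the \<open>E\<close>-valued norm.
\<close>

record ('e, 'u) vnormed_alg = "('e, 'u) module" +
  cscale :: "complex \<Rightarrow> 'u \<Rightarrow> 'u"
  vnorm :: "'u \<Rightarrow> 'e"

definition complex_reduct :: "('e, 'u) vnormed_alg \<Rightarrow> (complex, 'u) module" where
  "complex_reduct U = \<lparr>carrier = carrier U, monoid.mult = monoid.mult U, one = one U,
                       zero = zero U, add = add U, smult = cscale U\<rparr>"

definition vector_norm ::
  "'a measure \<Rightarrow> 'a L0_elem set \<Rightarrow> ('a L0_elem, 'u) vnormed_alg \<Rightarrow> bool" where
  "vector_norm M E U \<longleftrightarrow>
     (\<forall>x\<in>carrier U. vnorm U x \<in> E \<and> L0_le M \<zero>\<^bsub>L0 M\<^esub> (vnorm U x) \<and>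
        (vnorm U x = \<zero>\<^bsub>L0 M\<^esub> \<longleftrightarrow> x = \<zero>\<^bsub>U\<^esub>)) \<and>
     (\<forall>c. \<forall>x\<in>carrier U.
        vnorm U (cscale U c x) = complex_of_real (cmod c) \<odot>\<^bsub>L0 M\<^esub> vnorm U x) \<and>
     (\<forall>x\<in>carrier U. \<forall>y\<in>carrier U.
        L0_le M (vnorm U (x \<oplus>\<^bsub>U\<^esub> y)) (vnorm U x \<oplus>\<^bsub>L0 M\<^esub> vnorm U y))"

definition d_decomposable ::
  "'a measure \<Rightarrow> 'a L0_elem set \<Rightarrow> ('a L0_elem, 'u) vnormed_alg \<Rightarrow> bool" where
  "d_decomposable M E U \<longleftrightarrow>
     (\<forall>x\<in>carrier U. \<forall>a\<in>E. \<forall>b\<in>E.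
        L0_le M \<zero>\<^bsub>L0 M\<^esub> a \<and> L0_le M \<zero>\<^bsub>L0 M\<^esub> b \<and> a \<otimes>\<^bsub>L0 M\<^esub> b = \<zero>\<^bsub>L0 M\<^esub> \<and>
        vnorm U x = a \<oplus>\<^bsub>L0 M\<^esub> b \<longrightarrow>
        (\<exists>y\<in>carrier U. \<exists>z\<in>carrier U. x = y \<oplus>\<^bsub>U\<^esub> z \<and> vnorm U y = a \<and> vnorm U z = b))"

text \<open>
  A net \<open>(x\<^sub>\<alpha>)\<close> \<open>(bo)\<close>-converges to \<open>x\<close> if some net decreasing to \<open>0\<close> in \<open>E\<close> has the
  property that each of its members eventually dominates \<open>\<parallel>x - x\<^sub>\<alpha>\<parallel>\<close>. The set of members of a
  decreasing net with infimum \<open>0\<close> is a downward directed set \<open>D\<close> with infimum \<open>0\<close>, and vice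
  versa. Nets over arbitrary index sets are represented by their filters of tails on the
  algebra; the net of pairs \<open>(x\<^sub>\<alpha>, x\<^sub>\<beta>)\<close> then has the product filter.
\<close>

definition decreases_to_zero :: "'a measure \<Rightarrow> 'a L0_elem set \<Rightarrow> 'a L0_elem set \<Rightarrow> bool" where
  "decreases_to_zero M E D \<longleftrightarrow>
     D \<noteq> {} \<and> D \<subseteq> E \<and>
     (\<forall>a\<in>D. \<forall>b\<in>D. \<exists>c\<in>D. L0_le M c a \<and> L0_le M c b) \<and>
     (\<forall>a\<in>D. L0_le M \<zero>\<^bsub>L0 M\<^esub> a) \<and>
     (\<forall>g\<in>E. (\<forall>a\<in>D. L0_le M g a) \<longrightarrow> L0_le M g \<zero>\<^bsub>L0 M\<^esub>)"

definition bo_tendsto ::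
  "'a measure \<Rightarrow> 'a L0_elem set \<Rightarrow> ('a L0_elem, 'u) vnormed_alg \<Rightarrow> 'u filter \<Rightarrow> 'u \<Rightarrow> bool" where
  "bo_tendsto M E U F x \<longleftrightarrow>
     (\<exists>D. decreases_to_zero M E D \<and>
          (\<forall>a\<in>D. \<forall>\<^sub>F y in F. L0_le M (vnorm U (x \<ominus>\<^bsub>U\<^esub> y)) a))"

definition bo_cauchy ::
  "'a measure \<Rightarrow> 'a L0_elem set \<Rightarrow> ('a L0_elem, 'u) vnormed_alg \<Rightarrow> 'u filter \<Rightarrow> bool" where
  "bo_cauchy M E U F \<longleftrightarrow>
     (\<exists>D. decreases_to_zero M E D \<and>
          (\<forall>a\<in>D. \<forall>\<^sub>F (y, z) in F \<times>\<^sub>F F. L0_le M (vnorm U (y \<ominus>\<^bsub>U\<^esub> z)) a))"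

definition bo_complete ::
  "'a measure \<Rightarrow> 'a L0_elem set \<Rightarrow> ('a L0_elem, 'u) vnormed_alg \<Rightarrow> bool" where
  "bo_complete M E U \<longleftrightarrow>
     (\<forall>F. F \<noteq> bot \<and> (\<forall>\<^sub>F y in F. y \<in> carrier U) \<and> bo_cauchy M E U F \<longrightarrow>
          (\<exists>x\<in>carrier U. bo_tendsto M E U F x))"

definition BK_algebra ::
  "'a measure \<Rightarrow> 'a L0_elem set \<Rightarrow> ('a L0_elem, 'u) vnormed_alg \<Rightarrow> bool" where
  "BK_algebra M E U \<longleftrightarrow>
     assoc_algebra complex_ring (complex_reduct U) \<and>
     assoc_algebra (scalars M E) U \<and>
     vector_norm M E U \<and> d_decomposable M E U \<and> bo_complete M E U \<and>
     (\<forall>a\<in>E. \<forall>x\<in>carrier U. vnorm U (a \<odot>\<^bsub>U\<^esub> x) = L0_abs M a \<otimes>\<^bsub>L0 M\<^esub> vnorm U x) \<and>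
     (\<forall>x\<in>carrier U. \<forall>y\<in>carrier U.
        L0_le M (vnorm U (x \<otimes>\<^bsub>U\<^esub> y)) (vnorm U x \<otimes>\<^bsub>L0 M\<^esub> vnorm U y))"

definition unital_BK_algebra ::
  "'a measure \<Rightarrow> 'a L0_elem set \<Rightarrow> ('a L0_elem, 'u) vnormed_alg \<Rightarrow> bool" where
  "unital_BK_algebra M E U \<longleftrightarrow>
     BK_algebra M E U \<and> (\<exists>e. algebra_unit U e \<and> vnorm U e = \<one>\<^bsub>L0 M\<^esub>)"

section \<open>Measurable bundles of Banach algebras\<close>

text \<open>Sections are partial functions; \<^const>\<open>dom\<close> is their domain.\<close>

definition is_section :: "'a measure \<Rightarrow> ('a \<Rightarrow> 'b normed_alg) \<Rightarrow> ('a \<rightharpoonup> 'b) \<Rightarrow> bool" where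
  "is_section M X u \<longleftrightarrow>
     dom u \<subseteq> space M \<and> (AE \<omega> in M. \<omega> \<in> dom u) \<and> (\<forall>\<omega>\<in>dom u. the (u \<omega>) \<in> carrier (X \<omega>))"

definition sec_add :: "('a \<Rightarrow> 'b normed_alg) \<Rightarrow> ('a \<rightharpoonup> 'b) \<Rightarrow> ('a \<rightharpoonup> 'b) \<Rightarrow> ('a \<rightharpoonup> 'b)" where
  "sec_add X u v = (\<lambda>\<omega>. if \<omega> \<in> dom u \<inter> dom v
     then Some (the (u \<omega>) \<oplus>\<^bsub>X \<omega>\<^esub> the (v \<omega>)) else None)"

definition sec_mult :: "('a \<Rightarrow> 'b normed_alg) \<Rightarrow> ('a \<rightharpoonup> 'b) \<Rightarrow> ('a \<rightharpoonup> 'b) \<Rightarrow> ('a \<rightharpoonup> 'b)" where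
  "sec_mult X u v = (\<lambda>\<omega>. if \<omega> \<in> dom u \<inter> dom v
     then Some (the (u \<omega>) \<otimes>\<^bsub>X \<omega>\<^esub> the (v \<omega>)) else None)"

definition sec_scale ::
  "('a \<Rightarrow> 'b normed_alg) \<Rightarrow> ('a \<Rightarrow> complex) \<Rightarrow> ('a \<rightharpoonup> 'b) \<Rightarrow> ('a \<rightharpoonup> 'b)" where
  "sec_scale X f u = (\<lambda>\<omega>. if \<omega> \<in> dom u then Some (f \<omega> \<odot>\<^bsub>X \<omega>\<^esub> the (u \<omega>)) else None)"

definition sec_norm :: "('a \<Rightarrow> 'b normed_alg) \<Rightarrow> ('a \<rightharpoonup> 'b) \<Rightarrow> 'a \<Rightarrow> real" where
  "sec_norm X u \<omega> = fnorm (X \<omega>) (the (u \<omega>))"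

text \<open>
  The fibres of a weak bundle may be \<open>{0}\<close>; those of a measurable bundle may not. The weak notion
  is needed because an algebra whose norms all vanish on a set \<open>A\<close> of positive measure (for
  example the algebra \<open>{0}\<close>) forces \<open>X(\<omega>) = {0}\<close> wherever the lifting of \<open>\<chi>\<^sub>A\<close> equals \<open>1\<close>, if the
  vector-valued lifting is to be onto at every point. Measurability
  of the partially defined function \<open>\<omega> \<mapsto> \<parallel>c(\<omega>)\<parallel>\<close> is with respect to the trace of the
  \<open>\<sigma>\<close>-algebra on its domain.
\<close>

definition weak_measurable_bundle ::
  "'a measure \<Rightarrow> ('a \<Rightarrow> 'b normed_alg) \<Rightarrow> ('a \<rightharpoonup> 'b) set \<Rightarrow> bool" where
  "weak_measurable_bundle M X L \<longleftrightarrow>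
     (\<forall>\<omega>\<in>space M. banach_alg (X \<omega>)) \<and>
     (\<forall>c\<in>L. is_section M X c) \<and>
     (\<forall>s t. \<forall>c\<in>L. \<forall>d\<in>L. sec_add X (sec_scale X (\<lambda>_. s) c) (sec_scale X (\<lambda>_. t) d) \<in> L) \<and>
     (\<forall>c\<in>L. sec_norm X c \<in> borel_measurable (restrict_space M (dom c))) \<and>
     (\<forall>\<omega>\<in>space M. dense_in_alg (X \<omega>) {the (c \<omega>) |c. c \<in> L \<and> \<omega> \<in> dom c}) \<and>
     (\<forall>c\<in>L. \<forall>d\<in>L. sec_mult X c d \<in> L)"

definition measurable_bundle ::
  "'a measure \<Rightarrow> ('a \<Rightarrow> 'b normed_alg) \<Rightarrow> ('a \<rightharpoonup> 'b) set \<Rightarrow> bool" where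
  "measurable_bundle M X L \<longleftrightarrow>
     weak_measurable_bundle M X L \<and> (\<forall>\<omega>\<in>space M. carrier (X \<omega>) \<noteq> {\<zero>\<^bsub>X \<omega>\<^esub>})"

definition simple_section ::
  "'a measure \<Rightarrow> ('a \<Rightarrow> 'b normed_alg) \<Rightarrow> ('a \<rightharpoonup> 'b) set \<Rightarrow> ('a \<rightharpoonup> 'b) \<Rightarrow> bool" where
  "simple_section M X L s \<longleftrightarrow>
     (\<exists>(n::nat) A c. (\<forall>i<n. A i \<in> sets M \<and> c i \<in> L) \<and>
        s = (\<lambda>\<omega>. if \<omega> \<in> space M \<and> (\<forall>i<n. \<omega> \<in> dom (c i))
                 then Some (finsum (X \<omega>) (\<lambda>i. indicator (A i) \<omega> \<odot>\<^bsub>X \<omega>\<^esub> the (c i \<omega>)) {..<n})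
                 else None))"

definition measurable_sections ::
  "'a measure \<Rightarrow> ('a \<Rightarrow> 'b normed_alg) \<Rightarrow> ('a \<rightharpoonup> 'b) set \<Rightarrow> ('a \<rightharpoonup> 'b) set" where
  "measurable_sections M X L =
     {u. is_section M X u \<and>
         (\<exists>s :: nat \<Rightarrow> ('a \<rightharpoonup> 'b). (\<forall>n. simple_section M X L (s n)) \<and>
            (AE \<omega> in M. \<omega> \<in> dom u \<and> (\<forall>n. \<omega> \<in> dom (s n)) \<and>
               (\<lambda>n. fnorm (X \<omega>) (the (s n \<omega>) \<ominus>\<^bsub>X \<omega>\<^esub> the (u \<omega>))) \<longlonglongrightarrow> 0))}"

section \<open>Classes of measurable sections\<close>

definition sec_class ::
  "'a measure \<Rightarrow> ('a \<Rightarrow> 'b normed_alg) \<Rightarrow> ('a \<rightharpoonup> 'b) set \<Rightarrow> ('a \<rightharpoonup> 'b) \<Rightarrow> ('a \<rightharpoonup> 'b) set" where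
  "sec_class M X L u = {v \<in> measurable_sections M X L. AE \<omega> in M. v \<omega> = u \<omega>}"

definition L0_sec ::
  "'a measure \<Rightarrow> ('a \<Rightarrow> 'b normed_alg) \<Rightarrow> ('a \<rightharpoonup> 'b) set \<Rightarrow> ('a \<rightharpoonup> 'b) set set" where
  "L0_sec M X L = sec_class M X L ` measurable_sections M X L"

text \<open>
  When \<^term>\<open>M\<close> is not complete, the pointwise norm of a measurable section is only almost
  everywhere equal to a measurable function; \<open>cls_norm\<close> is the class of the latter.
\<close>

definition cls_norm ::
  "'a measure \<Rightarrow> ('a \<Rightarrow> 'b normed_alg) \<Rightarrow> ('a \<rightharpoonup> 'b) set \<Rightarrow> 'a L0_elem" where
  "cls_norm M X x =
     {g \<in> borel_measurable M. \<exists>u\<in>x. AE \<omega> in M. g \<omega> = complex_of_real (sec_norm X u \<omega>)}"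

definition cls_add ::
  "'a measure \<Rightarrow> ('a \<Rightarrow> 'b normed_alg) \<Rightarrow> ('a \<rightharpoonup> 'b) set \<Rightarrow>
   ('a \<rightharpoonup> 'b) set \<Rightarrow> ('a \<rightharpoonup> 'b) set \<Rightarrow> ('a \<rightharpoonup> 'b) set" where
  "cls_add M X L x y =
     {w \<in> measurable_sections M X L. \<exists>u\<in>x. \<exists>v\<in>y. AE \<omega> in M. w \<omega> = sec_add X u v \<omega>}"

definition cls_mult ::
  "'a measure \<Rightarrow> ('a \<Rightarrow> 'b normed_alg) \<Rightarrow> ('a \<rightharpoonup> 'b) set \<Rightarrow>
   ('a \<rightharpoonup> 'b) set \<Rightarrow> ('a \<rightharpoonup> 'b) set \<Rightarrow> ('a \<rightharpoonup> 'b) set" where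
  "cls_mult M X L x y =
     {w \<in> measurable_sections M X L. \<exists>u\<in>x. \<exists>v\<in>y. AE \<omega> in M. w \<omega> = sec_mult X u v \<omega>}"

definition cls_scale ::
  "'a measure \<Rightarrow> ('a \<Rightarrow> 'b normed_alg) \<Rightarrow> ('a \<rightharpoonup> 'b) set \<Rightarrow>
   'a L0_elem \<Rightarrow> ('a \<rightharpoonup> 'b) set \<Rightarrow> ('a \<rightharpoonup> 'b) set" where
  "cls_scale M X L a x =
     {w \<in> measurable_sections M X L. \<exists>f\<in>a. \<exists>u\<in>x. AE \<omega> in M. w \<omega> = sec_scale X f u \<omega>}"

definition E_sec ::
  "'a measure \<Rightarrow> 'a L0_elem set \<Rightarrow> ('a \<Rightarrow> 'b normed_alg) \<Rightarrow> ('a \<rightharpoonup> 'b) set \<Rightarrow> ('a \<rightharpoonup> 'b) set set"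
  where
  "E_sec M E X L = {x \<in> L0_sec M X L. cls_norm M X x \<in> E}"

abbreviation Linf_sec ::
  "'a measure \<Rightarrow> ('a \<Rightarrow> 'b normed_alg) \<Rightarrow> ('a \<rightharpoonup> 'b) set \<Rightarrow> ('a \<rightharpoonup> 'b) set set" where
  "Linf_sec M \<equiv> E_sec M (Linf M)"

definition bounded_sections ::
  "'a measure \<Rightarrow> ('a \<Rightarrow> 'b normed_alg) \<Rightarrow> ('a \<rightharpoonup> 'b) set \<Rightarrow> ('a \<rightharpoonup> 'b) set" where
  "bounded_sections M X L =
     {u \<in> measurable_sections M X L. dom u = space M \<and>
        (\<lambda>\<omega>. complex_of_real (sec_norm X u \<omega>)) \<in> bounded_measurable M}"

section \<open>Vector-valued liftings, isomorphisms\<close>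

definition vector_lifting ::
  "'a measure \<Rightarrow> ('a L0_elem \<Rightarrow> 'a \<Rightarrow> complex) \<Rightarrow> ('a \<Rightarrow> 'b normed_alg) \<Rightarrow> ('a \<rightharpoonup> 'b) set \<Rightarrow>
   (('a \<rightharpoonup> 'b) set \<Rightarrow> ('a \<rightharpoonup> 'b)) \<Rightarrow> bool" where
  "vector_lifting M p X L l \<longleftrightarrow>
     (\<forall>x\<in>Linf_sec M X L. l x \<in> bounded_sections M X L \<and> l x \<in> x \<and> dom (l x) = space M) \<and>
     (\<forall>x\<in>Linf_sec M X L. \<forall>\<omega>\<in>space M.
        complex_of_real (sec_norm X (l x) \<omega>) = p (cls_norm M X x) \<omega>) \<and>
     (\<forall>x\<in>Linf_sec M X L. \<forall>y\<in>Linf_sec M X L. l (cls_add M X L x y) = sec_add X (l x) (l y)) \<and>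
     (\<forall>a\<in>Linf M. \<forall>x\<in>Linf_sec M X L. l (cls_scale M X L a x) = sec_scale X (p a) (l x)) \<and>
     (\<forall>x\<in>Linf_sec M X L. \<forall>y\<in>Linf_sec M X L. l (cls_mult M X L x y) = sec_mult X (l x) (l y)) \<and>
     (\<forall>\<omega>\<in>space M. dense_in_alg (X \<omega>) {the (l x \<omega>) |x. x \<in> Linf_sec M X L})"

definition isometrically_isomorphic ::
  "'a measure \<Rightarrow> 'a L0_elem set \<Rightarrow> ('a L0_elem, 'u) vnormed_alg \<Rightarrow>
   ('a \<Rightarrow> 'b normed_alg) \<Rightarrow> ('a \<rightharpoonup> 'b) set \<Rightarrow> bool" where
  "isometrically_isomorphic M E U X L \<longleftrightarrow>
     (\<exists>\<Phi>. bij_betw \<Phi> (carrier U) (E_sec M E X L) \<and>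
        (\<forall>x\<in>carrier U. \<forall>y\<in>carrier U.
           \<Phi> (x \<oplus>\<^bsub>U\<^esub> y) = cls_add M X L (\<Phi> x) (\<Phi> y) \<and>
           \<Phi> (x \<otimes>\<^bsub>U\<^esub> y) = cls_mult M X L (\<Phi> x) (\<Phi> y)) \<and>
        (\<forall>a\<in>E. \<forall>x\<in>carrier U. \<Phi> (a \<odot>\<^bsub>U\<^esub> x) = cls_scale M X L a (\<Phi> x)) \<and>
        (\<forall>x\<in>carrier U. cls_norm M X (\<Phi> x) = vnorm U x))"

definition bundle_isomorphic ::
  "'a measure \<Rightarrow> ('a \<Rightarrow> 'b normed_alg) \<Rightarrow> ('a \<rightharpoonup> 'b) set \<Rightarrow>
   ('a \<Rightarrow> 'c normed_alg) \<Rightarrow> ('a \<rightharpoonup> 'c) set \<Rightarrow> bool" where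
  "bundle_isomorphic M X L Y K \<longleftrightarrow>
     (\<exists>H :: 'a \<Rightarrow> 'b \<Rightarrow> 'c.
        (\<forall>\<omega>\<in>space M. banach_alg_hom (X \<omega>) (Y \<omega>) (H \<omega>) \<and> inj_on (H \<omega>) (carrier (X \<omega>))) \<and>
        {(\<lambda>\<omega>. map_option (H \<omega>) (u \<omega>)) |u. u \<in> measurable_sections M X L} =
          measurable_sections M Y K)"

definition represents ::
  "'a measure \<Rightarrow> ('a L0_elem \<Rightarrow> 'a \<Rightarrow> complex) \<Rightarrow> 'a L0_elem set \<Rightarrow>
   ('a L0_elem, 'u) vnormed_alg \<Rightarrow> ('a \<Rightarrow> 'b normed_alg) \<Rightarrow> ('a \<rightharpoonup> 'b) set \<Rightarrow>
   (('a \<rightharpoonup> 'b) set \<Rightarrow> ('a \<rightharpoonup> 'b)) \<Rightarrow> bool" where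
  "represents M p E U X L l \<longleftrightarrow>
     vector_lifting M p X L l \<and>
     isometrically_isomorphic M E U X L \<and>
     (\<forall>\<omega>\<in>space M. {the (l x \<omega>) |x. x \<in> Linf_sec M X L} = carrier (X \<omega>))"

end

theory Submission
  imports Defs
begin

text \<open>
  Let \<open>U\<^sub>b\<close> be the elements of \<open>U\<close> with essentially bounded norm. At each point \<open>\<omega>\<close> the lifting turns the
  vector norm into a submultiplicative seminorm \<open>x \<mapsto> p(\<parallel>x\<parallel>)(\<omega>)\<close> on \<open>U\<^sub>b\<close>; the fibre \<open>X(\<omega>)\<close> is the quotient
  of \<open>U\<^sub>b\<close> by its kernel. It is complete because the seminorm is the quotient norm of the complete norm
  \<open>\<parallel>\<parallel>x\<parallel>\<parallel>\<^sub>\<infinity>\<close>: an element can be cut off to the set where its norm exceeds \<open>p(\<parallel>x\<parallel>)(\<omega>)\<close> by at most \<open>\<epsilon>\<close> without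
  changing its class at \<open>\<omega>\<close>. An arbitrary element of \<open>U\<close> is reached from \<open>U\<^sub>b\<close> by dividing by a strictly
  positive bounded function, and \<open>(bo)\<close>-completeness of \<open>U\<close> makes every measurable section with norm in
  \<open>E\<close> the section of an element.

  Conversely, in any representing bundle the evaluations \<open>x \<mapsto> \<ell>(x)(\<omega>)\<close> map \<open>U\<^sub>b\<close> onto \<open>X(\<omega>)\<close> with
  norm \<open>p(\<parallel>x\<parallel>)(\<omega>)\<close>. Hence the fibres of two representing bundles are isometric, compatibly with the
  evaluations, and a section is measurable iff it is glued from countably many evaluations.
\<close>

section \<open>Normed algebras on carrier sets\<close>

text \<open>Two kinds of statements are kept apart. What must hold at every point (fibre algebra,
  evaluation, its kernel) comes from the algebraic laws of the lifting on \<open>space M\<close>;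
  positivity, and with it the passage from an almost everywhere inequality to one at a given point,
  is obtained from square roots. What concerns measurable sections holds almost everywhere and is
  reached through p(f) = f a.e. The obstacle lies between the two: an unbounded element has no value
  at a point, so it is tied to its sections by a relation \<open>Rep\<close>, witnessed by a bounded
  weight, instead of an evaluation map. Order completeness enters through sequences with a
  decreasing majorant that tends to 0 almost everywhere; much of the work is to produce such
  majorants inside \<open>E\<close>. Fibres are nonzero when the norms of \<open>U\<close> are
  faithful, because then some element has norm 1 almost everywhere and the lifting gives it norm 1
  in every fibre.\<close>

lemma complex_ring_simps [simp]:
  "carrier complex_ring = UNIV" "\<zero>\<^bsub>complex_ring\<^esub> = 0" "\<one>\<^bsub>complex_ring\<^esub> = 1"
  "x \<oplus>\<^bsub>complex_ring\<^esub> y = x + y" "x \<otimes>\<^bsub>complex_ring\<^esub> y = x * y"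
  by (simp_all add: complex_ring_def)

lemma cring_complex_ring: "cring complex_ring"
proof (rule cringI)
  show "abelian_group complex_ring"
  proof (rule abelian_groupI)
    fix x :: complex
    show "\<exists>y\<in>carrier complex_ring. y \<oplus>\<^bsub>complex_ring\<^esub> x = \<zero>\<^bsub>complex_ring\<^esub>"
      by (intro bexI[of _ "- x"]) auto
  qed auto
  show "comm_monoid complex_ring"
    by (rule comm_monoidI) auto
qed (auto simp: algebra_simps)

lemma uminus_complex_ring: "\<ominus>\<^bsub>complex_ring\<^esub> c = - c"
proof -
  interpret cring complex_ring by (rule cring_complex_ring)
  show ?thesis
    by (rule minus_equality) auto
qed

text \<open>Generic in the record extension, so that one calculus serves both \<open>UbA\<close>, a
  plain module with a different seminorm at each point, and the fibres, whose norm is the record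
  field \<open>fnorm\<close>.\<close>

locale seminormed_alg =
  fixes A :: "(complex, 'b, 'n) module_scheme" (structure) and s :: "'b \<Rightarrow> real"
  assumes alg: "assoc_algebra complex_ring A"
    and s_nonneg: "\<And>x. x \<in> carrier A \<Longrightarrow> 0 \<le> s x"
    and s_scale: "\<And>c x. x \<in> carrier A \<Longrightarrow> s (c \<odot> x) = cmod c * s x"
    and s_add: "\<And>x y. \<lbrakk>x \<in> carrier A; y \<in> carrier A\<rbrakk> \<Longrightarrow> s (x \<oplus> y) \<le> s x + s y"
    and s_mult: "\<And>x y. \<lbrakk>x \<in> carrier A; y \<in> carrier A\<rbrakk> \<Longrightarrow> s (x \<otimes> y) \<le> s x * s y"
begin

sublocale mdl: Module.module complex_ring A
  using alg by (simp add: assoc_algebra_def)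

lemma mult_closed: "\<lbrakk>x \<in> carrier A; y \<in> carrier A\<rbrakk> \<Longrightarrow> x \<otimes> y \<in> carrier A"
  and mult_assoc: "\<lbrakk>x \<in> carrier A; y \<in> carrier A; z \<in> carrier A\<rbrakk> \<Longrightarrow>
        (x \<otimes> y) \<otimes> z = x \<otimes> (y \<otimes> z)"
  and mult_distr_l: "\<lbrakk>x \<in> carrier A; y \<in> carrier A; z \<in> carrier A\<rbrakk> \<Longrightarrow>
        (x \<oplus> y) \<otimes> z = (x \<otimes> z) \<oplus> (y \<otimes> z)"
  and mult_distr_r: "\<lbrakk>x \<in> carrier A; y \<in> carrier A; z \<in> carrier A\<rbrakk> \<Longrightarrow>
        z \<otimes> (x \<oplus> y) = (z \<otimes> x) \<oplus> (z \<otimes> y)"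
  and scale_mult_l: "\<lbrakk>x \<in> carrier A; y \<in> carrier A\<rbrakk> \<Longrightarrow>
        (c \<odot> x) \<otimes> y = c \<odot> (x \<otimes> y)"
  and scale_mult_r: "\<lbrakk>x \<in> carrier A; y \<in> carrier A\<rbrakk> \<Longrightarrow>
        x \<otimes> (c \<odot> y) = c \<odot> (x \<otimes> y)"
  using alg by (auto simp: assoc_algebra_def)

lemma scale_closed [simp, intro]: "x \<in> carrier A \<Longrightarrow> c \<odot> x \<in> carrier A"
  using mdl.smult_closed[of c x] by simp

lemma scale_one: "x \<in> carrier A \<Longrightarrow> 1 \<odot> x = x"
  using mdl.smult_one by simp

lemma scale_scale: "x \<in> carrier A \<Longrightarrow> a \<odot> (b \<odot> x) = (a * b) \<odot> x"
  using mdl.smult_assoc1[of a b x] by simp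

lemma scale_add_left: "x \<in> carrier A \<Longrightarrow> (a + b) \<odot> x = a \<odot> x \<oplus> b \<odot> x"
  using mdl.smult_l_distr[of a b x] by simp

lemma scale_add_right: "\<lbrakk>x \<in> carrier A; y \<in> carrier A\<rbrakk> \<Longrightarrow>
    a \<odot> (x \<oplus> y) = a \<odot> x \<oplus> a \<odot> y"
  using mdl.smult_r_distr[of a x y] by simp

lemma scale_zero_left: "x \<in> carrier A \<Longrightarrow> 0 \<odot> x = \<zero>"
  using mdl.smult_l_null[of x] by simp

lemma uminus_scale: "x \<in> carrier A \<Longrightarrow> \<ominus> x = (- 1) \<odot> x"
  using mdl.smult_l_minus[of 1 x] by (simp add: uminus_complex_ring scale_one)

lemma minus_scale: "\<lbrakk>x \<in> carrier A; y \<in> carrier A\<rbrakk> \<Longrightarrow> x \<ominus> y = x \<oplus> (- 1) \<odot> y"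
  by (simp add: a_minus_def uminus_scale)

lemma s_zero: "s \<zero> = 0"
  using s_scale[of "\<zero>" 0] by (simp add: scale_zero_left)

lemma s_minus_commute: 
  assumes "x \<in> carrier A" "y \<in> carrier A"
  shows "s (x \<ominus> y) = s (y \<ominus> x)"
proof -
  have "y \<ominus> x = (- 1) \<odot> (x \<ominus> y)"
    using assms by (simp add: minus_scale scale_add_right scale_scale scale_one mdl.add.m_comm)
  then show ?thesis
    using assms by (simp add: s_scale)
qed

lemma s_minus_triangle:
  assumes "x \<in> carrier A" "y \<in> carrier A" "z \<in> carrier A"
  shows "s (x \<ominus> z) \<le> s (x \<ominus> y) + s (y \<ominus> z)"
proof -
  have "x \<ominus> z = (x \<ominus> y) \<oplus> (y \<ominus> z)"
    using assms by (simp add: a_minus_def mdl.add.m_assoc mdl.M.r_neg1)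
  then show ?thesis
    using assms by (simp add: s_add)
qed

lemma minus_zero: "x \<in> carrier A \<Longrightarrow> x \<ominus> \<zero> = x"
  using mdl.smult_r_null[of "- 1"] by (simp add: minus_scale)

lemma s_le_minus:
  assumes "x \<in> carrier A" "y \<in> carrier A"
  shows "s x \<le> s y + s (x \<ominus> y)"
  using s_minus_triangle[of x y "\<zero>"] assms
  by (simp add: minus_zero)

lemma abs_s_minus_le:
  assumes "x \<in> carrier A" "y \<in> carrier A"
  shows "\<bar>s x - s y\<bar> \<le> s (x \<ominus> y)"
  using s_le_minus[of x y] s_le_minus[of y x] s_minus_commute[of x y] assms by linarith

lemma minus_add_add:
  assumes "x \<in> carrier A" "y \<in> carrier A" "x' \<in> carrier A" "y' \<in> carrier A"
  shows "(x \<oplus> y) \<ominus> (x' \<oplus> y') = (x \<ominus> x') \<oplus> (y \<ominus> y')"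
  using assms by (simp add: minus_scale scale_add_right mdl.add.m_ac)

text \<open>This split makes the quotient product independent of representatives: each summand
  contains a factor that is a difference of equivalent elements, hence of seminorm 0.\<close>

lemma minus_mult_mult:
  assumes "x \<in> carrier A" "y \<in> carrier A" "x' \<in> carrier A" "y' \<in> carrier A"
  shows "(x \<otimes> y) \<ominus> (x' \<otimes> y')
    = ((x \<ominus> x') \<otimes> y) \<oplus> (x' \<otimes> (y \<ominus> y'))"
proof -
  let ?m = "x' \<otimes> y"
  have c: "x \<otimes> y \<in> carrier A" "?m \<in> carrier A" "x' \<otimes> y' \<in> carrier A"
    using assms by (auto intro: mult_closed)
  have "((x \<ominus> x') \<otimes> y) \<oplus> (x' \<otimes> (y \<ominus> y'))
      = (x \<otimes> y \<ominus> ?m) \<oplus> (?m \<ominus> x' \<otimes> y')"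
    using assms c by (simp add: minus_scale mult_distr_l mult_distr_r scale_mult_l scale_mult_r)
  also have "\<dots> = (x \<otimes> y) \<ominus> (x' \<otimes> y')"
    using c by (simp add: a_minus_def mdl.add.m_assoc mdl.M.r_neg1)
  finally show ?thesis ..
qed

end

subsection \<open>The quotient by a seminorm\<close>

definition seminorm_class :: "('b, 'n) ring_scheme \<Rightarrow> ('b \<Rightarrow> real) \<Rightarrow> 'b \<Rightarrow> 'b set" where
  "seminorm_class A s x = {y \<in> carrier A. s (x \<ominus>\<^bsub>A\<^esub> y) = 0}"

text \<open>The quotient by the kernel, with cosets as sets. Operations choose representatives by
  \<open>SOME\<close>; \<open>add_quot\<close>, \<open>mult_quot\<close>, \<open>scale_quot\<close>
  and \<open>fnorm_quot\<close> show that the choice does not matter on the carrier.\<close>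

definition seminorm_quot :: "(complex, 'b, 'n) module_scheme \<Rightarrow> ('b \<Rightarrow> real) \<Rightarrow> 'b set normed_alg" where
  "seminorm_quot A s =
     \<lparr>carrier = seminorm_class A s ` carrier A,
      monoid.mult = (\<lambda>P Q. seminorm_class A s ((SOME x. x \<in> P) \<otimes>\<^bsub>A\<^esub> (SOME x. x \<in> Q))),
      one = seminorm_class A s \<one>\<^bsub>A\<^esub>,
      zero = seminorm_class A s \<zero>\<^bsub>A\<^esub>,
      add = (\<lambda>P Q. seminorm_class A s ((SOME x. x \<in> P) \<oplus>\<^bsub>A\<^esub> (SOME x. x \<in> Q))),
      smult = (\<lambda>c P. seminorm_class A s (c \<odot>\<^bsub>A\<^esub> (SOME x. x \<in> P))),
      fnorm = (\<lambda>P. s (SOME x. x \<in> P))\<rparr>"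

context seminormed_alg
begin

abbreviation cls where "cls \<equiv> seminorm_class A s"
abbreviation Q where "Q \<equiv> seminorm_quot A s"

lemma self_in_cls: "x \<in> carrier A \<Longrightarrow> x \<in> cls x"
  by (simp add: seminorm_class_def a_minus_def mdl.M.r_neg s_zero)

lemma cls_eq_iff:
  assumes "x \<in> carrier A" "y \<in> carrier A"
  shows "cls x = cls y \<longleftrightarrow> s (x \<ominus> y) = 0"
proof
  assume "cls x = cls y"
  then show "s (x \<ominus> y) = 0"
    using self_in_cls[of y] assms by (auto simp: seminorm_class_def)
next
  assume *: "s (x \<ominus> y) = 0"
  have "s (x \<ominus> z) = 0 \<longleftrightarrow> s (y \<ominus> z) = 0" if z: "z \<in> carrier A" for z
  proof -
    have "0 \<le> s (x \<ominus> z)" "0 \<le> s (y \<ominus> z)"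
      using assms z by (auto intro: s_nonneg)
    then show ?thesis
      using s_minus_triangle[of x y z] s_minus_triangle[of y x z] s_minus_commute[of x y] * assms z
      by auto
  qed
  then show "cls x = cls y"
    by (auto simp: seminorm_class_def)
qed

lemma rep_cls:
  assumes "x \<in> carrier A"
  shows "(SOME y. y \<in> cls x) \<in> carrier A" "s (x \<ominus> (SOME y. y \<in> cls x)) = 0"
proof -
  have "(SOME y. y \<in> cls x) \<in> cls x"
    using self_in_cls[OF assms] by (rule someI)
  then show "(SOME y. y \<in> cls x) \<in> carrier A" "s (x \<ominus> (SOME y. y \<in> cls x)) = 0"
    by (auto simp: seminorm_class_def)
qed

lemma carrier_quot: "carrier Q = cls ` carrier A"
  by (simp add: seminorm_quot_def)

lemma cls_closed [simp, intro]: "x \<in> carrier A \<Longrightarrow> cls x \<in> carrier Q"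
  by (simp add: carrier_quot)

lemma zero_quot: "\<zero>\<^bsub>Q\<^esub> = cls \<zero>"
  by (simp add: seminorm_quot_def)

lemma add_quot:
  assumes x: "x \<in> carrier A" and y: "y \<in> carrier A"
  shows "cls x \<oplus>\<^bsub>Q\<^esub> cls y = cls (x \<oplus> y)"
proof -
  note r = rep_cls[OF x] rep_cls[OF y]
  have "s ((x \<oplus> y) \<ominus> ((SOME z. z \<in> cls x) \<oplus> (SOME z. z \<in> cls y))) \<le> 0"
    using assms r order_trans[OF s_add] by (simp add: minus_add_add)
  then have "cls (x \<oplus> y) = cls ((SOME z. z \<in> cls x) \<oplus> (SOME z. z \<in> cls y))"
    using assms r by (subst cls_eq_iff) (auto intro!: antisym s_nonneg)
  then show ?thesis by (simp add: seminorm_quot_def)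
qed

lemma mult_quot:
  assumes x: "x \<in> carrier A" and y: "y \<in> carrier A"
  shows "cls x \<otimes>\<^bsub>Q\<^esub> cls y = cls (x \<otimes> y)"
proof -
  define x' y' where "x' = (SOME z. z \<in> cls x)" and "y' = (SOME z. z \<in> cls y)"
  have r: "x' \<in> carrier A" "y' \<in> carrier A" "s (x \<ominus> x') = 0" "s (y \<ominus> y') = 0"
    using rep_cls[OF x] rep_cls[OF y] by (auto simp: x'_def y'_def)
  have "s ((x \<otimes> y) \<ominus> (x' \<otimes> y'))
      \<le> s ((x \<ominus> x') \<otimes> y) + s (x' \<otimes> (y \<ominus> y'))"
    using assms r by (simp add: minus_mult_mult s_add mult_closed)
  also have "\<dots> \<le> s (x \<ominus> x') * s y + s x' * s (y \<ominus> y')"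
    using assms r by (intro add_mono s_mult) auto
  finally have "s ((x \<otimes> y) \<ominus> (x' \<otimes> y')) \<le> 0"
    using r by simp
  then have "cls (x \<otimes> y) = cls (x' \<otimes> y')"
    using assms r by (subst cls_eq_iff) (auto intro!: antisym s_nonneg mult_closed)
  then show ?thesis by (simp add: seminorm_quot_def x'_def y'_def)
qed

lemma scale_quot:
  assumes x: "x \<in> carrier A"
  shows "c \<odot>\<^bsub>Q\<^esub> cls x = cls (c \<odot> x)"
proof -
  define x' where "x' = (SOME z. z \<in> cls x)"
  have r: "x' \<in> carrier A" "s (x \<ominus> x') = 0"
    using rep_cls[OF x] by (auto simp: x'_def)
  have "c \<odot> x \<ominus> c \<odot> x' = c \<odot> (x \<ominus> x')"
    using assms r by (simp add: minus_scale scale_add_right scale_scale)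
  then have "s (c \<odot> x \<ominus> c \<odot> x') = 0"
    using assms r by (simp add: s_scale)
  then have "cls (c \<odot> x) = cls (c \<odot> x')"
    using assms r by (subst cls_eq_iff) auto
  then show ?thesis by (simp add: seminorm_quot_def x'_def)
qed

lemma fnorm_quot:
  assumes x: "x \<in> carrier A"
  shows "fnorm Q (cls x) = s x"
proof -
  have "fnorm Q (cls x) = s (SOME y. y \<in> cls x)"
    by (simp add: seminorm_quot_def)
  then show ?thesis
    using abs_s_minus_le[OF x rep_cls(1)[OF x]] rep_cls(2)[OF x] by simp
qed

lemma assoc_algebra_quot: "assoc_algebra complex_ring Q"
proof -
  have "abelian_group Q"
  proof (rule abelian_groupI)
    fix P assume "P \<in> carrier Q"
    then obtain x where x: "x \<in> carrier A" "P = cls x"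
      by (auto simp: carrier_quot)
    then have "cls (\<ominus> x) \<oplus>\<^bsub>Q\<^esub> P = \<zero>\<^bsub>Q\<^esub>"
      by (simp add: add_quot zero_quot mdl.M.l_neg)
    then show "\<exists>R\<in>carrier Q. R \<oplus>\<^bsub>Q\<^esub> P = \<zero>\<^bsub>Q\<^esub>"
      using x by auto
  qed (auto simp: carrier_quot add_quot zero_quot mdl.add.m_ac)
  then have "Module.module complex_ring Q"
    by (intro moduleI cring_complex_ring)
       (auto simp: carrier_quot add_quot zero_quot scale_quot scale_add_left scale_add_right
          scale_scale scale_one)
  then show ?thesis
    by (auto simp: assoc_algebra_def carrier_quot add_quot mult_quot scale_quot mult_closed
         mult_assoc mult_distr_l mult_distr_r scale_mult_l scale_mult_r)
qed

lemma seminormed_alg_quot: "seminormed_alg Q (fnorm Q)"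
  by unfold_locales
     (auto simp: assoc_algebra_quot carrier_quot add_quot mult_quot scale_quot mult_closed fnorm_quot
        s_nonneg s_scale s_add s_mult)

lemma minus_quot:
  assumes "x \<in> carrier A" "y \<in> carrier A"
  shows "cls x \<ominus>\<^bsub>Q\<^esub> cls y = cls (x \<ominus> y)"
proof -
  interpret q: seminormed_alg Q "fnorm Q" by (rule seminormed_alg_quot)
  show ?thesis
    using assms by (simp add: minus_scale q.minus_scale scale_quot add_quot)
qed

lemma fnorm_quot_eq_0_iff: "P \<in> carrier Q \<Longrightarrow> fnorm Q P = 0 \<longleftrightarrow> P = \<zero>\<^bsub>Q\<^esub>"
  by (elim imageE[of P cls "carrier A", folded carrier_quot])
     (simp add: zero_quot fnorm_quot cls_eq_iff minus_zero)

end

locale normed_carrier_alg = seminormed_alg X "fnorm X"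
  for X :: "'b normed_alg" +
  assumes fnorm_eq_0_iff: "x \<in> carrier X \<Longrightarrow> fnorm X x = 0 \<longleftrightarrow> x = \<zero>\<^bsub>X\<^esub>"
begin

lemma minus_eq_zero_iff:
  assumes "x \<in> carrier X" "y \<in> carrier X"
  shows "x \<ominus>\<^bsub>X\<^esub> y = \<zero>\<^bsub>X\<^esub> \<longleftrightarrow> x = y"
proof -
  have "(x \<ominus>\<^bsub>X\<^esub> y) \<oplus>\<^bsub>X\<^esub> y = x"
    using assms by (simp add: a_minus_def mdl.add.m_assoc mdl.M.l_neg)
  then show ?thesis
    using assms by (auto simp: a_minus_def mdl.M.r_neg)
qed

lemma fnorm_minus_eq_0_iff:
  assumes "x \<in> carrier X" "y \<in> carrier X"
  shows "fnorm X (x \<ominus>\<^bsub>X\<^esub> y) = 0 \<longleftrightarrow> x = y"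
  using assms by (simp add: fnorm_eq_0_iff minus_eq_zero_iff)

lemma metric: "Metric_space (carrier X) (fdist X)"
  by unfold_locales
     (auto simp: fdist_def s_nonneg s_minus_commute fnorm_minus_eq_0_iff s_minus_triangle)

text \<open>In the bundle constructed below the sections, and also the lifted sections, exhaust
  every fibre, so both density requirements reduce to this.\<close>

lemma dense_in_alg_carrier: "dense_in_alg X (carrier X)"
proof -
  interpret Metric_space "carrier X" "fdist X" by (rule metric)
  show ?thesis
    using closure_of_topspace[of mtopology] by (simp add: dense_in_alg_def)
qed

end

lemma banach_alg_normed: "banach_alg X \<Longrightarrow> normed_carrier_alg X"
  by unfold_locales (auto simp: banach_alg_def)

lemma (in normed_carrier_alg) banach_algI:
  "Metric_space.mcomplete (carrier X) (fdist X) \<Longrightarrow> banach_alg X"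
  by (auto simp: banach_alg_def alg s_nonneg fnorm_eq_0_iff s_scale s_add s_mult)

lemma (in seminormed_alg) normed_quot: "normed_carrier_alg Q"
  by (intro normed_carrier_alg.intro seminormed_alg_quot normed_carrier_alg_axioms.intro
      fnorm_quot_eq_0_iff)

text \<open>Think of \<open>t x r\<close> as \<open>\<parallel>x\<parallel> \<le> r\<close> for a complete norm on \<open>A\<close> whose quotient norm is \<open>s\<close>.\<close>

lemma (in seminormed_alg) quot_banach_alg:
  assumes lift: "\<And>x r. \<lbrakk>x \<in> carrier A; s x < r\<rbrakk> \<Longrightarrow> \<exists>y\<in>carrier A. s (x \<ominus> y) = 0 \<and> t y r"
    and complete: "\<And>f. \<lbrakk>\<And>n. f n \<in> carrier A; \<And>n. t (f (Suc n) \<ominus> f n) ((1/2) ^ n)\<rbrakk> \<Longrightarrow>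
        \<exists>x\<in>carrier A. \<forall>n. s (x \<ominus> f n) \<le> 2 * (1/2) ^ n"
  shows "banach_alg Q"
proof -
  interpret q: normed_carrier_alg Q by (rule normed_quot)
  interpret Metric_space "carrier Q" "Defs.fdist Q" by (rule q.metric)
  have "\<exists>L. limitin mtopology \<sigma> L sequentially" if "MCauchy \<sigma>" for \<sigma>
  proof -
    have car: "\<sigma> n \<in> carrier Q" for n
      using that by (auto simp: MCauchy_def)
    have "\<exists>N. \<forall>n\<ge>N. \<forall>n'\<ge>N. Defs.fdist Q (\<sigma> n) (\<sigma> n') < (1/2) ^ k" for k
      using that by (auto simp: MCauchy_def)
    then obtain N where N: "\<And>k n n'. \<lbrakk>n \<ge> N k; n' \<ge> N k\<rbrakk> \<Longrightarrow> Defs.fdist Q (\<sigma> n) (\<sigma> n') < (1/2) ^ k"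
      by metis
    \<comment> \<open>Summing \<open>Suc (N j)\<close> gives indices that increase strictly and
      still satisfy \<open>r k \<ge> N k\<close>, so consecutive terms of the subsequence are closer
      than (1/2)^k.\<close>
    define r where "r k = (\<Sum>j\<le>k. Suc (N j))" for k
    have r_Suc: "r (Suc k) = r k + Suc (N (Suc k))" for k
      by (simp add: r_def)
    have mono: "strict_mono r"
      by (rule strict_monoI_Suc) (simp add: r_Suc)
    have rN: "r k \<ge> N k" for k
      by (cases k) (auto simp: r_def)
    have small: "Defs.fdist Q (\<sigma> (r (Suc k))) (\<sigma> (r k)) < (1/2) ^ k" for k
      using rN[of k] by (intro N) (auto simp: r_Suc)
    \<comment> \<open>Only the difference of two representatives has to be small in the sense of
      \<open>t\<close>. An arbitrary representative \<open>z\<close> of the next class is therefore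
      replaced by \<open>v \<oplus> x\<close>, where \<open>v\<close> is a controlled representative
      of the class of \<open>z \<ominus> x\<close>.\<close>
    have step: "\<exists>y\<in>carrier A. cls y = \<sigma> (r (Suc k)) \<and> t (y \<ominus> x) ((1/2) ^ k)"
      if x: "x \<in> carrier A" "cls x = \<sigma> (r k)" for x k
    proof -
      obtain z where z: "z \<in> carrier A" "cls z = \<sigma> (r (Suc k))"
        using car[of "r (Suc k)"] by (auto simp: carrier_quot)
      have "s (z \<ominus> x) < (1/2) ^ k"
        using small[of k] x(1) z(1) unfolding x(2)[symmetric] z(2)[symmetric]
        by (simp add: Defs.fdist_def minus_quot fnorm_quot)
      then obtain v where v: "v \<in> carrier A" "s ((z \<ominus> x) \<ominus> v) = 0" "t v ((1/2) ^ k)"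
        using lift[OF mdl.M.minus_closed[OF z(1) x(1)]] by blast
      have "v \<oplus> x \<ominus> x = v"
        using v x by (simp add: a_minus_def mdl.add.m_assoc mdl.M.r_neg)
      moreover have "z \<ominus> (v \<oplus> x) = (z \<ominus> x) \<ominus> v"
        using v x z by (simp add: minus_scale scale_add_right mdl.add.m_ac)
      then have "cls z = cls (v \<oplus> x)"
        using v x z by (subst cls_eq_iff) auto
      ultimately show ?thesis
        using v x z by (intro bexI[of _ "v \<oplus> x"]) auto
    qed
    obtain x0 where x0: "x0 \<in> carrier A" "cls x0 = \<sigma> (r 0)"
      using car[of "r 0"] by (auto simp: carrier_quot)
    have "\<exists>f. \<forall>k. (f k \<in> carrier A \<and> cls (f k) = \<sigma> (r k)) \<and> t (f (Suc k) \<ominus> f k) ((1/2) ^ k)"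
    proof (rule dependent_nat_choice)
      show "\<exists>x. x \<in> carrier A \<and> cls x = \<sigma> (r 0)"
        using x0 by blast
    next
      fix x k assume "x \<in> carrier A \<and> cls x = \<sigma> (r k)"
      then show "\<exists>y. (y \<in> carrier A \<and> cls y = \<sigma> (r (Suc k))) \<and> t (y \<ominus> x) ((1/2) ^ k)"
        using step[of x k] by blast
    qed
    then obtain f where f: "\<And>k. f k \<in> carrier A" "\<And>k. cls (f k) = \<sigma> (r k)"
      "\<And>k. t (f (Suc k) \<ominus> f k) ((1/2) ^ k)"
      by blast
    obtain x where x: "x \<in> carrier A" "\<And>n. s (x \<ominus> f n) \<le> 2 * (1/2) ^ n"
      using complete[OF f(1,3)] by blast
    have d: "Defs.fdist Q (\<sigma> (r n)) (cls x) \<le> 2 * (1/2) ^ n" for n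
      using x(1) x(2)[of n] f(1)[of n] s_minus_commute[of x "f n"]
      by (simp add: Defs.fdist_def minus_quot fnorm_quot flip: f(2))
    have "(\<lambda>n. 2 * (1/2::real) ^ n) \<longlonglongrightarrow> 2 * 0"
      by (intro tendsto_intros LIMSEQ_realpow_zero) auto
    then have "(\<lambda>n. 2 * (1/2::real) ^ n) \<longlonglongrightarrow> 0"
      by simp
    then have "(\<lambda>n. Defs.fdist Q (\<sigma> (r n)) (cls x)) \<longlonglongrightarrow> 0"
      by (rule Lim_null_comparison[rotated]) (simp add: d)
    then have "limitin mtopology (\<sigma> \<circ> r) (cls x) sequentially"
      using x(1) car unfolding limitin_metric
      by (auto simp: tendsto_iff dist_real_def)
    then have "limitin mtopology \<sigma> (cls x) sequentially"
      using MCauchy_convergent_subsequence[OF that mono] by blast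
    then show ?thesis ..
  qed
  then have mcomplete
    by (simp add: mcomplete_def)
  then show ?thesis
    by (rule q.banach_algI)
qed

section \<open>Measurable sections\<close>

locale weak_bundle =
  fixes M :: "'a measure" and X :: "'a \<Rightarrow> 'b normed_alg" and L :: "('a \<rightharpoonup> 'b) set"
  assumes weak_bundle: "weak_measurable_bundle M X L"
begin

lemma fibre: "w \<in> space M \<Longrightarrow> normed_carrier_alg (X w)"
  using weak_bundle by (intro banach_alg_normed) (simp add: weak_measurable_bundle_def)

lemma L_section: "c \<in> L \<Longrightarrow> is_section M X c"
  using weak_bundle by (simp add: weak_measurable_bundle_def)

lemma AE_section:
  assumes "is_section M X u"
  shows "AE w in M. w \<in> space M \<and> u w = Some (the (u w)) \<and> the (u w) \<in> carrier (X w)"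
proof -
  have "AE w in M. w \<in> dom u"
    using assms by (simp add: is_section_def)
  then show ?thesis
    using AE_space by eventually_elim (use assms in \<open>auto simp: is_section_def\<close>)
qed

lemma L_comb:
  assumes "c \<in> L" "d \<in> L"
  shows "\<exists>e\<in>L. AE w in M. the (e w) = (s \<odot>\<^bsub>X w\<^esub> the (c w)) \<oplus>\<^bsub>X w\<^esub> (t \<odot>\<^bsub>X w\<^esub> the (d w))"
proof (intro bexI)
  let ?e = "sec_add X (sec_scale X (\<lambda>_. s) c) (sec_scale X (\<lambda>_. t) d)"
  show "?e \<in> L"
    using weak_bundle assms by (simp add: weak_measurable_bundle_def)
  show "AE w in M. the (?e w) = (s \<odot>\<^bsub>X w\<^esub> the (c w)) \<oplus>\<^bsub>X w\<^esub> (t \<odot>\<^bsub>X w\<^esub> the (d w))"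
    using AE_section[OF L_section[OF assms(1)]] AE_section[OF L_section[OF assms(2)]]
    by eventually_elim (auto simp: sec_add_def sec_scale_def dom_def)
qed

text \<open>\<open>dom c\<close> is conull but need not be measurable. The norm is restricted to a
  measurable conull subset of it and extended by 0, which turns trace measurability into
  measurability on \<open>M\<close>.\<close>

lemma L_norm:
  assumes "c \<in> L"
  shows "\<exists>m\<in>borel_measurable M. AE w in M. m w = fnorm (X w) (the (c w))"
proof -
  have "AE w in M. w \<in> dom c" and sub: "dom c \<subseteq> space M"
    using L_section[OF assms] by (auto simp: is_section_def)
  then obtain N where "{w \<in> space M. w \<notin> dom c} \<subseteq> N" "emeasure M N = 0" "N \<in> sets M"
    using AE_E by blast
  then have N: "N \<in> null_sets M" "\<And>w. \<lbrakk>w \<in> space M; w \<notin> dom c\<rbrakk> \<Longrightarrow> w \<in> N"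
    by auto
  let ?D = "space M - N"
  have D: "?D \<in> sets M" "?D \<subseteq> dom c"
    using N by (auto intro: null_setsD2)
  have "sec_norm X c \<in> borel_measurable (restrict_space M (dom c))"
    using weak_bundle assms by (simp add: weak_measurable_bundle_def)
  then have "sec_norm X c \<in> borel_measurable (restrict_space M ?D)"
    using D(2) by (rule measurable_restrict_mono)
  then have "(\<lambda>w. indicator ?D w *\<^sub>R sec_norm X c w) \<in> borel_measurable M"
    using D(1) by (simp add: borel_measurable_restrict_space_iff)
  moreover have "AE w in M. indicator ?D w *\<^sub>R sec_norm X c w = fnorm (X w) (the (c w))"
    using AE_not_in[OF N(1)] AE_space by eventually_elim (auto simp: sec_norm_def)
  ultimately show ?thesis
    by (intro bexI[of _ "\<lambda>w. indicator ?D w *\<^sub>R sec_norm X c w"])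
qed

lemma finsum_fibre_empty: "w \<in> space M \<Longrightarrow> finsum (X w) f {} = \<zero>\<^bsub>X w\<^esub>"
proof -
  assume "w \<in> space M"
  then interpret normed_carrier_alg "X w" by (rule fibre)
  show ?thesis by simp
qed

text \<open>Simple sections modulo null sets, as total functions built one summand at a time. This
  replaces domains and finite sums over fibres by an induction principle; \<open>asimple_iff\<close>
  is the link with \<open>simple_section\<close>.\<close>

inductive asimple :: "('a \<Rightarrow> 'b) \<Rightarrow> bool" where
  zero: "(AE w in M. f w = \<zero>\<^bsub>X w\<^esub>) \<Longrightarrow> asimple f"
| step: "\<lbrakk>asimple f; c \<in> L; A \<in> sets M;
    AE w in M. g w = f w \<oplus>\<^bsub>X w\<^esub> (indicator A w \<odot>\<^bsub>X w\<^esub> the (c w))\<rbrakk> \<Longrightarrow> asimple g"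

lemma zero_closed: "w \<in> space M \<Longrightarrow> \<zero>\<^bsub>X w\<^esub> \<in> carrier (X w)"
proof -
  assume "w \<in> space M"
  then interpret normed_carrier_alg "X w" by (rule fibre)
  show ?thesis by simp
qed

lemma AE_zero_closed: "AE w in M. \<zero>\<^bsub>X w\<^esub> \<in> carrier (X w)"
  using AE_space by eventually_elim (rule zero_closed)

lemma asimple_closed: "asimple f \<Longrightarrow> AE w in M. f w \<in> carrier (X w)"
proof (induction rule: asimple.induct)
  case (zero f)
  then show ?case
    using AE_zero_closed by eventually_elim auto
next
  case (step f c A g)
  from step.hyps(4) step.IH AE_section[OF L_section[OF step.hyps(2)]] show ?case
  proof eventually_elim
    case (elim w)
    then interpret normed_carrier_alg "X w" by (intro fibre) auto
    show ?case using elim by simp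
  qed
qed

lemma asimple_cong:
  assumes "asimple f" "AE w in M. g w = f w"
  shows "asimple g"
  using assms(1)
proof cases
  case zero
  then have "AE w in M. g w = \<zero>\<^bsub>X w\<^esub>"
    using assms(2) by eventually_elim auto
  then show ?thesis by (rule asimple.zero)
next
  case (step f' c A)
  then have "AE w in M. g w = f' w \<oplus>\<^bsub>X w\<^esub> (indicator A w \<odot>\<^bsub>X w\<^esub> the (c w))"
    using assms(2) by (auto elim: AE_mp)
  then show ?thesis by (rule asimple.step[OF step(1-3)])
qed

lemma asimple_iff: "asimple f \<longleftrightarrow> (\<exists>s. simple_section M X L s \<and> (AE w in M. s w = Some (f w)))"
proof
  assume "asimple f"
  then show "\<exists>s. simple_section M X L s \<and> (AE w in M. s w = Some (f w))"
  proof (induction rule: asimple.induct)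
    case (zero f)
    let ?s = "\<lambda>w. if w \<in> space M then Some \<zero>\<^bsub>X w\<^esub> else None"
    have "simple_section M X L ?s"
      unfolding simple_section_def
      \<comment> \<open>The empty sum: with \<open>n = 0\<close> there is no condition on the sets
        and sections, so any will do.\<close>
      by (intro exI[of _ 0] exI[of _ "\<lambda>_. {}"] exI[of _ "\<lambda>_. Map.empty"])
         (auto simp: finsum_fibre_empty fun_eq_iff)
    moreover have "AE w in M. ?s w = Some (f w)"
      using zero AE_space by eventually_elim auto
    ultimately show ?case by blast
  next
    case (step f c A g)
    then obtain s where s: "simple_section M X L s" "AE w in M. s w = Some (f w)" by blast
    from s(1) obtain n :: nat and B e where e0: "\<forall>i<n. B i \<in> sets M \<and> e i \<in> L" and e3:
      "s = (\<lambda>w. if w \<in> space M \<and> (\<forall>i<n. w \<in> dom (e i))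
                 then Some (finsum (X w) (\<lambda>i. indicator (B i) w \<odot>\<^bsub>X w\<^esub> the (e i w)) {..<n})
                 else None)"
      unfolding simple_section_def by blast
    have e: "\<And>i. i < n \<Longrightarrow> B i \<in> sets M" "\<And>i. i < n \<Longrightarrow> e i \<in> L"
      using e0 by auto
    define e' where "e' = e(n := c)"
    define B' where "B' = B(n := A)"
    let ?s = "\<lambda>w. if w \<in> space M \<and> (\<forall>i<Suc n. w \<in> dom (e' i))
                 then Some (finsum (X w) (\<lambda>i. indicator (B' i) w \<odot>\<^bsub>X w\<^esub> the (e' i w)) {..<Suc n})
                 else None"
    have "simple_section M X L ?s"
      unfolding simple_section_def using e step.hyps
      by (intro exI[of _ "Suc n"] exI[of _ B'] exI[of _ e']) (auto simp: e'_def B'_def less_Suc_eq)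
    moreover have "AE w in M. ?s w = Some (g w)"
      using s(2) step.hyps(4) AE_section[OF L_section[OF step.hyps(2)]]
        asimple_closed[OF step.hyps(1)]
    proof eventually_elim
      case (elim w)
      then interpret normed_carrier_alg "X w" by (intro fibre) auto
      have dom: "w \<in> dom (e i)" if "i < n" for i
        using elim(1) that unfolding e3 by (auto split: if_splits)
      then have car: "the (e i w) \<in> carrier (X w)" if "i < n" for i
        using L_section[of "e i"] e(2)[OF that] that by (auto simp: is_section_def)
      have f: "f w = finsum (X w) (\<lambda>i. indicator (B i) w \<odot>\<^bsub>X w\<^esub> the (e i w)) {..<n}"
        using elim(1) unfolding e3 by (auto split: if_splits)
      have "finsum (X w) (\<lambda>i. indicator (B' i) w \<odot>\<^bsub>X w\<^esub> the (e' i w)) {..<Suc n}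
        = (indicator A w \<odot>\<^bsub>X w\<^esub> the (c w)) \<oplus>\<^bsub>X w\<^esub>
          finsum (X w) (\<lambda>i. indicator (B' i) w \<odot>\<^bsub>X w\<^esub> the (e' i w)) {..<n}"
        unfolding lessThan_Suc using car elim
        by (subst mdl.M.finsum_insert) (auto simp: e'_def B'_def)
      also have "finsum (X w) (\<lambda>i. indicator (B' i) w \<odot>\<^bsub>X w\<^esub> the (e' i w)) {..<n} = f w"
        unfolding f using car by (intro mdl.M.finsum_cong') (auto simp: e'_def B'_def)
      finally show ?case
        using elim dom by (auto simp: mdl.add.m_comm e'_def less_Suc_eq)
    qed
    ultimately show ?case by blast
  qed
next
  assume "\<exists>s. simple_section M X L s \<and> (AE w in M. s w = Some (f w))"
  then obtain s where s: "simple_section M X L s" "AE w in M. s w = Some (f w)" by blast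
  from s(1) obtain n :: nat and B e where e0: "\<forall>i<n. B i \<in> sets M \<and> e i \<in> L" and e3:
    "s = (\<lambda>w. if w \<in> space M \<and> (\<forall>i<n. w \<in> dom (e i))
               then Some (finsum (X w) (\<lambda>i. indicator (B i) w \<odot>\<^bsub>X w\<^esub> the (e i w)) {..<n})
               else None)"
    unfolding simple_section_def by blast
  have e: "\<And>i. i < n \<Longrightarrow> B i \<in> sets M" "\<And>i. i < n \<Longrightarrow> e i \<in> L"
    using e0 by auto
  have dom: "AE w in M. w \<in> space M \<and> (\<forall>i<n. the (e i w) \<in> carrier (X w))"
  proof -
    have "AE w in M. \<forall>i\<in>{..<n}. the (e i w) \<in> carrier (X w)"
    proof (rule AE_finite_allI)
      fix i assume "i \<in> {..<n}"
      then show "AE w in M. the (e i w) \<in> carrier (X w)"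
        using AE_section[OF L_section[of "e i"]] e(2)[of i] by auto
    qed auto
    then show ?thesis using AE_space by eventually_elim auto
  qed
  have "asimple (\<lambda>w. finsum (X w) (\<lambda>i. indicator (B i) w \<odot>\<^bsub>X w\<^esub> the (e i w)) {..<k})"
    if "k \<le> n" for k
    using that
  proof (induction k)
    case 0
    show ?case by (rule asimple.zero) (use AE_space in \<open>eventually_elim, auto simp: finsum_fibre_empty\<close>)
  next
    case (Suc k)
    then have "asimple (\<lambda>w. finsum (X w) (\<lambda>i. indicator (B i) w \<odot>\<^bsub>X w\<^esub> the (e i w)) {..<k})"
      by simp
    then show ?case
    proof (rule asimple.step)
      show "e k \<in> L" "B k \<in> sets M"
        using Suc.prems e(1,2) by auto
      show "AE w in M. finsum (X w) (\<lambda>i. indicator (B i) w \<odot>\<^bsub>X w\<^esub> the (e i w)) {..<Suc k}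
        = finsum (X w) (\<lambda>i. indicator (B i) w \<odot>\<^bsub>X w\<^esub> the (e i w)) {..<k} \<oplus>\<^bsub>X w\<^esub>
          (indicator (B k) w \<odot>\<^bsub>X w\<^esub> the (e k w))"
        using dom
      proof eventually_elim
        case (elim w)
        then interpret normed_carrier_alg "X w" by (intro fibre) auto
        show ?case
          unfolding lessThan_Suc using elim Suc.prems
          by (subst mdl.M.finsum_insert) (auto intro!: mdl.add.m_comm mdl.M.finsum_closed)
      qed
    qed
  qed
  from this[OF order_refl] show "asimple f"
    by (rule asimple_cong) (use s(2) in \<open>eventually_elim, auto simp: e3 split: if_splits\<close>)
qed

lemma asimple_add:
  assumes "asimple f" "asimple g" "AE w in M. h w = f w \<oplus>\<^bsub>X w\<^esub> g w"
  shows "asimple h"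
  using assms(2,3)
proof (induction arbitrary: h rule: asimple.induct)
  case (zero g)
  have "AE w in M. h w = f w"
    using zero AE_space asimple_closed[OF assms(1)]
  proof eventually_elim
    case (elim w)
    then interpret normed_carrier_alg "X w" by (intro fibre) auto
    show ?case using elim by simp
  qed
  then show ?case by (rule asimple_cong[OF assms(1)])
next
  case (step g c A g')
  have "asimple (\<lambda>w. f w \<oplus>\<^bsub>X w\<^esub> g w)"
    by (rule step.IH) simp
  then show ?case
  proof (rule asimple.step[OF _ step.hyps(2,3)])
    show "AE w in M. h w = f w \<oplus>\<^bsub>X w\<^esub> g w \<oplus>\<^bsub>X w\<^esub> indicator A w \<odot>\<^bsub>X w\<^esub> the (c w)"
      using step.hyps(4) step.prems asimple_closed[OF assms(1)] asimple_closed[OF step.hyps(1)]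
        AE_section[OF L_section[OF step.hyps(2)]]
    proof eventually_elim
      case (elim w)
      then interpret normed_carrier_alg "X w" by (intro fibre) auto
      show ?case using elim by (simp add: mdl.add.m_assoc)
    qed
  qed
qed

text \<open>Every summand keeps its section and has its set intersected with
  \<open>B\<close>.\<close>

lemma asimple_restrict:
  assumes "asimple f" "B \<in> sets M" "AE w in M. h w = (if w \<in> B then f w else \<zero>\<^bsub>X w\<^esub>)"
  shows "asimple h"
  using assms(1,3)
proof (induction arbitrary: h rule: asimple.induct)
  case (zero f)
  have "AE w in M. h w = \<zero>\<^bsub>X w\<^esub>"
    using zero by eventually_elim auto
  then show ?case by (rule asimple.zero)
next
  case (step f c A f')
  have "asimple (\<lambda>w. if w \<in> B then f w else \<zero>\<^bsub>X w\<^esub>)"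
    by (rule step.IH) simp
  then show ?case
  proof (rule asimple.step[OF _ step.hyps(2)])
    show "A \<inter> B \<in> sets M" using assms step by auto
    show "AE w in M. h w = (if w \<in> B then f w else \<zero>\<^bsub>X w\<^esub>) \<oplus>\<^bsub>X w\<^esub>
        indicator (A \<inter> B) w \<odot>\<^bsub>X w\<^esub> the (c w)"
      using step.hyps(4) step.prems AE_section[OF L_section[OF step.hyps(2)]]
    proof eventually_elim
      case (elim w)
      then interpret normed_carrier_alg "X w" by (intro fibre) auto
      show ?case using elim by (auto simp: indicator_def scale_zero_left)
    qed
  qed
qed

lemma asimple_If:
  assumes "asimple f" "asimple g" "B \<in> sets M"
  shows "asimple (\<lambda>w. if w \<in> B then f w else g w)"
proof (rule asimple_add)
  show "asimple (\<lambda>w. if w \<in> B then f w else \<zero>\<^bsub>X w\<^esub>)"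
    using assms(1,3) by (rule asimple_restrict) simp
  show "asimple (\<lambda>w. if w \<in> space M - B then g w else \<zero>\<^bsub>X w\<^esub>)"
    by (rule asimple_restrict[OF assms(2), of "space M - B"]) (use assms in auto)
  show "AE w in M. (if w \<in> B then f w else g w) = (if w \<in> B then f w else \<zero>\<^bsub>X w\<^esub>) \<oplus>\<^bsub>X w\<^esub>
      (if w \<in> space M - B then g w else \<zero>\<^bsub>X w\<^esub>)"
    using AE_space asimple_closed[OF assms(1)] asimple_closed[OF assms(2)]
  proof eventually_elim
    case (elim w)
    then interpret normed_carrier_alg "X w" by (intro fibre) auto
    show ?case using elim by auto
  qed
qed

lemma asimple_L: "c \<in> L \<Longrightarrow> asimple (\<lambda>w. the (c w))"
proof (rule asimple.step[OF asimple.zero, of "\<lambda>w. \<zero>\<^bsub>X w\<^esub>"])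
  assume c: "c \<in> L"
  show "AE w in M. the (c w) = \<zero>\<^bsub>X w\<^esub> \<oplus>\<^bsub>X w\<^esub> indicator (space M) w \<odot>\<^bsub>X w\<^esub> the (c w)"
    using AE_section[OF L_section[OF c]]
  proof eventually_elim
    case (elim w)
    then interpret normed_carrier_alg "X w" by (intro fibre) auto
    show ?case using elim by (auto simp: scale_one)
  qed
qed auto

text \<open>Measurability is given only for norms of members of \<open>L\<close>, and norms are not
  additive, so the induction carries an arbitrary shift \<open>d\<close>. The last summand is
  \<open>c\<close> on \<open>A\<close> and 0 elsewhere: on \<open>A\<close> it is absorbed into the
  shift, since \<open>d + c\<close> is again in \<open>L\<close>, and off \<open>A\<close> the shift
  stays \<open>d\<close>. The two measurable norms are then pasted along \<open>A\<close>.\<close>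

lemma asimple_norm_shift:
  assumes "asimple f" "d \<in> L"
  shows "\<exists>m\<in>borel_measurable M. AE w in M. m w = fnorm (X w) (the (d w) \<oplus>\<^bsub>X w\<^esub> f w)"
  using assms
proof (induction arbitrary: d rule: asimple.induct)
  case (zero f)
  obtain m where m: "m \<in> borel_measurable M" "AE w in M. m w = fnorm (X w) (the (d w))"
    using L_norm[OF zero.prems] by blast
  have "AE w in M. m w = fnorm (X w) (the (d w) \<oplus>\<^bsub>X w\<^esub> f w)"
    using m(2) zero.hyps AE_section[OF L_section[OF zero.prems]]
  proof eventually_elim
    case (elim w)
    then interpret normed_carrier_alg "X w" by (intro fibre) auto
    show ?case using elim by simp
  qed
  then show ?case using m by blast
next
  case (step f c A g)
  obtain e where e: "e \<in> L"
    "AE w in M. the (e w) = (1 \<odot>\<^bsub>X w\<^esub> the (d w)) \<oplus>\<^bsub>X w\<^esub> (1 \<odot>\<^bsub>X w\<^esub> the (c w))"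
    using L_comb[OF step.prems step.hyps(2)] by blast
  obtain m where m: "m \<in> borel_measurable M"
    "AE w in M. m w = fnorm (X w) (the (d w) \<oplus>\<^bsub>X w\<^esub> f w)"
    using step.IH[OF step.prems] by blast
  obtain m' where m': "m' \<in> borel_measurable M"
    "AE w in M. m' w = fnorm (X w) (the (e w) \<oplus>\<^bsub>X w\<^esub> f w)"
    using step.IH[OF e(1)] by blast
  let ?m = "\<lambda>w. if w \<in> A then m' w else m w"
  have "?m \<in> borel_measurable M"
    using m(1) m'(1) step.hyps(3) by measurable
  moreover have "AE w in M. ?m w = fnorm (X w) (the (d w) \<oplus>\<^bsub>X w\<^esub> g w)"
    using m(2) m'(2) e(2) step.hyps(4) AE_section[OF L_section[OF step.prems]]
      AE_section[OF L_section[OF step.hyps(2)]] asimple_closed[OF step.hyps(1)]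
  proof eventually_elim
    case (elim w)
    then interpret normed_carrier_alg "X w" by (intro fibre) auto
    show ?case
      using elim by (auto simp: scale_zero_left scale_one mdl.add.m_ac)
  qed
  ultimately show ?case by (intro bexI[of _ ?m])
qed

lemma asimple_norm:
  assumes "asimple f"
  shows "\<exists>m\<in>borel_measurable M. AE w in M. m w = fnorm (X w) (f w)"
proof (cases "L = {}")
  case False
  then obtain c where c: "c \<in> L" by blast
  \<comment> \<open>The combination 0c + 0c vanishes almost everywhere and lies in \<open>L\<close>,
    so shifting by it does not change the norm.\<close>
  obtain e where e: "e \<in> L"
    "AE w in M. the (e w) = (0 \<odot>\<^bsub>X w\<^esub> the (c w)) \<oplus>\<^bsub>X w\<^esub> (0 \<odot>\<^bsub>X w\<^esub> the (c w))"
    using L_comb[OF c c] by blast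
  obtain m where m: "m \<in> borel_measurable M"
    "AE w in M. m w = fnorm (X w) (the (e w) \<oplus>\<^bsub>X w\<^esub> f w)"
    using asimple_norm_shift[OF assms e(1)] by blast
  have "AE w in M. m w = fnorm (X w) (f w)"
    using m(2) e(2) AE_section[OF L_section[OF c]] asimple_closed[OF assms]
  proof eventually_elim
    case (elim w)
    then interpret normed_carrier_alg "X w" by (intro fibre) auto
    show ?case using elim by (simp add: scale_zero_left)
  qed
  then show ?thesis using m by blast
next
  case True
  from assms have "AE w in M. f w = \<zero>\<^bsub>X w\<^esub>"
    by cases (use True in auto)
  then have "AE w in M. 0 = fnorm (X w) (f w)"
    using AE_space
  proof eventually_elim
    case (elim w)
    then interpret normed_carrier_alg "X w" by (intro fibre) auto
    show ?case using elim by (simp add: s_zero)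
  qed
  then show ?thesis by (intro bexI[of _ "\<lambda>_. 0"]) auto
qed

section \<open>Measurable sections as almost everywhere limits of simple ones\<close>

lemma measurable_sections_iff:
  "u \<in> measurable_sections M X L \<longleftrightarrow> is_section M X u \<and>
     (\<exists>f. (\<forall>n. asimple (f n)) \<and>
        (AE w in M. (\<lambda>n. fnorm (X w) (f n w \<ominus>\<^bsub>X w\<^esub> the (u w))) \<longlonglongrightarrow> 0))"
  (is "?L \<longleftrightarrow> _ \<and> ?R")
proof
  assume u: "u \<in> measurable_sections M X L"
  from u obtain s :: "nat \<Rightarrow> 'a \<rightharpoonup> 'b" where s: "\<And>n. simple_section M X L (s n)" and
    lim: "AE w in M. w \<in> dom u \<and> (\<forall>n. w \<in> dom (s n)) \<and>
               (\<lambda>n. fnorm (X w) (the (s n w) \<ominus>\<^bsub>X w\<^esub> the (u w))) \<longlonglongrightarrow> 0"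
    unfolding measurable_sections_def by blast
  have "AE w in M. s n w = Some (the (s n w))" for n
    using lim by eventually_elim (metis domD option.sel)
  then have "asimple (\<lambda>w. the (s n w))" for n
    unfolding asimple_iff using s[of n] by blast
  moreover have "AE w in M. (\<lambda>n. fnorm (X w) (the (s n w) \<ominus>\<^bsub>X w\<^esub> the (u w))) \<longlonglongrightarrow> 0"
    using lim by eventually_elim simp
  ultimately show "is_section M X u \<and> ?R"
    using u by (intro conjI exI[of _ "\<lambda>n w. the (s n w)"]) (auto simp: measurable_sections_def)
next
  assume "is_section M X u \<and> ?R"
  then obtain f where u: "is_section M X u" and f: "\<forall>n. asimple (f n)" and
    lim: "AE w in M. (\<lambda>n. fnorm (X w) (f n w \<ominus>\<^bsub>X w\<^esub> the (u w))) \<longlonglongrightarrow> 0"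
    by blast
  have "\<exists>s. \<forall>n. simple_section M X L (s n) \<and> (AE w in M. s n w = Some (f n w))"
    using f unfolding asimple_iff by (intro choice) simp
  then obtain s where s: "\<And>n. simple_section M X L (s n)" "\<And>n. AE w in M. s n w = Some (f n w)"
    by blast
  have "AE w in M. \<forall>n. s n w = Some (f n w)"
    using s(2) by (simp add: AE_all_countable)
  then have "AE w in M. w \<in> dom u \<and> (\<forall>n. w \<in> dom (s n)) \<and>
               (\<lambda>n. fnorm (X w) (the (s n w) \<ominus>\<^bsub>X w\<^esub> the (u w))) \<longlonglongrightarrow> 0"
    using lim AE_section[OF u] by eventually_elim auto
  then show ?L
    using u s(1) by (auto simp: measurable_sections_def)
qed

lemma measurable_sections_section: "u \<in> measurable_sections M X L \<Longrightarrow> is_section M X u"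
  by (simp add: measurable_sections_def)

lemma asimple_measurable:
  assumes u: "is_section M X u" and f: "asimple f" and eq: "AE w in M. the (u w) = f w"
  shows "u \<in> measurable_sections M X L"
proof -
  have "AE w in M. (\<lambda>n. fnorm (X w) (f w \<ominus>\<^bsub>X w\<^esub> the (u w))) \<longlonglongrightarrow> 0"
    using AE_section[OF u] eq
  proof eventually_elim
    case (elim w)
    then interpret normed_carrier_alg "X w" by (intro fibre) auto
    show ?case
      using elim by (simp add: fnorm_minus_eq_0_iff[THEN iffD2])
  qed
  then show ?thesis
    unfolding measurable_sections_iff using u f by (intro conjI exI[of _ "\<lambda>_. f"]) auto
qed

lemma L_measurable: "c \<in> L \<Longrightarrow> c \<in> measurable_sections M X L"
  by (rule asimple_measurable[OF L_section asimple_L[of c]]) auto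

lemma zero_section_measurable:
  "(\<lambda>w. if w \<in> space M then Some \<zero>\<^bsub>X w\<^esub> else None) \<in> measurable_sections M X L"
proof (rule asimple_measurable[of _ "\<lambda>w. \<zero>\<^bsub>X w\<^esub>"])
  show "asimple (\<lambda>w. \<zero>\<^bsub>X w\<^esub>)" by (rule asimple.zero) simp
  show "AE w in M. the (if w \<in> space M then Some \<zero>\<^bsub>X w\<^esub> else None) = \<zero>\<^bsub>X w\<^esub>"
    using AE_space[of M] by eventually_elim simp
  show "is_section M X (\<lambda>w. if w \<in> space M then Some \<zero>\<^bsub>X w\<^esub> else None)"
  proof -
    have "dom (\<lambda>w. if w \<in> space M then Some \<zero>\<^bsub>X w\<^esub> else None) = space M"
      by (auto split: if_splits)
    then show ?thesis
      using AE_space[of M] by (simp add: is_section_def zero_closed)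
  qed
qed

text \<open>A diagonal argument. At \<open>w\<close> the function \<open>t m n\<close> takes the
  \<open>n\<close>-th approximant of the section belonging to the first set that contains
  \<open>w\<close>, provided its index is below \<open>m\<close>, and 0 otherwise. For fixed
  \<open>m\<close> only finitely many pieces are pasted, so \<open>t m n\<close> is simple; at a
  fixed \<open>w\<close> the diagonal \<open>t n n\<close> follows the approximants of one single
  section as soon as \<open>n\<close> exceeds \<open>K w\<close>.\<close>

lemma measurable_sections_glue:
  assumes u: "is_section M X u"
    and v: "\<And>k::nat. v k \<in> measurable_sections M X L"
    and A: "\<And>k. A k \<in> sets M"
    and cover: "AE w in M. \<exists>k. w \<in> A k"
    and eq: "\<And>k. AE w in M. w \<in> A k \<longrightarrow> u w = v k w"
  shows "u \<in> measurable_sections M X L"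
proof -
  have "\<exists>f. (\<forall>n. asimple (f n)) \<and>
      (AE w in M. (\<lambda>n. fnorm (X w) (f n w \<ominus>\<^bsub>X w\<^esub> the (v k w))) \<longlonglongrightarrow> 0)" for k
    using v[of k] unfolding measurable_sections_iff by (rule conjunct2)
  then have "\<exists>f. \<forall>k. (\<forall>n. asimple (f k n)) \<and>
      (AE w in M. (\<lambda>n. fnorm (X w) (f k n w \<ominus>\<^bsub>X w\<^esub> the (v k w))) \<longlonglongrightarrow> 0)"
    by (intro choice allI)
  then obtain f where f: "\<And>k n. asimple (f k n)"
    "\<And>k. AE w in M. (\<lambda>n. fnorm (X w) (f k n w \<ominus>\<^bsub>X w\<^esub> the (v k w))) \<longlonglongrightarrow> 0"
    by blast
  define K where "K w = (LEAST k. w \<in> A k)" for w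
  define t where "t m n w = (if \<exists>k<m. w \<in> A k then f (K w) n w else \<zero>\<^bsub>X w\<^esub>)" for m n w
  have t: "asimple (t m n)" for m n
  proof (induction m)
    case 0
    show ?case by (rule asimple.zero) (simp add: t_def)
  next
    case (Suc m)
    let ?B = "A m - (\<Union>k<m. A k)"
    have "t (Suc m) n = (\<lambda>w. if w \<in> ?B then f m n w else t m n w)"
    proof
      fix w
      have "K w = m" if "w \<in> ?B"
        unfolding K_def using that by (intro Least_equality) (auto simp: not_less[symmetric])
      then show "t (Suc m) n w = (if w \<in> ?B then f m n w else t m n w)"
        by (auto simp: t_def less_Suc_eq)
    qed
    moreover have "asimple (\<lambda>w. if w \<in> ?B then f m n w else t m n w)"
      by (rule asimple_If[OF f(1) Suc]) (use A in auto)
    ultimately show ?case by simp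
  qed
  have "AE w in M. \<forall>k. w \<in> A k \<longrightarrow> u w = v k w"
    using eq by (simp add: AE_all_countable)
  moreover have "AE w in M. \<forall>k. (\<lambda>n. fnorm (X w) (f k n w \<ominus>\<^bsub>X w\<^esub> the (v k w))) \<longlonglongrightarrow> 0"
    using f(2) by (simp add: AE_all_countable)
  ultimately have "AE w in M. (\<lambda>n. fnorm (X w) (t n n w \<ominus>\<^bsub>X w\<^esub> the (u w))) \<longlonglongrightarrow> 0"
    using cover
  proof eventually_elim
    case (elim w)
    then obtain k where k: "w \<in> A k" by blast
    then have K: "w \<in> A (K w)"
      unfolding K_def by (rule LeastI)
    have "eventually (\<lambda>n. t n n w = f (K w) n w) sequentially"
      using eventually_gt_at_top[of "K w"] by eventually_elim (use K in \<open>auto simp: t_def\<close>)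
    then have "eventually (\<lambda>n. fnorm (X w) (f (K w) n w \<ominus>\<^bsub>X w\<^esub> the (v (K w) w)) =
        fnorm (X w) (t n n w \<ominus>\<^bsub>X w\<^esub> the (u w))) sequentially"
      by eventually_elim (use elim(1) K in auto)
    with elim(2)[rule_format, of "K w"] show ?case
      by (rule Lim_transform_eventually)
  qed
  then show ?thesis
    unfolding measurable_sections_iff using u t by (intro conjI exI[of _ "\<lambda>n. t n n"]) auto
qed

text \<open>Serves to truncate a section to the set where its norm is below a bound: it is glued
  from \<open>u\<close> and the zero section.\<close>

lemma measurable_sections_restrict:
  assumes u: "u \<in> measurable_sections M X L" and A: "A \<in> sets M"
  shows "(\<lambda>w. if w \<in> A then u w else if w \<in> space M then Some \<zero>\<^bsub>X w\<^esub> else None)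
    \<in> measurable_sections M X L" (is "?u \<in> _")
proof (rule measurable_sections_glue[where A = "\<lambda>k. if k = 0 then A else space M - A" and
      v = "\<lambda>k. if k = 0 then u else (\<lambda>w. if w \<in> space M then Some \<zero>\<^bsub>X w\<^esub> else None)"])
  note sec = measurable_sections_section[OF u] measurable_sections_section[OF zero_section_measurable]
  have "AE w in M. w \<in> dom ?u"
    using AE_section[OF sec(1)] by eventually_elim auto
  then show "is_section M X ?u"
    using sec by (auto simp: is_section_def dom_def split: if_splits)
  show "AE w in M. \<exists>k::nat. w \<in> (if k = 0 then A else space M - A)"
    using AE_space
  proof eventually_elim
    case (elim w)
    then show ?case
      by (intro exI[of _ "if w \<in> A then 0 else Suc 0"]) auto
  qed
qed (use u A zero_section_measurable in \<open>auto split: if_splits\<close>)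

lemma measurable_sections_norm:
  assumes u: "u \<in> measurable_sections M X L"
  obtains g where "g \<in> borel_measurable M" "\<And>w. 0 \<le> g w" "AE w in M. g w = sec_norm X u w"
proof -
  obtain f where f: "\<And>n. asimple (f n)"
    and lim: "AE w in M. (\<lambda>n. fnorm (X w) (f n w \<ominus>\<^bsub>X w\<^esub> the (u w))) \<longlonglongrightarrow> 0"
    using u unfolding measurable_sections_iff by blast
  have "\<exists>m. \<forall>n. m n \<in> borel_measurable M \<and> (AE w in M. m n w = fnorm (X w) (f n w))"
    using asimple_norm[OF f] by (intro choice allI) blast
  then obtain m where m: "\<And>n. m n \<in> borel_measurable M" "\<And>n. AE w in M. m n w = fnorm (X w) (f n w)"
    by blast
  have "AE w in M. \<forall>n. m n w = fnorm (X w) (f n w)"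
    using m(2) by (simp add: AE_all_countable)
  moreover have "AE w in M. \<forall>n. f n w \<in> carrier (X w)"
    using asimple_closed[OF f] by (simp add: AE_all_countable)
  \<comment> \<open>\<open>lim\<close> of measurable real functions is measurable whether or not
    they converge. The maximum with 0 makes the result nonnegative also on the null set where
    convergence may fail.\<close>
  ultimately have "AE w in M. max 0 (lim (\<lambda>n. m n w)) = sec_norm X u w"
    using lim AE_section[OF measurable_sections_section[OF u]]
  proof eventually_elim
    case (elim w)
    then interpret normed_carrier_alg "X w" by (intro fibre) auto
    have "(\<lambda>n. fnorm (X w) (f n w) - fnorm (X w) (the (u w))) \<longlonglongrightarrow> 0"
      using elim by (intro Lim_null_comparison[OF _ elim(3)]) (auto intro!: always_eventually abs_s_minus_le)
    then have "(\<lambda>n. m n w) \<longlonglongrightarrow> fnorm (X w) (the (u w))"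
      using elim(1) by (simp add: LIM_zero_iff)
    then show ?case
      using elim by (simp add: limI sec_norm_def s_nonneg)
  qed
  moreover have "(\<lambda>w. max 0 (lim (\<lambda>n. m n w))) \<in> borel_measurable M"
    using m(1) by measurable
  ultimately show ?thesis
    by (intro that[of "\<lambda>w. max 0 (lim (\<lambda>n. m n w))"]) auto
qed

lemma cls_norm_sec_class:
  assumes u: "u \<in> measurable_sections M X L" and g: "AE w in M. g w = sec_norm X u w"
  shows "cls_norm M X (sec_class M X L u) = L0_class M (\<lambda>w. complex_of_real (g w))"
proof -
  have "(\<exists>v\<in>sec_class M X L u. AE w in M. f w = complex_of_real (sec_norm X v w)) \<longleftrightarrow>
      (AE w in M. f w = complex_of_real (g w))" for f
  proof
    assume "\<exists>v\<in>sec_class M X L u. AE w in M. f w = complex_of_real (sec_norm X v w)"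
    then obtain v where "AE w in M. f w = complex_of_real (sec_norm X v w)" "AE w in M. v w = u w"
      by (auto simp: sec_class_def)
    then show "AE w in M. f w = complex_of_real (g w)"
      using g by eventually_elim (simp add: sec_norm_def)
  next
    assume "AE w in M. f w = complex_of_real (g w)"
    then have "AE w in M. f w = complex_of_real (sec_norm X u w)"
      using g by eventually_elim simp
    then show "\<exists>v\<in>sec_class M X L u. AE w in M. f w = complex_of_real (sec_norm X v w)"
      using u by (auto simp: sec_class_def)
  qed
  then show ?thesis
    by (simp add: cls_norm_def L0_class_def)
qed

end

section \<open>Classes of measurable functions and liftings\<close>

lemma L0_class_eq_iff:
  assumes "f \<in> borel_measurable M" "g \<in> borel_measurable M"
  shows "L0_class M f = L0_class M g \<longleftrightarrow> (AE w in M. f w = g w)"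
proof
  assume "L0_class M f = L0_class M g"
  moreover have "f \<in> L0_class M f"
    using assms by (simp add: L0_class_def)
  ultimately show "AE w in M. f w = g w"
    by (simp add: L0_class_def)
next
  assume *: "AE w in M. f w = g w"
  have "(AE w in M. h w = f w) \<longleftrightarrow> (AE w in M. h w = g w)" for h
    using * by (intro eventually_cong) auto
  then show "L0_class M f = L0_class M g"
    by (simp add: L0_class_def)
qed

lemma L0_class_self: "f \<in> borel_measurable M \<Longrightarrow> f \<in> L0_class M f"
  by (simp add: L0_class_def)

lemma L0_lift_class:
  assumes "f \<in> borel_measurable M"
  shows "L0_lift M h (L0_class M f) = L0_class M (\<lambda>w. h (f w))"
proof -
  have "(\<exists>f'\<in>L0_class M f. AE w in M. g w = h (f' w)) \<longleftrightarrow> (AE w in M. g w = h (f w))" for g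
  proof
    assume "\<exists>f'\<in>L0_class M f. AE w in M. g w = h (f' w)"
    then obtain f' where f': "AE w in M. g w = h (f' w)" "AE w in M. f' w = f w"
      by (auto simp: L0_class_def)
    then show "AE w in M. g w = h (f w)"
      by eventually_elim simp
  qed (use assms L0_class_self in blast)
  then show ?thesis
    by (simp add: L0_lift_def L0_class_def)
qed

lemma L0_lift2_class:
  assumes "f \<in> borel_measurable M" "f' \<in> borel_measurable M"
  shows "L0_lift2 M h (L0_class M f) (L0_class M f') = L0_class M (\<lambda>w. h (f w) (f' w))"
proof -
  have "(\<exists>f1\<in>L0_class M f. \<exists>f2\<in>L0_class M f'. AE w in M. g w = h (f1 w) (f2 w))
      \<longleftrightarrow> (AE w in M. g w = h (f w) (f' w))" for g
  proof
    assume "\<exists>f1\<in>L0_class M f. \<exists>f2\<in>L0_class M f'. AE w in M. g w = h (f1 w) (f2 w)"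
    then obtain f1 f2 where "AE w in M. g w = h (f1 w) (f2 w)"
      "AE w in M. f1 w = f w" "AE w in M. f2 w = f' w"
      by (auto simp: L0_class_def)
    then show "AE w in M. g w = h (f w) (f' w)"
      by eventually_elim simp
  qed (use assms L0_class_self in blast)
  then show ?thesis
    by (simp add: L0_lift2_def L0_class_def)
qed

lemma L0_le_class:
  assumes "f \<in> borel_measurable M" "g \<in> borel_measurable M"
  shows "L0_le M (L0_class M f) (L0_class M g) \<longleftrightarrow>
    (AE w in M. Im (f w) = Im (g w) \<and> Re (f w) \<le> Re (g w))"
proof
  assume "L0_le M (L0_class M f) (L0_class M g)"
  then obtain f1 g1 where "AE w in M. Im (f1 w) = Im (g1 w) \<and> Re (f1 w) \<le> Re (g1 w)"
    "AE w in M. f1 w = f w" "AE w in M. g1 w = g w"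
    by (auto simp: L0_class_def L0_le_def)
  then show "AE w in M. Im (f w) = Im (g w) \<and> Re (f w) \<le> Re (g w)"
    by eventually_elim simp
next
  assume "AE w in M. Im (f w) = Im (g w) \<and> Re (f w) \<le> Re (g w)"
  then show "L0_le M (L0_class M f) (L0_class M g)"
    unfolding L0_le_def using assms L0_class_self by blast
qed

lemma L0_carrier: "carrier (L0 M) = L0_class M ` borel_measurable M"
  and L0_zero: "\<zero>\<^bsub>L0 M\<^esub> = L0_class M (\<lambda>_. 0)"
  and L0_one: "\<one>\<^bsub>L0 M\<^esub> = L0_class M (\<lambda>_. 1)"
  by (simp_all add: L0_def)

lemma L0_add: "\<lbrakk>f \<in> borel_measurable M; g \<in> borel_measurable M\<rbrakk> \<Longrightarrow>
    L0_class M f \<oplus>\<^bsub>L0 M\<^esub> L0_class M g = L0_class M (\<lambda>w. f w + g w)"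
  and L0_mult: "\<lbrakk>f \<in> borel_measurable M; g \<in> borel_measurable M\<rbrakk> \<Longrightarrow>
    L0_class M f \<otimes>\<^bsub>L0 M\<^esub> L0_class M g = L0_class M (\<lambda>w. f w * g w)"
  and L0_smult: "f \<in> borel_measurable M \<Longrightarrow> c \<odot>\<^bsub>L0 M\<^esub> L0_class M f = L0_class M (\<lambda>w. c * f w)"
  and L0_abs_class: "f \<in> borel_measurable M \<Longrightarrow>
    L0_abs M (L0_class M f) = L0_class M (\<lambda>w. complex_of_real (cmod (f w)))"
  and L0_cnj_class: "f \<in> borel_measurable M \<Longrightarrow> L0_cnj M (L0_class M f) = L0_class M (\<lambda>w. cnj (f w))"
  by (simp_all add: L0_def L0_lift2_class L0_lift_class L0_abs_def L0_cnj_def)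

text \<open>Membership in \<open>Linf\<close> for functions instead of classes, polymorphic in the
  value space so that real norms and complex scalars share one set of closure rules.\<close>

definition ess_bounded :: "'a measure \<Rightarrow> ('a \<Rightarrow> 'c::real_normed_vector) \<Rightarrow> bool" where
  "ess_bounded M f \<longleftrightarrow> f \<in> borel_measurable M \<and> (\<exists>C. AE w in M. norm (f w) \<le> C)"

lemma ess_boundedD: "ess_bounded M f \<Longrightarrow> f \<in> borel_measurable M"
  by (simp add: ess_bounded_def)

lemma ess_boundedE:
  assumes "ess_bounded M f"
  obtains C where "0 \<le> C" "AE w in M. norm (f w) \<le> C"
proof -
  obtain C where "AE w in M. norm (f w) \<le> C"
    using assms by (auto simp: ess_bounded_def)
  then have "AE w in M. norm (f w) \<le> max C 0"
    by eventually_elim simp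
  then show ?thesis
    by (intro that[of "max C 0"]) auto
qed

lemma ess_bounded_bound:
  assumes "f \<in> borel_measurable M" "AE w in M. norm (f w) \<le> C"
  shows "ess_bounded M f"
  using assms by (auto simp: ess_bounded_def)

lemma ess_bounded_mono:
  assumes "ess_bounded M g" "f \<in> borel_measurable M" "AE w in M. norm (f w) \<le> norm (g w)"
  shows "ess_bounded M f"
proof -
  obtain C where "AE w in M. norm (g w) \<le> C"
    using assms(1) by (rule ess_boundedE)
  then have "AE w in M. norm (f w) \<le> C"
    using assms(3) by eventually_elim simp
  then show ?thesis
    using assms(2) by (rule ess_bounded_bound[rotated])
qed

lemma ess_bounded_const [simp, intro]: "ess_bounded M (\<lambda>_. c)"
  by (rule ess_bounded_bound[of _ _ "norm c"]) auto

lemma ess_bounded_add [intro]: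
  fixes f g :: "'a \<Rightarrow> 'c::{real_normed_vector, second_countable_topology}"
  assumes "ess_bounded M f" "ess_bounded M g"
  shows "ess_bounded M (\<lambda>w. f w + g w)"
proof -
  obtain C D where "AE w in M. norm (f w) \<le> C" "AE w in M. norm (g w) \<le> D"
    using assms by (metis ess_boundedE)
  then have "AE w in M. norm (f w + g w) \<le> C + D"
    by eventually_elim (rule norm_triangle_mono)
  then show ?thesis
    by (rule ess_bounded_bound[rotated]) (intro borel_measurable_add ess_boundedD assms)
qed

lemma ess_bounded_mult [intro]:
  fixes f g :: "'a \<Rightarrow> 'c::{real_normed_algebra, second_countable_topology}"
  assumes "ess_bounded M f" "ess_bounded M g"
  shows "ess_bounded M (\<lambda>w. f w * g w)"
proof -
  obtain C D where C: "0 \<le> C" and CD: "AE w in M. norm (f w) \<le> C" "AE w in M. norm (g w) \<le> D"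
    using assms by (metis ess_boundedE)
  from CD have "AE w in M. norm (f w * g w) \<le> C * D"
  proof eventually_elim
    case (elim w)
    have "norm (f w * g w) \<le> norm (f w) * norm (g w)"
      by (rule norm_mult_ineq)
    also have "\<dots> \<le> C * D"
      using elim C by (intro mult_mono) auto
    finally show ?case .
  qed
  then show ?thesis
    by (rule ess_bounded_bound[rotated]) (intro borel_measurable_times ess_boundedD assms)
qed

lemma ess_bounded_cnj [intro]:
  assumes "ess_bounded M f"
  shows "ess_bounded M (\<lambda>w. cnj (f w))"
proof (rule ess_bounded_mono[OF assms])
  show "(\<lambda>w. cnj (f w)) \<in> borel_measurable M"
    using continuous_on_cnj[OF continuous_on_id] ess_boundedD[OF assms]
    by (rule borel_measurable_continuous_on)
qed simp

lemma ess_bounded_of_real [simp]: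
  "ess_bounded M (\<lambda>w. complex_of_real (f w)) \<longleftrightarrow> ess_bounded M f"
proof -
  have "(\<lambda>w. complex_of_real (f w)) \<in> borel_measurable M \<longleftrightarrow> f \<in> borel_measurable M"
  proof
    assume "(\<lambda>w. complex_of_real (f w)) \<in> borel_measurable M"
    from measurable_compose[OF this borel_measurable_Re] show "f \<in> borel_measurable M"
      by simp
  qed auto
  then show ?thesis
    by (simp add: ess_bounded_def)
qed

lemma ess_bounded_cmod [intro]: "ess_bounded M f \<Longrightarrow> ess_bounded M (\<lambda>w. cmod (f w))"
  by (rule ess_bounded_mono[of M f]) (auto intro!: borel_measurable_norm dest: ess_boundedD)

lemma ess_bounded_indicator [intro]: "A \<in> sets M \<Longrightarrow> ess_bounded M (indicator A :: 'a \<Rightarrow> real)"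
  by (rule ess_bounded_bound[of _ _ 1]) (auto simp: indicator_def)

lemma L0_class_in_Linf_iff:
  assumes "f \<in> borel_measurable M"
  shows "L0_class M f \<in> Linf M \<longleftrightarrow> ess_bounded M f"
proof
  assume "L0_class M f \<in> Linf M"
  then obtain g C where g: "AE w in M. g w = f w" "AE w in M. cmod (g w) \<le> C"
    by (auto simp: Linf_def L0_class_def)
  then have "AE w in M. cmod (f w) \<le> C"
    by eventually_elim simp
  then show "ess_bounded M f"
    using assms by (auto simp: ess_bounded_def)
next
  assume "ess_bounded M f"
  then show "L0_class M f \<in> Linf M"
    using L0_class_self[OF assms] assms by (auto simp: Linf_def L0_carrier ess_bounded_def)
qed

section \<open>The scalar lifting on functions and its positivity\<close>

locale lifting =
  fixes M :: "'a measure" and p :: "'a L0_elem \<Rightarrow> 'a \<Rightarrow> complex"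
  assumes lifting: "is_lifting M p"
begin

definition P :: "('a \<Rightarrow> complex) \<Rightarrow> 'a \<Rightarrow> complex" where
  "P f = p (L0_class M f)"

lemma bounded_in_Linf: "ess_bounded M f \<Longrightarrow> L0_class M f \<in> Linf M"
  by (simp add: L0_class_in_Linf_iff ess_boundedD)

lemma P_bounded_measurable: "ess_bounded M f \<Longrightarrow> P f \<in> bounded_measurable M"
  using lifting bounded_in_Linf[of f] by (auto simp: P_def is_lifting_def)

lemma P_AE: 
  assumes "ess_bounded M f"
  shows "AE w in M. P f w = f w"
proof -
  have "p (L0_class M f) \<in> L0_class M f"
    using lifting bounded_in_Linf[OF assms] by (simp add: is_lifting_def)
  then show ?thesis
    by (simp add: L0_class_def P_def)
qed

lemma P_add:
  assumes "ess_bounded M f" "ess_bounded M g" "w \<in> space M"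
  shows "P (\<lambda>w. f w + g w) w = P f w + P g w"
  unfolding P_def L0_add[OF ess_boundedD[OF assms(1)] ess_boundedD[OF assms(2)], symmetric]
  using lifting assms by (simp add: is_lifting_def bounded_in_Linf)

lemma P_mult:
  assumes "ess_bounded M f" "ess_bounded M g" "w \<in> space M"
  shows "P (\<lambda>w. f w * g w) w = P f w * P g w"
  unfolding P_def L0_mult[OF ess_boundedD[OF assms(1)] ess_boundedD[OF assms(2)], symmetric]
  using lifting assms by (simp add: is_lifting_def bounded_in_Linf)

lemma P_scale:
  assumes "ess_bounded M f" "w \<in> space M"
  shows "P (\<lambda>w. c * f w) w = c * P f w"
  unfolding P_def L0_smult[OF ess_boundedD[OF assms(1)], symmetric]
  using lifting assms by (simp add: is_lifting_def bounded_in_Linf)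

lemma P_cnj:
  assumes "ess_bounded M f" "w \<in> space M"
  shows "P (\<lambda>w. cnj (f w)) w = cnj (P f w)"
  unfolding P_def L0_cnj_class[OF ess_boundedD[OF assms(1)], symmetric]
  using lifting assms by (simp add: is_lifting_def bounded_in_Linf)

lemma P_one: "w \<in> space M \<Longrightarrow> P (\<lambda>_. 1) w = 1"
  using lifting by (simp add: P_def is_lifting_def L0_one)

lemma P_const: "w \<in> space M \<Longrightarrow> P (\<lambda>_. c) w = c"
  using P_scale[of "\<lambda>_. 1" w c] P_one[of w] by simp

lemma P_cong: "\<lbrakk>f \<in> borel_measurable M; g \<in> borel_measurable M; AE w in M. f w = g w\<rbrakk> \<Longrightarrow> P f = P g"
  using L0_class_eq_iff[of f M g] by (simp add: P_def)

text \<open>The real part makes the lifting of a real function real by type. On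
  \<open>space M\<close> nothing is lost, because the lifting commutes with conjugation; see
  \<open>P_of_real\<close>.\<close>

definition PR :: "('a \<Rightarrow> real) \<Rightarrow> 'a \<Rightarrow> real" where
  "PR f w = Re (P (\<lambda>w. complex_of_real (f w)) w)"

lemma P_of_real:
  assumes "ess_bounded M f" "w \<in> space M"
  shows "P (\<lambda>w. complex_of_real (f w)) w = complex_of_real (PR f w)"
proof -
  have "cnj (P (\<lambda>w. complex_of_real (f w)) w) = P (\<lambda>w. complex_of_real (f w)) w"
    using P_cnj[of "\<lambda>w. complex_of_real (f w)" w] assms by simp
  then show ?thesis
    by (simp add: PR_def complex_eq_iff)
qed

lemma PR_AE:
  assumes "ess_bounded M f"
  shows "AE w in M. PR f w = f w"
proof -
  have "AE w in M. P (\<lambda>w. complex_of_real (f w)) w = complex_of_real (f w)"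
    using assms by (intro P_AE) simp
  then show ?thesis
    by eventually_elim (simp add: PR_def)
qed

lemma PR_measurable: "ess_bounded M f \<Longrightarrow> PR f \<in> borel_measurable M"
  using P_bounded_measurable[of "\<lambda>w. complex_of_real (f w)"]
  by (auto simp: PR_def[abs_def] bounded_measurable_def)

lemma PR_add: "\<lbrakk>ess_bounded M f; ess_bounded M g; w \<in> space M\<rbrakk> \<Longrightarrow>
    PR (\<lambda>w. f w + g w) w = PR f w + PR g w"
  using P_add[of "\<lambda>w. complex_of_real (f w)" "\<lambda>w. complex_of_real (g w)"]
  by (simp add: PR_def)

lemma PR_mult: "\<lbrakk>ess_bounded M f; ess_bounded M g; w \<in> space M\<rbrakk> \<Longrightarrow>
    PR (\<lambda>w. f w * g w) w = PR f w * PR g w"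
  using P_mult[of "\<lambda>w. complex_of_real (f w)" "\<lambda>w. complex_of_real (g w)"]
  by (simp add: PR_def[of "\<lambda>w. f w * g w"] P_of_real)

lemma PR_const: "w \<in> space M \<Longrightarrow> PR (\<lambda>_. c) w = c"
  by (simp add: PR_def P_const)

lemma PR_scale: "\<lbrakk>ess_bounded M f; w \<in> space M\<rbrakk> \<Longrightarrow> PR (\<lambda>w. c * f w) w = c * PR f w"
  by (simp add: PR_mult PR_const)

lemma PR_cong: "\<lbrakk>f \<in> borel_measurable M; g \<in> borel_measurable M; AE w in M. f w = g w\<rbrakk> \<Longrightarrow> PR f = PR g"
  using P_cong[of "\<lambda>w. complex_of_real (f w)" "\<lambda>w. complex_of_real (g w)"]
  by (simp add: PR_def[abs_def])

text \<open>Positivity follows from multiplicativity: almost everywhere \<open>f\<close> is the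
  square of \<open>sqrt \<bar>f\<bar>\<close>, so its lifting at \<open>w\<close> is the square of a
  real number.\<close>

lemma PR_nonneg:
  assumes f: "ess_bounded M f" and nn: "AE w in M. 0 \<le> f w" and w: "w \<in> space M"
  shows "0 \<le> PR f w"
proof -
  let ?s = "\<lambda>w. sqrt \<bar>f w\<bar>"
  have meas: "f \<in> borel_measurable M"
    using f by (rule ess_boundedD)
  obtain C where C: "AE w in M. norm (f w) \<le> C"
    using f by (rule ess_boundedE)
  then have "AE w in M. norm (?s w) \<le> sqrt C"
    by eventually_elim simp
  then have s: "ess_bounded M ?s"
    using meas by (intro ess_bounded_bound[where C = "sqrt C"]) auto
  have "AE w in M. f w = ?s w * ?s w"
    using nn by eventually_elim simp
  then have "PR f = PR (\<lambda>w. ?s w * ?s w)"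
    using meas by (intro PR_cong) auto
  then show ?thesis
    using PR_mult[OF s s w] by simp
qed

lemma PR_mono:
  assumes f: "ess_bounded M f" and g: "ess_bounded M g"
    and le: "AE w in M. f w \<le> g w" and w: "w \<in> space M"
  shows "PR f w \<le> PR g w"
proof -
  have b: "ess_bounded M (\<lambda>w. - 1 * f w)"
    using f by (intro ess_bounded_mult) auto
  have "0 \<le> PR (\<lambda>w. g w + - 1 * f w) w"
  proof (rule PR_nonneg[OF _ _ w])
    show "ess_bounded M (\<lambda>w. g w + - 1 * f w)"
      using g b by (rule ess_bounded_add)
    show "AE w in M. 0 \<le> g w + - 1 * f w"
      using le by eventually_elim simp
  qed
  then show ?thesis
    using PR_add[OF g b w] PR_scale[OF f w, of "- 1"] by simp
qed

text \<open>The lifting of |f|^2 can be read in two ways: as \<open>P f w\<close> times its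
  conjugate, which is 0, and as the square of the lifting of |f|.\<close>

lemma PR_cmod_eq_0:
  assumes f: "ess_bounded M f" and w: "w \<in> space M" and zero: "P f w = 0"
  shows "PR (\<lambda>w. cmod (f w)) w = 0"
proof -
  have "complex_of_real (PR (\<lambda>w. cmod (f w) * cmod (f w)) w)
      = P (\<lambda>w. complex_of_real (cmod (f w) * cmod (f w))) w"
    using f w by (intro P_of_real[symmetric] ess_bounded_mult ess_bounded_cmod)
  also have "(\<lambda>w. complex_of_real (cmod (f w) * cmod (f w))) = (\<lambda>w. f w * cnj (f w))"
    by (simp add: fun_eq_iff complex_norm_square[symmetric] power2_eq_square flip: of_real_mult)
  also have "P \<dots> w = 0"
    using f w zero by (subst P_mult) auto
  finally show ?thesis
    using f w by (simp add: PR_mult ess_bounded_cmod)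
qed

end

section \<open>Banach--Kantorovich algebras\<close>

locale BK = finite_measure M + lifting M p
  for M :: "'a measure" and p :: "'a L0_elem \<Rightarrow> 'a \<Rightarrow> complex" +
  fixes E :: "'a L0_elem set" and U :: "('a L0_elem, 'u) vnormed_alg" (structure)
  assumes solid: "faithful_solid_subalgebra M E"
    and BK: "BK_algebra M E U"
begin

section \<open>Membership in \<open>E\<close> for representatives\<close>

definition EF :: "('a \<Rightarrow> complex) \<Rightarrow> bool" where
  "EF f \<longleftrightarrow> f \<in> borel_measurable M \<and> L0_class M f \<in> E"

lemma EF_measurable: "EF f \<Longrightarrow> f \<in> borel_measurable M"
  by (simp add: EF_def)

lemma E_carrier: "a \<in> E \<Longrightarrow> a \<in> carrier (L0 M)"
  using solid by (auto simp: faithful_solid_subalgebra_def)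

lemma E_rep:
  assumes "a \<in> E"
  obtains f where "EF f" "a = L0_class M f"
  using E_carrier[OF assms] assms by (auto simp: L0_carrier EF_def)

lemma EF_bounded: "ess_bounded M f \<Longrightarrow> EF f"
  using solid bounded_in_Linf[of f] ess_boundedD[of M f]
  by (auto simp: EF_def faithful_solid_subalgebra_def)

lemma EF_const [simp, intro]: "EF (\<lambda>_. c)"
  by (rule EF_bounded) simp

lemma EF_add:
  assumes "EF f" "EF g"
  shows "EF (\<lambda>w. f w + g w)"
proof -
  have "L0_class M f \<oplus>\<^bsub>L0 M\<^esub> L0_class M g \<in> E"
    using solid assms by (simp add: faithful_solid_subalgebra_def EF_def)
  then show ?thesis
    using EF_measurable[OF assms(1)] EF_measurable[OF assms(2)] by (simp add: EF_def L0_add)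
qed

lemma EF_mult:
  assumes "EF f" "EF g"
  shows "EF (\<lambda>w. f w * g w)"
proof -
  have "L0_class M f \<otimes>\<^bsub>L0 M\<^esub> L0_class M g \<in> E"
    using solid assms by (simp add: faithful_solid_subalgebra_def EF_def)
  then show ?thesis
    using EF_measurable[OF assms(1)] EF_measurable[OF assms(2)] by (simp add: EF_def L0_mult)
qed

lemma EF_solid:
  assumes "EF g" "f \<in> borel_measurable M" "AE w in M. cmod (f w) \<le> cmod (g w)"
  shows "EF f"
proof -
  have "L0_le M (L0_abs M (L0_class M f)) (L0_abs M (L0_class M g))"
    using assms EF_measurable[OF assms(1)] by (simp add: L0_abs_class L0_le_class)
  moreover have "L0_class M f \<in> carrier (L0 M)" "L0_class M g \<in> E"
    using assms by (auto simp: L0_carrier EF_def)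
  ultimately have "L0_class M f \<in> E"
    using solid unfolding faithful_solid_subalgebra_def by blast
  then show ?thesis
    using assms(2) by (simp add: EF_def)
qed

abbreviation RF :: "('a \<Rightarrow> real) \<Rightarrow> bool" where
  "RF f \<equiv> EF (\<lambda>w. complex_of_real (f w))"

lemma RF_measurable: "RF f \<Longrightarrow> f \<in> borel_measurable M"
  using measurable_compose[OF EF_measurable borel_measurable_Re, of "\<lambda>w. complex_of_real (f w)"] by simp

lemma RF_bounded: "ess_bounded M f \<Longrightarrow> RF f"
  by (rule EF_bounded) simp

lemma RF_add: "RF f \<Longrightarrow> RF g \<Longrightarrow> RF (\<lambda>w. f w + g w)"
  using EF_add[of "\<lambda>w. complex_of_real (f w)" "\<lambda>w. complex_of_real (g w)"] by simp

lemma RF_mult: "RF f \<Longrightarrow> RF g \<Longrightarrow> RF (\<lambda>w. f w * g w)"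
  using EF_mult[of "\<lambda>w. complex_of_real (f w)" "\<lambda>w. complex_of_real (g w)"] by simp

lemma RF_solid: "\<lbrakk>RF g; f \<in> borel_measurable M; AE w in M. \<bar>f w\<bar> \<le> \<bar>g w\<bar>\<rbrakk> \<Longrightarrow> RF f"
  by (erule EF_solid) auto

subsection \<open>The module structure in terms of functions\<close>

sublocale um: Module.module "scalars M E" U
  using BK by (simp add: BK_algebra_def assoc_algebra_def)

definition act :: "('a \<Rightarrow> complex) \<Rightarrow> 'u \<Rightarrow> 'u" where
  "act f x = L0_class M f \<odot> x"

abbreviation ract :: "('a \<Rightarrow> real) \<Rightarrow> 'u \<Rightarrow> 'u" where
  "ract f \<equiv> act (\<lambda>w. complex_of_real (f w))"

lemma act_closed [simp, intro]: "\<lbrakk>EF f; x \<in> carrier U\<rbrakk> \<Longrightarrow> act f x \<in> carrier U"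
  using um.smult_closed[of "L0_class M f" x] by (simp add: act_def EF_def)

lemma act_cong:
  assumes "EF f" "EF g" "AE w in M. f w = g w"
  shows "act f x = act g x"
proof -
  have "L0_class M f = L0_class M g"
    using assms by (simp add: L0_class_eq_iff EF_measurable)
  then show ?thesis by (simp add: act_def)
qed

lemma act_add_left: "\<lbrakk>EF f; EF g; x \<in> carrier U\<rbrakk> \<Longrightarrow>
    act (\<lambda>w. f w + g w) x = act f x \<oplus> act g x"
  using um.smult_l_distr[of "L0_class M f" "L0_class M g" x]
  by (simp add: act_def EF_def L0_add)

lemma act_add_right: "\<lbrakk>EF f; x \<in> carrier U; y \<in> carrier U\<rbrakk> \<Longrightarrow>
    act f (x \<oplus> y) = act f x \<oplus> act f y"
  using um.smult_r_distr[of "L0_class M f" x y] by (simp add: act_def EF_def)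

lemma act_act: "\<lbrakk>EF f; EF g; x \<in> carrier U\<rbrakk> \<Longrightarrow> act f (act g x) = act (\<lambda>w. f w * g w) x"
  using um.smult_assoc1[of "L0_class M f" "L0_class M g" x]
  by (simp add: act_def EF_def L0_mult)

lemma act_one: "x \<in> carrier U \<Longrightarrow> act (\<lambda>_. 1) x = x"
  using um.smult_one[of x] by (simp add: act_def L0_one)

lemma act_zero: "x \<in> carrier U \<Longrightarrow> act (\<lambda>_. 0) x = \<zero>"
  using um.smult_l_null[of x] by (simp add: act_def L0_zero)

lemma mult_closed: "\<lbrakk>x \<in> carrier U; y \<in> carrier U\<rbrakk> \<Longrightarrow> x \<otimes> y \<in> carrier U"
  and mult_assoc: "\<lbrakk>x \<in> carrier U; y \<in> carrier U; z \<in> carrier U\<rbrakk> \<Longrightarrow>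
        (x \<otimes> y) \<otimes> z = x \<otimes> (y \<otimes> z)"
  and mult_distr_l: "\<lbrakk>x \<in> carrier U; y \<in> carrier U; z \<in> carrier U\<rbrakk> \<Longrightarrow>
        (x \<oplus> y) \<otimes> z = (x \<otimes> z) \<oplus> (y \<otimes> z)"
  and mult_distr_r: "\<lbrakk>x \<in> carrier U; y \<in> carrier U; z \<in> carrier U\<rbrakk> \<Longrightarrow>
        z \<otimes> (x \<oplus> y) = (z \<otimes> x) \<oplus> (z \<otimes> y)"
  using BK unfolding BK_algebra_def assoc_algebra_def by blast+

lemma act_mult_l: "\<lbrakk>EF f; x \<in> carrier U; y \<in> carrier U\<rbrakk> \<Longrightarrow>
        act f x \<otimes> y = act f (x \<otimes> y)"
  and act_mult_r: "\<lbrakk>EF f; x \<in> carrier U; y \<in> carrier U\<rbrakk> \<Longrightarrow>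
        x \<otimes> act f y = act f (x \<otimes> y)"
  using BK by (auto simp: BK_algebra_def assoc_algebra_def act_def EF_def)

lemma uminus_act:
  assumes "x \<in> carrier U"
  shows "\<ominus> x = act (\<lambda>_. - 1) x"
proof -
  have "act (\<lambda>_. - 1) x \<oplus> x = act (\<lambda>_. - 1 + 1) x"
    using act_add_left[of "\<lambda>_. - 1" "\<lambda>_. 1" x] assms by (simp add: act_one)
  also have "\<dots> = \<zero>"
    using assms by (simp add: act_zero)
  finally show ?thesis
    using assms by (intro um.M.minus_equality) auto
qed

lemma minus_act: "\<lbrakk>x \<in> carrier U; y \<in> carrier U\<rbrakk> \<Longrightarrow> x \<ominus> y = x \<oplus> act (\<lambda>_. - 1) y"
  by (simp add: a_minus_def uminus_act)

lemma act_minus: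
  assumes "EF f" "x \<in> carrier U" "y \<in> carrier U"
  shows "act f (x \<ominus> y) = act f x \<ominus> act f y"
  using assms by (simp add: minus_act act_add_right act_act mult.commute)

lemma act_diff:
  assumes "EF f" "EF g" "x \<in> carrier U"
  shows "act (\<lambda>w. f w - g w) x = act f x \<ominus> act g x"
  using act_add_left[of f "\<lambda>w. - 1 * g w" x] EF_mult[of "\<lambda>_. - 1" g] assms
  by (simp add: minus_act act_act)

subsection \<open>The norm in terms of functions\<close>

text \<open>A representative of the vector norm that is nonnegative at every point, so that its sign
  never costs a null set.\<close>

definition nr :: "'u \<Rightarrow> 'a \<Rightarrow> real" where
  "nr x = (SOME f. f \<in> borel_measurable M \<and> (\<forall>w. 0 \<le> f w) \<and>
             vnorm U x = L0_class M (\<lambda>w. complex_of_real (f w)))"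

lemma nr_props:
  assumes "x \<in> carrier U"
  shows nr_measurable: "nr x \<in> borel_measurable M" and nr_nonneg: "0 \<le> nr x w"
    and vnorm_nr: "vnorm U x = L0_class M (\<lambda>w. complex_of_real (nr x w))"
    and nr_RF: "RF (nr x)"
proof -
  have vn: "vnorm U x \<in> E" "L0_le M \<zero>\<^bsub>L0 M\<^esub> (vnorm U x)"
    using BK assms by (auto simp: BK_algebra_def vector_norm_def)
  then obtain g where g: "EF g" "vnorm U x = L0_class M g"
    by (auto elim: E_rep)
  then have "AE w in M. 0 = Im (g w) \<and> 0 \<le> Re (g w)"
    using vn by (simp add: L0_zero L0_le_class EF_measurable)
  then have "AE w in M. g w = complex_of_real (max 0 (Re (g w)))"
    by eventually_elim (simp add: complex_eq_iff)
  moreover have m: "(\<lambda>w. max 0 (Re (g w))) \<in> borel_measurable M"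
    using EF_measurable[OF g(1)] by measurable
  ultimately have "vnorm U x = L0_class M (\<lambda>w. complex_of_real (max 0 (Re (g w))))"
    using EF_measurable[OF g(1)] by (simp add: g L0_class_eq_iff)
  then have "\<exists>f. f \<in> borel_measurable M \<and> (\<forall>w. 0 \<le> f w) \<and>
             vnorm U x = L0_class M (\<lambda>w. complex_of_real (f w))"
    using m by (intro exI[of _ "\<lambda>w. max 0 (Re (g w))"]) simp
  then have "nr x \<in> borel_measurable M \<and> (\<forall>w. 0 \<le> nr x w) \<and>
             vnorm U x = L0_class M (\<lambda>w. complex_of_real (nr x w))"
    unfolding nr_def by (rule someI_ex)
  then show "nr x \<in> borel_measurable M" "0 \<le> nr x w"
    "vnorm U x = L0_class M (\<lambda>w. complex_of_real (nr x w))" "RF (nr x)"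
    using vn by (auto simp: EF_def)
qed

declare nr_measurable [measurable]

lemma vnorm_le_iff:
  assumes "x \<in> carrier U" "f \<in> borel_measurable M"
  shows "L0_le M (vnorm U x) (L0_class M f) \<longleftrightarrow> (AE w in M. Im (f w) = 0 \<and> nr x w \<le> Re (f w))"
  using nr_measurable[OF assms(1)] assms by (simp add: vnorm_nr L0_le_class eq_commute[of 0])

lemma nr_add:
  assumes "x \<in> carrier U" "y \<in> carrier U"
  shows "AE w in M. nr (x \<oplus> y) w \<le> nr x w + nr y w"
proof -
  have "L0_le M (vnorm U (x \<oplus> y)) (vnorm U x \<oplus>\<^bsub>L0 M\<^esub> vnorm U y)"
    using BK assms by (auto simp: BK_algebra_def vector_norm_def)
  then show ?thesis
    using assms nr_measurable[OF assms(1)] nr_measurable[OF assms(2)]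
    by (simp add: vnorm_nr[of x] vnorm_nr[of y] L0_add vnorm_le_iff)
qed

lemma nr_mult:
  assumes "x \<in> carrier U" "y \<in> carrier U"
  shows "AE w in M. nr (x \<otimes> y) w \<le> nr x w * nr y w"
proof -
  have "L0_le M (vnorm U (x \<otimes> y)) (vnorm U x \<otimes>\<^bsub>L0 M\<^esub> vnorm U y)"
    using BK assms by (auto simp: BK_algebra_def)
  then show ?thesis
    using assms nr_measurable[OF assms(1)] nr_measurable[OF assms(2)]
    by (simp add: vnorm_nr[of x] vnorm_nr[of y] L0_mult vnorm_le_iff mult_closed)
qed

lemma vnorm_eq_iff:
  assumes "x \<in> carrier U" "f \<in> borel_measurable M"
  shows "vnorm U x = L0_class M (\<lambda>w. complex_of_real (f w)) \<longleftrightarrow> (AE w in M. nr x w = f w)"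
  using assms by (simp add: vnorm_nr L0_class_eq_iff nr_measurable)

lemma nr_act:
  assumes "EF f" "x \<in> carrier U"
  shows "AE w in M. nr (act f x) w = cmod (f w) * nr x w"
proof -
  have "vnorm U (act f x) = L0_abs M (L0_class M f) \<otimes>\<^bsub>L0 M\<^esub> vnorm U x"
    using BK assms by (auto simp: BK_algebra_def act_def EF_def)
  also have "\<dots> = L0_class M (\<lambda>w. complex_of_real (cmod (f w) * nr x w))"
    using assms EF_measurable[OF assms(1)] nr_measurable[OF assms(2)]
    by (simp add: L0_abs_class vnorm_nr L0_mult)
  finally show ?thesis
    using assms EF_measurable[OF assms(1)] nr_measurable[OF assms(2)]
    by (subst (asm) vnorm_eq_iff) auto
qed

lemma nr_eq_0_iff:
  assumes "x \<in> carrier U"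
  shows "(AE w in M. nr x w = 0) \<longleftrightarrow> x = \<zero>"
proof -
  have "vnorm U x = \<zero>\<^bsub>L0 M\<^esub> \<longleftrightarrow> x = \<zero>"
    using BK assms by (auto simp: BK_algebra_def vector_norm_def)
  then show ?thesis
    using vnorm_eq_iff[OF assms, of "\<lambda>_. 0"] by (simp add: L0_zero)
qed

lemma nr_zero: "AE w in M. nr \<zero> w = 0"
  by (simp add: nr_eq_0_iff)

lemma nr_minus_eq_0:
  assumes "x \<in> carrier U" "y \<in> carrier U" "AE w in M. nr (x \<ominus> y) w = 0"
  shows "x = y"
proof -
  have "x \<ominus> y = \<zero>"
    using nr_eq_0_iff[of "x \<ominus> y"] assms by simp
  moreover have "x = (x \<ominus> y) \<oplus> y"
    using assms by (simp add: a_minus_def um.add.m_assoc um.M.l_neg)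
  ultimately show ?thesis
    using assms by simp
qed

lemma nr_minus_commute:
  assumes "x \<in> carrier U" "y \<in> carrier U"
  shows "AE w in M. nr (x \<ominus> y) w = nr (y \<ominus> x) w"
proof -
  have "x \<ominus> y = act (\<lambda>_. - 1) (y \<ominus> x)"
    using assms by (simp add: minus_act act_add_right act_act act_one um.add.m_comm)
  then show ?thesis
    using nr_act[of "\<lambda>_. - 1" "y \<ominus> x"] assms by simp
qed

lemma nr_minus_triangle:
  assumes "x \<in> carrier U" "y \<in> carrier U" "z \<in> carrier U"
  shows "AE w in M. nr (x \<ominus> z) w \<le> nr (x \<ominus> y) w + nr (y \<ominus> z) w"
proof -
  have "x \<ominus> z = (x \<ominus> y) \<oplus> (y \<ominus> z)"
    using assms by (simp add: a_minus_def um.add.m_assoc um.M.r_neg1)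
  then show ?thesis
    using nr_add[of "x \<ominus> y" "y \<ominus> z"] assms by simp
qed

lemma nr_le_minus:
  assumes "x \<in> carrier U" "y \<in> carrier U"
  shows "AE w in M. nr x w \<le> nr y w + nr (x \<ominus> y) w"
proof -
  have "x = y \<oplus> (x \<ominus> y)"
    using assms by (simp add: a_minus_def um.add.m_lcomm um.M.r_neg)
  then show ?thesis
    using nr_add[of y "x \<ominus> y"] assms by simp
qed

lemma nr_minus_le:
  assumes "x \<in> carrier U" "y \<in> carrier U"
  shows "AE w in M. nr (x \<ominus> y) w \<le> nr x w + nr y w"
  using nr_add[of x "act (\<lambda>_. - 1) y"] nr_act[of "\<lambda>_. - 1" y] assms
  by (simp add: minus_act) (elim AE_mp, auto)

subsection \<open>Sequential completeness\<close>

text \<open>The form in which order completeness is used. The classes of the \<open>f n\<close> form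
  a set decreasing to zero, because a lower bound of all of them is at most their pointwise limit 0.
  The limit supplied by \<open>bo_complete\<close> comes with an unrelated set \<open>D'\<close> of
  bounds; the explicit estimate by \<open>f n\<close> is recovered from the fact that
  \<open>D'\<close> has infimum 0.\<close>

lemma seq_complete:
  fixes x :: "nat \<Rightarrow> 'u" and f :: "nat \<Rightarrow> 'a \<Rightarrow> real"
  assumes x: "\<And>n. x n \<in> carrier U" and f: "\<And>n. RF (f n)"
    and dec: "\<And>n m. n \<le> m \<Longrightarrow> AE w in M. f m w \<le> f n w"
    and lim: "AE w in M. (\<lambda>n. f n w) \<longlonglongrightarrow> 0"
    and cauchy: "\<And>n m. n \<le> m \<Longrightarrow> AE w in M. nr (x n \<ominus> x m) w \<le> f n w"
  obtains y where "y \<in> carrier U" "\<And>n. AE w in M. nr (y \<ominus> x n) w \<le> f n w"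
proof -
  define F where "F = filtermap x sequentially"
  define D where "D = range (\<lambda>n. L0_class M (\<lambda>w. complex_of_real (f n w)))"
  have fm: "f n \<in> borel_measurable M" for n
    using f by (rule RF_measurable)
  have f_nonneg: "AE w in M. 0 \<le> f n w" for n
  proof -
    have "0 \<le> nr (x n \<ominus> x n) w" for w
      using x by (intro nr_nonneg) simp
    then show ?thesis
      using cauchy[OF order_refl, of n] by (auto elim!: AE_mp intro: order_trans)
  qed
  have ev: "eventually (\<lambda>z. \<exists>k\<ge>n. z = x k) F" for n
    unfolding F_def eventually_filtermap using eventually_ge_at_top[of n] by eventually_elim auto
  have "decreases_to_zero M E D"
    unfolding decreases_to_zero_def
  proof (intro conjI ballI impI)
    show "D \<noteq> {}" by (auto simp: D_def)
    show "D \<subseteq> E" using f by (auto simp: D_def EF_def)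
  next
    fix a b assume "a \<in> D" "b \<in> D"
    then obtain n m where a: "a = L0_class M (\<lambda>w. complex_of_real (f n w))"
      and b: "b = L0_class M (\<lambda>w. complex_of_real (f m w))"
      by (auto simp: D_def)
    show "\<exists>c\<in>D. L0_le M c a \<and> L0_le M c b"
      using dec[of n "max n m"] dec[of m "max n m"] fm
      by (intro bexI[of _ "L0_class M (\<lambda>w. complex_of_real (f (max n m) w))"])
         (auto simp: a b L0_le_class D_def)
  next
    fix a assume "a \<in> D"
    then show "L0_le M \<zero>\<^bsub>L0 M\<^esub> a"
      using f_nonneg fm by (auto simp: D_def L0_zero L0_le_class)
  next
    fix g assume "g \<in> E" and le: "\<forall>a\<in>D. L0_le M g a"
    then obtain G where G: "EF G" "g = L0_class M G"
      by (auto elim: E_rep)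
    note [measurable] = EF_measurable[OF G(1)] fm
    have "AE w in M. Im (G w) = 0 \<and> Re (G w) \<le> f n w" for n
      using le G(2) by (auto simp: D_def L0_le_class)
    then have "AE w in M. \<forall>n. Im (G w) = 0 \<and> Re (G w) \<le> f n w"
      by (simp add: AE_all_countable)
    then have "AE w in M. Im (G w) = 0 \<and> Re (G w) \<le> 0"
      using lim
    proof eventually_elim
      case (elim w)
      then show ?case
        using LIMSEQ_le_const[OF elim(2)] by blast
    qed
    then show "L0_le M g \<zero>\<^bsub>L0 M\<^esub>"
      by (simp add: G L0_zero L0_le_class)
  qed
  moreover have "eventually (\<lambda>(y, z). L0_le M (vnorm U (y \<ominus> z)) a) (F \<times>\<^sub>F F)" if aD: "a \<in> D" for a
  proof -
    obtain n where a: "a = L0_class M (\<lambda>w. complex_of_real (f n w))"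
      using aD by (auto simp: D_def)
    have "L0_le M (vnorm U (x k \<ominus> x l)) a" if "n \<le> k" "n \<le> l" for k l
    proof -
      have "AE w in M. nr (x k \<ominus> x l) w \<le> f n w"
      proof (cases "k \<le> l")
        case True
        from cauchy[OF True] dec[OF \<open>n \<le> k\<close>] show ?thesis
          by eventually_elim simp
      next
        case False
        then have "l \<le> k" by simp
        from cauchy[OF this] dec[OF \<open>n \<le> l\<close>] nr_minus_commute[OF x x, of k l] show ?thesis
          by eventually_elim simp
      qed
      then show ?thesis
        using x fm by (simp add: a vnorm_le_iff)
    qed
    then show ?thesis
      unfolding eventually_prod_filter using ev[of n]
      by (intro exI[of _ "\<lambda>z. \<exists>k\<ge>n. z = x k"]) auto
  qed
  ultimately have "bo_cauchy M E U F"
    unfolding bo_cauchy_def by blast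
  moreover have "F \<noteq> bot" "eventually (\<lambda>z. z \<in> carrier U) F"
    using x by (auto simp: F_def filtermap_bot_iff eventually_filtermap)
  ultimately obtain y where y: "y \<in> carrier U" "bo_tendsto M E U F y"
    using BK unfolding BK_algebra_def bo_complete_def by blast
  then obtain D' where D': "decreases_to_zero M E D'"
    "\<And>a. a \<in> D' \<Longrightarrow> eventually (\<lambda>z. L0_le M (vnorm U (y \<ominus> z)) a) F"
    by (auto simp: bo_tendsto_def)
  have "AE w in M. nr (y \<ominus> x n) w \<le> f n w" for n
  proof -
    \<comment> \<open>\<open>?G\<close> lies below every member of \<open>D'\<close>: beyond some
      \<open>k \<ge> n\<close> the distance of \<open>y\<close> to \<open>x k\<close> is bounded by
      that member, and the distance of \<open>x k\<close> to \<open>x n\<close> is at most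
      \<open>f n\<close>. Hence \<open>?G\<close> is at most 0.\<close>
    let ?G = "\<lambda>w. complex_of_real (nr (y \<ominus> x n) w + - 1 * f n w)"
    have G: "EF ?G"
      by (intro RF_add RF_mult nr_RF um.M.minus_closed y x f EF_const)
    note [measurable] = EF_measurable[OF G]
    have "L0_le M (L0_class M ?G) a" if a: "a \<in> D'" for a
    proof -
      have "a \<in> E" using a D'(1) by (auto simp: decreases_to_zero_def)
      then obtain A where A: "EF A" "a = L0_class M A"
        by (rule E_rep)
      have "eventually (\<lambda>z. L0_le M (vnorm U (y \<ominus> z)) a \<and> (\<exists>k\<ge>n. z = x k)) F"
        using D'(2)[OF a] ev[of n] by (rule eventually_conj)
      then obtain k where k: "k \<ge> n" "L0_le M (vnorm U (y \<ominus> x k)) a"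
        using eventually_happens'[OF \<open>F \<noteq> bot\<close>] by blast
      then have "AE w in M. Im (A w) = 0 \<and> nr (y \<ominus> x k) w \<le> Re (A w)"
        using y x A by (simp add: vnorm_le_iff EF_measurable)
      then have "AE w in M. Im (?G w) = Im (A w) \<and> Re (?G w) \<le> Re (A w)"
        using cauchy[OF k(1)] nr_minus_commute[OF x[of n] x[of k]]
          nr_minus_triangle[OF y(1) x[of k] x[of n]]
        by eventually_elim simp
      then show ?thesis
        unfolding A(2) L0_le_class[OF EF_measurable[OF G] EF_measurable[OF A(1)]] .
    qed
    then have "L0_le M (L0_class M ?G) \<zero>\<^bsub>L0 M\<^esub>"
      using D'(1) G unfolding decreases_to_zero_def EF_def by blast
    then have "AE w in M. Im (?G w) = Im 0 \<and> Re (?G w) \<le> Re 0"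
      unfolding L0_zero L0_le_class[OF EF_measurable[OF G] EF_measurable[OF EF_const]] .
    then show ?thesis
      by eventually_elim simp
  qed
  with y(1) show ?thesis
    by (rule that)
qed


subsection \<open>The bounded part and its fibres\<close>

definition Ub :: "'u set" where
  "Ub = {x \<in> carrier U. ess_bounded M (nr x)}"

lemma Ub_carrier [simp, intro]: "x \<in> Ub \<Longrightarrow> x \<in> carrier U"
  and Ub_bounded: "x \<in> Ub \<Longrightarrow> ess_bounded M (nr x)"
  by (simp_all add: Ub_def)

lemma UbI:
  assumes "x \<in> carrier U" "ess_bounded M g" "AE w in M. nr x w \<le> g w"
  shows "x \<in> Ub"
proof -
  have "AE w in M. norm (nr x w) \<le> norm (g w)"
    using assms(3) by eventually_elim (simp add: nr_nonneg[OF assms(1)])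
  then have "ess_bounded M (nr x)"
    using assms by (intro ess_bounded_mono[OF assms(2)]) auto
  then show ?thesis
    using assms(1) unfolding Ub_def by blast
qed

lemma Ub_add [intro]:
  assumes "x \<in> Ub" "y \<in> Ub"
  shows "x \<oplus> y \<in> Ub"
proof (rule UbI)
  show "ess_bounded M (\<lambda>w. nr x w + nr y w)"
    by (intro ess_bounded_add Ub_bounded assms)
qed (use assms in \<open>auto intro: nr_add\<close>)

lemma Ub_mult [intro]:
  assumes "x \<in> Ub" "y \<in> Ub"
  shows "x \<otimes> y \<in> Ub"
proof (rule UbI)
  show "ess_bounded M (\<lambda>w. nr x w * nr y w)"
    by (intro ess_bounded_mult Ub_bounded assms)
qed (use assms in \<open>auto intro: nr_mult mult_closed\<close>)

lemma Ub_act [intro]: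
  assumes "ess_bounded M f" "x \<in> Ub"
  shows "act f x \<in> Ub"
proof (rule UbI)
  show "act f x \<in> carrier U"
    using assms by (intro act_closed EF_bounded) auto
  show "ess_bounded M (\<lambda>w. cmod (f w) * nr x w)"
    using assms by (intro ess_bounded_mult ess_bounded_cmod Ub_bounded)
  have "AE w in M. nr (act f x) w = cmod (f w) * nr x w"
    using assms by (intro nr_act EF_bounded) auto
  then show "AE w in M. nr (act f x) w \<le> cmod (f w) * nr x w"
    by eventually_elim simp
qed

lemma Ub_zero [simp, intro]: "\<zero> \<in> Ub"
proof (rule UbI)
  show "AE w in M. nr \<zero> w \<le> 0"
    using nr_zero by eventually_elim simp
qed auto

lemma Ub_minus [intro]: "\<lbrakk>x \<in> Ub; y \<in> Ub\<rbrakk> \<Longrightarrow> x \<ominus> y \<in> Ub"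
  by (auto simp: minus_act)

text \<open>Stated for any norm-preserving bijection onto the classes, since it is needed for the
  constructed bundle and again for arbitrary representing bundles.\<close>

lemma Linf_sec_image:
  assumes bij: "bij_betw f (carrier U) (E_sec M E X L)"
    and norm: "\<And>x. x \<in> carrier U \<Longrightarrow> cls_norm M X (f x) = vnorm U x"
  shows "Linf_sec M X L = f ` Ub"
proof -
  have "Linf M \<subseteq> E"
    using solid by (simp add: faithful_solid_subalgebra_def)
  then have "Linf_sec M X L = {Y \<in> f ` carrier U. cls_norm M X Y \<in> Linf M}"
    using bij by (auto simp: E_sec_def bij_betw_def)
  also have "\<dots> = f ` {x \<in> carrier U. vnorm U x \<in> Linf M}"
    by (auto simp: norm)
  also have "{x \<in> carrier U. vnorm U x \<in> Linf M} = Ub"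
    unfolding Ub_def using nr_measurable
    by (auto simp: vnorm_nr L0_class_in_Linf_iff)
  finally show ?thesis .
qed

text \<open>Complex numbers act through constant functions in \<open>E\<close>, so that this action
  and multiplication by functions obey the same rules for \<open>act\<close>.\<close>

definition UbA :: "(complex, 'u) module" where
  "UbA = \<lparr>carrier = Ub, monoid.mult = monoid.mult U, one = one U, zero = zero U, add = add U,
          smult = (\<lambda>c. act (\<lambda>_. c))\<rparr>"

lemma UbA_simps [simp]:
  "carrier UbA = Ub" "x \<otimes>\<^bsub>UbA\<^esub> y = x \<otimes> y" "x \<oplus>\<^bsub>UbA\<^esub> y = x \<oplus> y"
  "\<zero>\<^bsub>UbA\<^esub> = \<zero>" "c \<odot>\<^bsub>UbA\<^esub> x = act (\<lambda>_. c) x"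
  by (simp_all add: UbA_def)

lemma assoc_algebra_UbA: "assoc_algebra complex_ring UbA"
proof -
  have "abelian_group UbA"
  proof (rule abelian_groupI)
    fix x assume x: "x \<in> carrier UbA"
    then have "act (\<lambda>_. - 1) x \<oplus> x = \<zero>"
      using um.M.l_neg[of x] by (simp add: uminus_act)
    then show "\<exists>y\<in>carrier UbA. y \<oplus>\<^bsub>UbA\<^esub> x = \<zero>\<^bsub>UbA\<^esub>"
      using x by (intro bexI[of _ "act (\<lambda>_. - 1) x"]) auto
  qed (auto simp: um.add.m_ac)
  then have "Module.module complex_ring UbA"
    by (intro moduleI cring_complex_ring)
       (auto simp: act_add_left act_add_right act_act act_one)
  then show ?thesis
    by (auto simp: assoc_algebra_def mult_assoc mult_distr_l mult_distr_r act_mult_l act_mult_r)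
qed

lemma UbA_minus:
  assumes "x \<in> Ub" "y \<in> Ub"
  shows "x \<ominus>\<^bsub>UbA\<^esub> y = x \<ominus> y"
proof -
  \<comment> \<open>The zero seminorm only serves to make the subtraction formula of the locale
    available.\<close>
  interpret seminormed_alg UbA "\<lambda>_. 0"
    by unfold_locales (auto simp: assoc_algebra_UbA)
  show ?thesis
    using assms by (simp add: minus_scale minus_act)
qed

text \<open>The norm inequalities of \<open>U\<close> hold almost everywhere; monotonicity of the
  lifting turns them into inequalities at the given point, where sums and products are
  preserved.\<close>

lemma seminormed_UbA:
  assumes w: "w \<in> space M"
  shows "seminormed_alg UbA (\<lambda>x. PR (nr x) w)"
proof
  show "assoc_algebra complex_ring UbA"
    by (rule assoc_algebra_UbA)
next
  fix x assume "x \<in> carrier UbA"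
  then show "0 \<le> PR (nr x) w"
    using w by (auto intro!: PR_nonneg Ub_bounded simp: nr_nonneg)
next
  fix c x assume x: "x \<in> carrier UbA"
  have "PR (nr (act (\<lambda>_. c) x)) = PR (\<lambda>w. cmod c * nr x w)"
    using x nr_act[of "\<lambda>_. c" x] by (intro PR_cong) auto
  then show "PR (nr (c \<odot>\<^bsub>UbA\<^esub> x)) w = cmod c * PR (nr x) w"
    using x w by (simp add: PR_scale Ub_bounded)
next
  fix x y assume xy: "x \<in> carrier UbA" "y \<in> carrier UbA"
  then have "PR (nr (x \<oplus> y)) w \<le> PR (\<lambda>w. nr x w + nr y w) w"
    using w by (intro PR_mono nr_add ess_bounded_add Ub_bounded Ub_add) auto
  then show "PR (nr (x \<oplus>\<^bsub>UbA\<^esub> y)) w \<le> PR (nr x) w + PR (nr y) w"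
    using xy w by (simp add: PR_add Ub_bounded)
  have "PR (nr (x \<otimes> y)) w \<le> PR (\<lambda>w. nr x w * nr y w) w"
    using w xy by (intro PR_mono nr_mult ess_bounded_mult Ub_bounded Ub_mult) auto
  then show "PR (nr (x \<otimes>\<^bsub>UbA\<^esub> y)) w \<le> PR (nr x) w * PR (nr y) w"
    using xy w by (simp add: PR_mult Ub_bounded)
qed

definition fib :: "'a \<Rightarrow> 'u set normed_alg" where
  "fib w = seminorm_quot UbA (\<lambda>x. PR (nr x) w)"

definition q :: "'a \<Rightarrow> 'u \<Rightarrow> 'u set" where
  "q w x = seminorm_class UbA (\<lambda>x. PR (nr x) w) x"

context
  fixes w assumes w: "w \<in> space M"
begin

interpretation seminormed_alg UbA "\<lambda>x. PR (nr x) w"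
  using w by (rule seminormed_UbA)

lemma fib_normed: "normed_carrier_alg (fib w)"
  unfolding fib_def by (rule normed_quot)

lemma fib_carrier: "carrier (fib w) = q w ` Ub"
  by (auto simp: fib_def q_def carrier_quot)

lemma q_closed [simp, intro]: "x \<in> Ub \<Longrightarrow> q w x \<in> carrier (fib w)"
  by (simp add: fib_carrier)

lemma q_add: "\<lbrakk>x \<in> Ub; y \<in> Ub\<rbrakk> \<Longrightarrow> q w x \<oplus>\<^bsub>fib w\<^esub> q w y = q w (x \<oplus> y)"
  and q_mult: "\<lbrakk>x \<in> Ub; y \<in> Ub\<rbrakk> \<Longrightarrow> q w x \<otimes>\<^bsub>fib w\<^esub> q w y = q w (x \<otimes> y)"
  and q_scale: "x \<in> Ub \<Longrightarrow> c \<odot>\<^bsub>fib w\<^esub> q w x = q w (act (\<lambda>_. c) x)"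
  and q_minus: "\<lbrakk>x \<in> Ub; y \<in> Ub\<rbrakk> \<Longrightarrow> q w x \<ominus>\<^bsub>fib w\<^esub> q w y = q w (x \<ominus> y)"
  and q_norm: "x \<in> Ub \<Longrightarrow> fnorm (fib w) (q w x) = PR (nr x) w"
  and q_zero: "\<zero>\<^bsub>fib w\<^esub> = q w \<zero>"
  and q_eq_iff: "\<lbrakk>x \<in> Ub; y \<in> Ub\<rbrakk> \<Longrightarrow> q w x = q w y \<longleftrightarrow> PR (nr (x \<ominus> y)) w = 0"
  using add_quot[of x y] mult_quot[of x y] scale_quot[of x c] minus_quot[of x y] fnorm_quot[of x]
    cls_eq_iff[of x y] zero_quot
  by (auto simp: fib_def q_def UbA_minus)

text \<open>At \<open>w\<close> the function \<open>f\<close> acts like the constant c =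
  \<open>P f w\<close>: the difference g = f - c has lifting 0 at \<open>w\<close>, hence so has
  |g|, and the norm of the product of g and \<open>x\<close> is |g| times the norm of
  \<open>x\<close>, which therefore also lifts to 0.\<close>

lemma q_act:
  assumes f: "ess_bounded M f" and x: "x \<in> Ub"
  shows "q w (act f x) = P f w \<odot>\<^bsub>fib w\<^esub> q w x"
proof -
  define c where "c = P f w"
  define g where "g = (\<lambda>w. f w + - c)"
  have g: "ess_bounded M g"
    unfolding g_def using f by (intro ess_bounded_add) auto
  have "P g w = 0"
    unfolding g_def using f w by (subst P_add) (auto simp: P_const c_def)
  have "act g x = act f x \<ominus> act (\<lambda>_. c) x"
    using act_diff[OF EF_bounded[OF f] EF_const, of x c] x by (simp add: g_def)
  then have "AE w in M. nr (act f x \<ominus> act (\<lambda>_. c) x) w = cmod (g w) * nr x w"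
    using nr_act[OF EF_bounded[OF g], of x] x by simp
  then have "PR (nr (act f x \<ominus> act (\<lambda>_. c) x)) w = PR (\<lambda>w. cmod (g w) * nr x w) w"
    using x f ess_boundedD[OF g] by (intro fun_cong[OF PR_cong]) (auto intro!: nr_measurable um.M.minus_closed act_closed EF_bounded)
  also have "\<dots> = 0"
    using x g w \<open>P g w = 0\<close> by (simp add: PR_mult Ub_bounded ess_bounded_cmod PR_cmod_eq_0)
  finally have "q w (act f x) = q w (act (\<lambda>_. c) x)"
    using x f by (subst q_eq_iff) auto
  then show ?thesis
    using x by (simp add: q_scale c_def)
qed

text \<open>A representative is cut off to the set where its norm is below \<open>r\<close>, to which \<open>w\<close> belongs in the
  sense of the lifting.\<close>

lemma q_cutoff:
  assumes x: "x \<in> Ub" and r: "PR (nr x) w < r"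
  shows "\<exists>y\<in>Ub. PR (nr (x \<ominus> y)) w = 0 \<and> (AE w in M. nr y w \<le> r)"
proof -
  have [measurable]: "nr x \<in> borel_measurable M"
    using x by auto
  define A where "A = {w\<in>space M. nr x w \<le> r}"
  have A: "A \<in> sets M" "space M - A \<in> sets M"
    unfolding A_def by measurable
  let ?a = "\<lambda>w. complex_of_real (indicator A w)"
  let ?b = "\<lambda>w. indicator (space M - A) w :: real"
  have a: "ess_bounded M ?a" and b: "ess_bounded M ?b"
    using A by (auto intro: ess_bounded_indicator)
  have r0: "0 < r"
    using r s_nonneg[of x] x by simp
  let ?y = "act ?a x"
  have y: "?y \<in> Ub"
    using a x by (rule Ub_act)
  have nx: "0 \<le> nr x w" for w
    using x by (intro nr_nonneg) auto
  have "AE w in M. nr ?y w = cmod (?a w) * nr x w"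
    using a x by (intro nr_act EF_bounded) auto
  then have "AE w in M. nr ?y w \<le> r"
    using AE_space by eventually_elim (use r0 in \<open>auto simp: A_def indicator_def\<close>)
  moreover have "PR (nr (x \<ominus> ?y)) w = 0"
  proof -
    have "x \<ominus> ?y = act (\<lambda>_. 1) x \<ominus> ?y"
      using x by (simp add: act_one)
    also have "\<dots> = act (\<lambda>w. 1 - ?a w) x"
      using x a by (subst act_diff) (auto intro: EF_bounded)
    also have "\<dots> = ract ?b x"
    proof (rule act_cong)
      have "ess_bounded M (\<lambda>w. 1 + - 1 * ?a w)"
        using a by (intro ess_bounded_add ess_bounded_mult) auto
      then show "EF (\<lambda>w. 1 - ?a w)"
        by (intro EF_bounded) simp
      show "RF ?b"
        using b by (rule RF_bounded)
      show "AE w in M. 1 - ?a w = complex_of_real (?b w)"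
        using AE_space by eventually_elim (auto simp: indicator_def)
    qed
    finally have "AE w in M. nr (x \<ominus> ?y) w = cmod (complex_of_real (?b w)) * nr x w"
      using nr_act[OF RF_bounded[OF b], of x] x by simp
    then have "AE w in M. nr (x \<ominus> ?y) w = ?b w * nr x w"
      by eventually_elim simp
    then have "PR (nr (x \<ominus> ?y)) = PR (\<lambda>w. ?b w * nr x w)"
      using x y A by (intro PR_cong) auto
    then have eq: "PR (nr (x \<ominus> ?y)) w = PR ?b w * PR (nr x) w"
      using x b w by (simp add: PR_mult Ub_bounded)
    \<comment> \<open>Off \<open>A\<close> the norm of \<open>x\<close> is at least
      \<open>r\<close>. Lifted to \<open>w\<close>, this says that r b \<le> b
      \<open>PR (nr x) w\<close> for b = \<open>PR ?b w\<close> \<ge> 0; as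
      \<open>PR (nr x) w\<close> is smaller than \<open>r\<close>, b must be 0.\<close>
    have "PR (\<lambda>w. r * ?b w) w \<le> PR (\<lambda>w. ?b w * nr x w) w"
    proof (rule PR_mono[OF _ _ _ w])
      show "ess_bounded M (\<lambda>w. r * ?b w)" "ess_bounded M (\<lambda>w. ?b w * nr x w)"
        using b x by (auto intro!: ess_bounded_mult Ub_bounded)
      show "AE w in M. r * ?b w \<le> ?b w * nr x w"
        using AE_space by eventually_elim (auto simp: A_def indicator_def)
    qed
    then have "r * PR ?b w \<le> PR ?b w * PR (nr x) w"
      using b x w by (simp add: PR_mult PR_const Ub_bounded)
    moreover have "0 \<le> PR ?b w"
      using b w by (intro PR_nonneg) auto
    ultimately have "PR ?b w = 0"
      using r by (metis mult.commute mult_less_cancel_left_pos not_le order_le_less)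
    then show ?thesis
      by (simp add: eq)
  qed
  ultimately show ?thesis
    using y by blast
qed

lemma fib_banach: "banach_alg (fib w)"
  unfolding fib_def
proof (rule quot_banach_alg[where t = "\<lambda>x r. AE w in M. nr x w \<le> r"])
  fix x r assume "x \<in> carrier UbA" "PR (nr x) w < r"
  then show "\<exists>y\<in>carrier UbA. PR (nr (x \<ominus>\<^bsub>UbA\<^esub> y)) w = 0 \<and> (AE w in M. nr y w \<le> r)"
    using q_cutoff[of x r] by (auto simp: UbA_minus)
next
  fix f :: "nat \<Rightarrow> 'u"
  assume f: "\<And>n. f n \<in> carrier UbA"
    and step: "\<And>n. AE w in M. nr (f (Suc n) \<ominus>\<^bsub>UbA\<^esub> f n) w \<le> (1/2) ^ n"
  have fU: "f n \<in> Ub" "f n \<in> carrier U" for n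
    using f[of n] by auto
  \<comment> \<open>The bound is the exact value of the geometric sum of (1/2)^j for j from n to
    n+k-1, so the induction closes without loss.\<close>
  have tele: "AE w in M. nr (f n \<ominus> f (n + k)) w \<le> 2 * (1/2) ^ n - 2 * (1/2) ^ (n + k)" for n k
  proof (induction k)
    case 0
    have "f n \<ominus> f n = \<zero>"
      using fU by (simp add: a_minus_def um.M.r_neg)
    then have "AE w in M. nr (f n \<ominus> f n) w \<le> 0"
      using nr_zero by (auto elim: AE_mp)
    then show ?case
      by simp
  next
    case (Suc k)
    have "AE w in M. nr (f (Suc (n + k)) \<ominus> f (n + k)) w \<le> (1/2) ^ (n + k)"
      using step[of "n + k"] fU by (simp add: UbA_minus)
    then show ?case
      using Suc nr_minus_commute[OF fU(2)[of "n + k"] fU(2)[of "Suc (n + k)"]]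
        nr_minus_triangle[OF fU(2)[of n] fU(2)[of "n + k"] fU(2)[of "Suc (n + k)"]]
      by eventually_elim simp
  qed
  \<comment> \<open>With constants as majorants, order convergence is uniform convergence, so order
    completeness gives completeness for the essential supremum norm.\<close>
  obtain y where y: "y \<in> carrier U" "\<And>n. AE w in M. nr (y \<ominus> f n) w \<le> 2 * (1/2) ^ n"
  proof (rule seq_complete[of f "\<lambda>n _. 2 * (1/2) ^ n"])
    show "RF (\<lambda>_. 2 * (1/2) ^ n)" for n
      by (rule RF_bounded) simp
    show "AE w in M. 2 * (1/2::real) ^ m \<le> 2 * (1/2) ^ n" if "n \<le> m" for n m :: nat
      using that by (simp add: power_decreasing)
    have "(\<lambda>n. 2 * (1/2::real) ^ n) \<longlonglongrightarrow> 2 * 0"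
      by (intro tendsto_intros LIMSEQ_realpow_zero) auto
    then show "AE w in M. (\<lambda>n. 2 * (1/2::real) ^ n) \<longlonglongrightarrow> 0"
      by simp
    show "AE w in M. nr (f n \<ominus> f m) w \<le> 2 * (1/2) ^ n" if nm: "n \<le> m" for n m
    proof -
      obtain k where m: "m = n + k"
        using le_Suc_ex[OF nm] by blast
      have "0 \<le> 2 * (1/2::real) ^ (n + k)"
        by simp
      with tele[of n k] show ?thesis
        unfolding m by (auto elim!: eventually_mono intro: order_trans)
    qed
  qed (use fU in auto)
  have "y \<in> Ub"
  proof (rule UbI[OF y(1)])
    show "ess_bounded M (\<lambda>w. nr (f 0) w + 2)"
      using fU by (intro ess_bounded_add Ub_bounded) auto
    show "AE w in M. nr y w \<le> nr (f 0) w + 2"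
      using nr_le_minus[OF y(1) fU(2)[of 0]] y(2)[of 0] by eventually_elim simp
  qed
  moreover have "PR (nr (y \<ominus>\<^bsub>UbA\<^esub> f n)) w \<le> 2 * (1/2) ^ n" for n
  proof -
    have "PR (nr (y \<ominus> f n)) w \<le> PR (\<lambda>_. 2 * (1/2) ^ n) w"
      using \<open>y \<in> Ub\<close> fU y(2)[of n] w by (intro PR_mono Ub_bounded Ub_minus) auto
    then show ?thesis
      using \<open>y \<in> Ub\<close> fU w by (simp add: UbA_minus PR_const)
  qed
  ultimately show "\<exists>x\<in>carrier UbA. \<forall>n. PR (nr (x \<ominus>\<^bsub>UbA\<^esub> f n)) w \<le> 2 * (1/2) ^ n"
    by auto
qed

end

subsection \<open>The bundle of fibres\<close>

definition sec :: "'u \<Rightarrow> 'a \<rightharpoonup> 'u set" where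
  "sec x = (\<lambda>w. if w \<in> space M then Some (q w x) else None)"

text \<open>All evaluations of bounded elements at once. This set is already closed under linear
  combinations and products, so nothing has to be generated from it.\<close>

definition Lb :: "('a \<rightharpoonup> 'u set) set" where
  "Lb = sec ` Ub"

lemma dom_sec: "dom (sec x) = space M"
  by (auto simp: sec_def split: if_splits)

lemma sec_section: "x \<in> Ub \<Longrightarrow> is_section M fib (sec x)"
  using AE_space[of M] by (auto simp: is_section_def dom_sec) (simp add: sec_def)

lemma sec_add_sec: "\<lbrakk>x \<in> Ub; y \<in> Ub\<rbrakk> \<Longrightarrow> sec_add fib (sec x) (sec y) = sec (x \<oplus> y)"
  by (auto simp: sec_add_def dom_sec fun_eq_iff) (simp_all add: sec_def q_add)

lemma sec_mult_sec: "\<lbrakk>x \<in> Ub; y \<in> Ub\<rbrakk> \<Longrightarrow> sec_mult fib (sec x) (sec y) = sec (x \<otimes> y)"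
  by (auto simp: sec_mult_def dom_sec fun_eq_iff) (simp_all add: sec_def q_mult)

lemma sec_scale_sec: "\<lbrakk>ess_bounded M f; x \<in> Ub\<rbrakk> \<Longrightarrow> sec_scale fib (P f) (sec x) = sec (act f x)"
  by (auto simp: sec_scale_def dom_sec fun_eq_iff) (simp_all add: sec_def q_act)

lemma sec_scale_const_sec: "x \<in> Ub \<Longrightarrow> sec_scale fib (\<lambda>_. c) (sec x) = sec (act (\<lambda>_. c) x)"
  by (auto simp: sec_scale_def dom_sec fun_eq_iff) (simp_all add: sec_def q_scale)

lemma sec_norm_sec: "\<lbrakk>x \<in> Ub; w \<in> space M\<rbrakk> \<Longrightarrow> sec_norm fib (sec x) w = PR (nr x) w"
  by (simp add: sec_norm_def sec_def q_norm)

lemma sec_norm_measurable: "x \<in> Ub \<Longrightarrow> sec_norm fib (sec x) \<in> borel_measurable M"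
  using PR_measurable[OF Ub_bounded, of x] measurable_cong[of M "sec_norm fib (sec x)" "PR (nr x)" borel]
  by (simp add: sec_norm_sec)

lemma weak_bundle_fib: "weak_measurable_bundle M fib Lb"
  unfolding weak_measurable_bundle_def
proof (intro conjI ballI allI)
  fix w assume w: "w \<in> space M"
  then show "banach_alg (fib w)" by (rule fib_banach)
  have "{the (c w) |c. c \<in> Lb \<and> w \<in> dom c} = carrier (fib w)"
  proof (intro equalityI subsetI)
    fix \<xi> assume "\<xi> \<in> carrier (fib w)"
    then obtain x where "x \<in> Ub" "\<xi> = the (sec x w)"
      using w by (auto simp: fib_carrier sec_def)
    then show "\<xi> \<in> {the (c w) |c. c \<in> Lb \<and> w \<in> dom c}"
      using w by (auto simp: Lb_def sec_def intro!: exI[of _ "sec x"])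
  qed (use w in \<open>auto simp: Lb_def sec_def\<close>)
  then show "dense_in_alg (fib w) {the (c w) |c. c \<in> Lb \<and> w \<in> dom c}"
    using normed_carrier_alg.dense_in_alg_carrier[OF fib_normed[OF w]] by simp
next
  fix c assume "c \<in> Lb"
  then obtain x where x: "x \<in> Ub" "c = sec x" by (auto simp: Lb_def)
  then show "is_section M fib c" by (simp add: sec_section)
  show "sec_norm fib c \<in> borel_measurable (restrict_space M (dom c))"
    using x by (auto intro: measurable_restrict_space1 sec_norm_measurable)
  fix d assume "d \<in> Lb"
  then obtain y where y: "y \<in> Ub" "d = sec y" by (auto simp: Lb_def)
  show "sec_mult fib c d \<in> Lb"
    using x y by (auto simp: sec_mult_sec Lb_def)
  fix s t
  show "sec_add fib (sec_scale fib (\<lambda>_. s) c) (sec_scale fib (\<lambda>_. t) d) \<in> Lb"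
    using x(1) y(1) by (auto simp: x(2) y(2) sec_scale_const_sec sec_add_sec Ub_act Lb_def)
qed

sublocale wb: weak_bundle M fib Lb
  by unfold_locales (rule weak_bundle_fib)


subsection \<open>Elements of the algebra as classes of sections\<close>

text \<open>Multiplication by a strictly positive \<open>h\<close> moves any element into the bounded part, where its
  value at a point is defined.\<close>

definition good :: "('a \<Rightarrow> real) \<Rightarrow> 'u \<Rightarrow> bool" where
  "good h x \<longleftrightarrow> ess_bounded M h \<and> (\<forall>w. 0 < h w) \<and> ract h x \<in> Ub"

abbreviation rep_at :: "('a \<Rightarrow> real) \<Rightarrow> 'u \<Rightarrow> ('a \<rightharpoonup> 'u set) \<Rightarrow> 'a \<Rightarrow> bool" where
  "rep_at h x u w \<equiv> w \<in> space M \<and> u w = Some (the (u w)) \<and> the (u w) \<in> carrier (fib w) \<and>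
     complex_of_real (h w) \<odot>\<^bsub>fib w\<^esub> the (u w) = q w (ract h x)"

definition Rep_via :: "('a \<Rightarrow> real) \<Rightarrow> 'u \<Rightarrow> ('a \<rightharpoonup> 'u set) \<Rightarrow> bool" where
  "Rep_via h x u \<longleftrightarrow> good h x \<and>
     (AE w in M. rep_at h x u w)"

text \<open>The weight is not canonical: \<open>Rep_via_mult\<close> allows it to be refined, and
  \<open>Rep_via_common\<close> makes two elements share one.\<close>

definition Rep :: "'u \<Rightarrow> ('a \<rightharpoonup> 'u set) \<Rightarrow> bool" where
  "Rep x u \<longleftrightarrow> (\<exists>h. Rep_via h x u)"

lemma good_RF: "good h x \<Longrightarrow> RF h"
  by (auto simp: good_def intro: RF_bounded)

lemma q_act_AE:
  assumes "ess_bounded M f" "x \<in> Ub"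
  shows "AE w in M. q w (act f x) = f w \<odot>\<^bsub>fib w\<^esub> q w x"
  using P_AE[OF assms(1)] AE_space by eventually_elim (simp add: q_act assms)

lemma act_Rf: "\<lbrakk>RF k; RF h; x \<in> carrier U\<rbrakk> \<Longrightarrow> ract k (ract h x)
    = act (\<lambda>w. complex_of_real (k w * h w)) x"
  by (simp add: act_act)

lemma good_mult:
  assumes "good h x" "ess_bounded M k" "\<And>w. 0 < k w" "x \<in> carrier U"
  shows "good (\<lambda>w. k w * h w) x"
proof -
  have "ract k (ract h x) \<in> Ub"
    using assms by (intro Ub_act[where x = "act _ x"]) (simp_all add: good_def)
  then have "act (\<lambda>w. complex_of_real (k w * h w)) x \<in> Ub"
    unfolding act_Rf[OF RF_bounded[OF assms(2)] good_RF[OF assms(1)] assms(4)] .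
  then show ?thesis
    using assms(1-3) by (auto simp: good_def)
qed

lemma Rep_via_mult:
  assumes u: "Rep_via h x u" and k: "ess_bounded M k" "\<And>w. 0 < k w" and x: "x \<in> carrier U"
  shows "Rep_via (\<lambda>w. k w * h w) x u"
  unfolding Rep_via_def
proof
  have h: "good h x"
    using u by (simp add: Rep_via_def)
  show "good (\<lambda>w. k w * h w) x"
    using h k x by (intro good_mult)
  have hx: "ract h x \<in> Ub"
    using h by (simp add: good_def)
  have "AE w in M. rep_at h x u w"
    using u by (simp add: Rep_via_def)
  moreover have "AE w in M. q w (ract k (ract h x)) =
      complex_of_real (k w) \<odot>\<^bsub>fib w\<^esub> q w (ract h x)"
    using k hx by (intro q_act_AE) auto
  ultimately show "AE w in M. rep_at (\<lambda>w. k w * h w) x u w"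
    unfolding act_Rf[OF RF_bounded[OF k(1)] good_RF[OF h] x]
  proof eventually_elim
    case (elim w)
    interpret f: normed_carrier_alg "fib w"
      using elim by (intro fib_normed) simp
    show ?case
      using elim f.scale_scale[of "the (u w)" "complex_of_real (k w)" "complex_of_real (h w)"] by simp
  qed
qed

text \<open>The product of the two weights serves both elements. Comparing or adding unbounded
  elements thereby becomes a computation with bounded ones.\<close>

lemma Rep_via_common:
  assumes "Rep x u" "Rep y v" "x \<in> carrier U" "y \<in> carrier U"
  obtains h where "Rep_via h x u" "Rep_via h y v"
proof -
  obtain h k where h: "Rep_via h x u" and k: "Rep_via k y v"
    using assms by (auto simp: Rep_def)
  have hb: "ess_bounded M h" "\<And>w. 0 < h w" and kb: "ess_bounded M k" "\<And>w. 0 < k w"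
    using h k by (auto simp: Rep_via_def good_def)
  have "Rep_via (\<lambda>w. k w * h w) x u"
    using h kb assms(3) by (rule Rep_via_mult)
  moreover have "Rep_via (\<lambda>w. h w * k w) y v"
    using k hb assms(4) by (rule Rep_via_mult)
  ultimately show ?thesis
    by (intro that[of "\<lambda>w. h w * k w"]) (simp_all add: mult.commute)
qed

lemma Rep_via_AE:
  assumes "Rep_via h x u"
  shows "AE w in M. rep_at h x u w \<and> 0 < h w \<and> ract h x \<in> Ub"
  using assms by (auto simp: Rep_via_def good_def)

lemma fib_scale_cancel:
  assumes "w \<in> space M" "\<xi> \<in> carrier (fib w)" "\<eta> \<in> carrier (fib w)" "c \<noteq> 0"
    "c \<odot>\<^bsub>fib w\<^esub> \<xi> = c \<odot>\<^bsub>fib w\<^esub> \<eta>"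
  shows "\<xi> = \<eta>"
proof -
  interpret f: normed_carrier_alg "fib w"
    using assms(1) by (rule fib_normed)
  have "inverse c \<odot>\<^bsub>fib w\<^esub> (c \<odot>\<^bsub>fib w\<^esub> \<xi>) = inverse c \<odot>\<^bsub>fib w\<^esub> (c \<odot>\<^bsub>fib w\<^esub> \<eta>)"
    using assms(5) by simp
  then show ?thesis
    using assms(2-4) by (simp add: f.scale_scale f.scale_one)
qed

lemma Rep_unique:
  assumes "Rep x u" "Rep x v" "x \<in> carrier U"
  shows "AE w in M. u w = v w"
proof -
  obtain h where "Rep_via h x u" "Rep_via h x v"
    using assms Rep_via_common by blast
  from this[THEN Rep_via_AE] show ?thesis
  proof eventually_elim
    case (elim w)
    then have *: "w \<in> space M" "the (u w) \<in> carrier (fib w)" "the (v w) \<in> carrier (fib w)"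
      "0 < h w" "complex_of_real (h w) \<odot>\<^bsub>fib w\<^esub> the (u w) = complex_of_real (h w) \<odot>\<^bsub>fib w\<^esub> the (v w)"
      "u w = Some (the (u w))" "v w = Some (the (v w))"
      by (blast, blast, blast, blast, metis, blast, blast)
    have "the (u w) = the (v w)"
      using *(4) by (intro fib_scale_cancel[OF *(1-3) _ *(5)]) simp
    with *(6,7) show ?case
      by metis
  qed
qed

lemma Rep_cong:
  assumes "Rep x u" "AE w in M. v w = u w"
  shows "Rep x v"
proof -
  obtain h where h: "Rep_via h x u"
    using assms by (auto simp: Rep_def)
  have "AE w in M. rep_at h x v w"
    using Rep_via_AE[OF h] assms(2) by eventually_elim auto
  then have "Rep_via h x v"
    using h by (simp add: Rep_via_def)
  then show ?thesis
    by (auto simp: Rep_def)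
qed

text \<open>With a common weight \<open>h\<close>, the elements hx and hy have the same value in
  almost every fibre, so the lifted norm of their difference vanishes almost everywhere. It agrees
  a.e. with h times the norm of x - y, and \<open>h\<close> is strictly positive.\<close>

lemma Rep_inj:
  assumes "Rep x u" "Rep y u" "x \<in> carrier U" "y \<in> carrier U"
  shows "x = y"
proof (rule nr_minus_eq_0[OF assms(3,4)])
  obtain h where h: "Rep_via h x u" "Rep_via h y u"
    using assms Rep_via_common by blast
  let ?h = "\<lambda>w. complex_of_real (h w)"
  have hb: "RF h" and Ub: "act ?h x \<in> Ub" "act ?h y \<in> Ub"
    using h by (auto simp: Rep_via_def good_RF) (auto simp: good_def)
  have "AE w in M. PR (nr (act ?h x \<ominus> act ?h y)) w = 0"
    using h[THEN Rep_via_AE] by eventually_elim (use Ub in \<open>auto simp flip: q_eq_iff\<close>)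
  moreover have "AE w in M. PR (nr (act ?h x \<ominus> act ?h y)) w = nr (act ?h x \<ominus> act ?h y) w"
    using Ub by (intro PR_AE Ub_bounded Ub_minus)
  moreover have "AE w in M. nr (act ?h x \<ominus> act ?h y) w = cmod (?h w) * nr (x \<ominus> y) w"
    using nr_act[OF hb, of "x \<ominus> y"] assms hb by (simp add: act_minus)
  ultimately show "AE w in M. nr (x \<ominus> y) w = 0"
    using Rep_via_AE[OF h(1)] by eventually_elim auto
qed

lemma Rep_norm:
  assumes "Rep x u" "x \<in> carrier U"
  shows "AE w in M. sec_norm fib u w = nr x w"
proof -
  obtain h where h: "Rep_via h x u"
    using assms by (auto simp: Rep_def)
  let ?h = "\<lambda>w. complex_of_real (h w)"
  have hb: "RF h" and Ub: "act ?h x \<in> Ub"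
    using h by (auto simp: Rep_via_def good_RF) (auto simp: good_def)
  show ?thesis
    using Rep_via_AE[OF h] nr_act[OF hb assms(2)] PR_AE[OF Ub_bounded[OF Ub]]
  proof eventually_elim
    case (elim w)
    then interpret f: normed_carrier_alg "fib w"
      by (intro fib_normed) simp
    have "h w * fnorm (fib w) (the (u w)) = fnorm (fib w) (?h w \<odot>\<^bsub>fib w\<^esub> the (u w))"
      using elim f.s_scale[of "the (u w)" "?h w"] by simp
    also have "\<dots> = h w * nr x w"
      using elim by (simp add: q_norm)
    finally show ?case
      using elim by (simp add: sec_norm_def)
  qed
qed

lemma Rep_sec:
  assumes "x \<in> Ub"
  shows "Rep x (sec x)"
proof -
  have "Rep_via (\<lambda>_. 1) x (sec x)"
    unfolding Rep_via_def
  proof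
    show "good (\<lambda>_. 1) x"
      using assms by (simp add: good_def act_one)
    show "AE w in M. rep_at (\<lambda>_. 1) x (sec x) w"
      using AE_space by eventually_elim (use assms in \<open>simp add: sec_def q_scale\<close>)
  qed
  then show ?thesis
    by (auto simp: Rep_def)
qed

lemma Rep_add:
  assumes "Rep x u" "Rep y v" "x \<in> carrier U" "y \<in> carrier U"
  shows "Rep (x \<oplus> y) (sec_add fib u v)"
proof -
  obtain h where h: "Rep_via h x u" "Rep_via h y v"
    using assms Rep_via_common by blast
  let ?h = "\<lambda>w. complex_of_real (h w)"
  have hb: "RF h" and Ub: "act ?h x \<in> Ub" "act ?h y \<in> Ub"
    using h by (auto simp: Rep_via_def good_RF) (auto simp: good_def)
  have eq: "act ?h (x \<oplus> y) = act ?h x \<oplus> act ?h y"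
    using hb assms by (simp add: act_add_right)
  have "Rep_via h (x \<oplus> y) (sec_add fib u v)"
    unfolding Rep_via_def
  proof
    show "good h (x \<oplus> y)"
      using h Ub by (simp add: Rep_via_def good_def eq Ub_add)
    show "AE w in M. rep_at h (x \<oplus> y) (sec_add fib u v) w"
      unfolding eq
      using h[THEN Rep_via_AE]
    proof eventually_elim
      case (elim w)
      then interpret f: normed_carrier_alg "fib w"
        by (intro fib_normed) simp
      have "sec_add fib u v w = Some (the (u w) \<oplus>\<^bsub>fib w\<^esub> the (v w))"
        using elim by (auto simp: sec_add_def)
      then show ?case
        using elim by (simp add: f.scale_add_right q_add)
    qed
  qed
  then show ?thesis
    by (auto simp: Rep_def)
qed

text \<open>A product of two weighted elements carries the square of the common weight.\<close>

lemma Rep_mult: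
  assumes "Rep x u" "Rep y v" "x \<in> carrier U" "y \<in> carrier U"
  shows "Rep (x \<otimes> y) (sec_mult fib u v)"
proof -
  obtain h where h: "Rep_via h x u" "Rep_via h y v"
    using assms Rep_via_common by blast
  let ?h = "\<lambda>w. complex_of_real (h w)"
  let ?k = "\<lambda>w. complex_of_real (h w * h w)"
  have hb: "RF h" and Ub: "act ?h x \<in> Ub" "act ?h y \<in> Ub"
    using h by (auto simp: Rep_via_def good_RF) (auto simp: good_def)
  have eq: "act ?k (x \<otimes> y) = act ?h x \<otimes> act ?h y"
    using hb assms by (simp add: act_mult_l act_mult_r act_act mult_closed)
  have "Rep_via (\<lambda>w. h w * h w) (x \<otimes> y) (sec_mult fib u v)"
    unfolding Rep_via_def
  proof
    show "good (\<lambda>w. h w * h w) (x \<otimes> y)"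
      unfolding good_def eq using h Ub by (auto simp: Rep_via_def good_def Ub_mult)
    show "AE w in M. rep_at (\<lambda>w. h w * h w) (x \<otimes> y) (sec_mult fib u v) w"
      unfolding eq
      using h[THEN Rep_via_AE]
    proof eventually_elim
      case (elim w)
      then interpret f: normed_carrier_alg "fib w"
        by (intro fib_normed) simp
      have uv_car: "the (u w) \<in> carrier (fib w)" "the (v w) \<in> carrier (fib w)"
        using elim by blast+
      have uv: "sec_mult fib u v w = Some (the (u w) \<otimes>\<^bsub>fib w\<^esub> the (v w))"
        using elim by (auto simp: sec_mult_def)
      have "q w (act ?h x \<otimes> act ?h y) = q w (act ?h x) \<otimes>\<^bsub>fib w\<^esub> q w (act ?h y)"
        using elim by (simp add: q_mult)
      also have "\<dots> = (?h w \<odot>\<^bsub>fib w\<^esub> the (u w)) \<otimes>\<^bsub>fib w\<^esub> (?h w \<odot>\<^bsub>fib w\<^esub> the (v w))"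
        using elim by simp
      also have "\<dots> = ?k w \<odot>\<^bsub>fib w\<^esub> (the (u w) \<otimes>\<^bsub>fib w\<^esub> the (v w))"
        using uv_car by (simp add: f.scale_mult_l f.scale_mult_r f.scale_scale f.mult_closed)
      finally show ?case
        using elim uv by (simp add: f.mult_closed)
    qed
  qed
  then show ?thesis
    by (auto simp: Rep_def)
qed

lemma Rep_act:
  assumes "Rep x u" "EF f" "x \<in> carrier U"
  shows "Rep (act f x) (sec_scale fib f u)"
proof -
  obtain h where h: "Rep_via h x u"
    using assms by (auto simp: Rep_def)
  let ?h = "\<lambda>w. complex_of_real (h w)"
  have hb: "ess_bounded M h" "RF h" "\<And>w. 0 < h w" and Ub: "act ?h x \<in> Ub"
    using h by (auto simp: Rep_via_def good_RF) (auto simp: good_def)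
  have [measurable]: "f \<in> borel_measurable M" "h \<in> borel_measurable M"
    using assms hb by (auto intro: EF_measurable ess_boundedD)
  \<comment> \<open>\<open>f\<close> may be unbounded. The extra weight 1/(1+|f|) makes
    \<open>r\<close> times \<open>f\<close> bounded by 1, so that it acts on the bounded element
    hx.\<close>
  define r where "r w = 1 / (1 + cmod (f w))" for w
  have r0: "0 < r w" "r w \<le> 1" for w
    by (simp_all add: r_def add_pos_nonneg)
  have r: "ess_bounded M r"
  proof (rule ess_bounded_bound[of _ _ 1])
    show "r \<in> borel_measurable M"
      unfolding r_def by measurable
    show "AE w in M. norm (r w) \<le> 1"
      using r0 by (simp add: abs_of_pos)
  qed
  have g: "ess_bounded M (\<lambda>w. complex_of_real (r w) * f w)" (is "ess_bounded M ?g")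
  proof (rule ess_bounded_bound[of _ _ 1])
    show "?g \<in> borel_measurable M"
      unfolding r_def by measurable
    have "r w * cmod (f w) \<le> 1" for w
      by (simp add: r_def divide_simps add_pos_nonneg)
    then show "AE w in M. cmod (?g w) \<le> 1"
      using r0 by (simp add: norm_mult abs_of_pos)
  qed
  let ?k = "\<lambda>w. complex_of_real (r w * h w)"
  have eq: "act ?k (act f x) = act ?g (act ?h x)"
    using EF_bounded[OF g] RF_mult[OF RF_bounded[OF r] hb(2)] hb(2) assms
    by (simp add: act_act mult_ac)
  have "Rep_via (\<lambda>w. r w * h w) (act f x) (sec_scale fib f u)"
    unfolding Rep_via_def
  proof
    show "good (\<lambda>w. r w * h w) (act f x)"
      unfolding good_def eq using hb r0 r g Ub by (auto intro: Ub_act ess_bounded_mult)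
    show "AE w in M. rep_at (\<lambda>w. r w * h w) (act f x) (sec_scale fib f u) w"
      unfolding eq
      using Rep_via_AE[OF h] q_act_AE[OF g Ub]
    proof eventually_elim
      case (elim w)
      then interpret f: normed_carrier_alg "fib w"
        by (intro fib_normed) simp
      have u_car: "the (u w) \<in> carrier (fib w)"
        using elim by blast
      have su: "sec_scale fib f u w = Some (f w \<odot>\<^bsub>fib w\<^esub> the (u w))"
        using elim by (auto simp: sec_scale_def)
      have "q w (act ?g (act ?h x)) = ?g w \<odot>\<^bsub>fib w\<^esub> (?h w \<odot>\<^bsub>fib w\<^esub> the (u w))"
        using elim by simp
      also have "\<dots> = ?k w \<odot>\<^bsub>fib w\<^esub> (f w \<odot>\<^bsub>fib w\<^esub> the (u w))"
        using u_car by (simp add: f.scale_scale mult_ac)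
      finally show ?case
        using elim su by simp
    qed
  qed
  then show ?thesis
    by (auto simp: Rep_def)
qed

lemma Rep_exists:
  assumes x: "x \<in> carrier U"
  shows "\<exists>u\<in>measurable_sections M fib Lb. Rep x u"
proof -
  note [measurable] = nr_measurable[OF x]
  have n0: "0 \<le> nr x w" for w
    using x by (rule nr_nonneg)
  \<comment> \<open>This weight brings the norm of hx below 1; the section of \<open>x\<close> is
    then hx multiplied pointwise by the reciprocal 1 + \<open>nr x\<close>.\<close>
  define h where "h w = 1 / (1 + nr x w)" for w
  have h0: "0 < h w" "h w \<le> 1" for w
    using n0[of w] by (simp_all add: h_def add_pos_nonneg)
  have hm [measurable]: "h \<in> borel_measurable M"
    unfolding h_def by measurable
  have hb: "ess_bounded M h"
    by (rule ess_bounded_bound[of _ _ 1]) (use h0 hm in \<open>auto simp: abs_of_pos\<close>)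
  let ?h = "\<lambda>w. complex_of_real (h w)"
  define z where "z = act ?h x"
  have "z \<in> Ub"
  proof (rule UbI[of _ "\<lambda>_. 1"])
    show "z \<in> carrier U"
      unfolding z_def using hb x by (intro act_closed RF_bounded)
    have "AE w in M. nr z w = cmod (?h w) * nr x w"
      unfolding z_def using hb x by (intro nr_act RF_bounded)
    then show "AE w in M. nr z w \<le> 1"
    proof eventually_elim
      case (elim w)
      then have "nr z w = h w * nr x w"
        using h0[of w] by (simp add: abs_of_pos)
      moreover have "h w * nr x w \<le> 1"
        using n0[of w] by (simp add: h_def divide_simps add_pos_nonneg)
      ultimately show ?case
        by simp
    qed
  qed simp
  define u where "u = (\<lambda>w. if w \<in> space M then Some (complex_of_real (1 + nr x w) \<odot>\<^bsub>fib w\<^esub> q w z) else None)"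
  have cl: "complex_of_real (1 + nr x w) \<odot>\<^bsub>fib w\<^esub> q w z \<in> carrier (fib w)"
    and mult: "?h w \<odot>\<^bsub>fib w\<^esub> (complex_of_real (1 + nr x w) \<odot>\<^bsub>fib w\<^esub> q w z) = q w z"
    if w: "w \<in> space M" for w
  proof -
    interpret f: normed_carrier_alg "fib w"
      using w by (rule fib_normed)
    have qz: "q w z \<in> carrier (fib w)"
      using w \<open>z \<in> Ub\<close> by simp
    show "complex_of_real (1 + nr x w) \<odot>\<^bsub>fib w\<^esub> q w z \<in> carrier (fib w)"
      using qz by (rule f.scale_closed)
    have "h w * (1 + nr x w) = 1"
      using n0[of w] by (simp add: h_def add_nonneg_eq_0_iff)
    then have eq: "?h w * complex_of_real (1 + nr x w) = 1"
      by (metis of_real_1 of_real_mult)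
    show "?h w \<odot>\<^bsub>fib w\<^esub> (complex_of_real (1 + nr x w) \<odot>\<^bsub>fib w\<^esub> q w z) = q w z"
      unfolding f.scale_scale[OF qz] eq using qz by (rule f.scale_one)
  qed
  have "Rep_via h x u"
    unfolding Rep_via_def good_def
  proof (intro conjI allI)
    show "AE w in M. rep_at h x u w"
      using AE_space by eventually_elim (use cl mult in \<open>simp add: u_def flip: z_def\<close>)
  qed (use hb h0 \<open>z \<in> Ub\<close> in \<open>auto simp: z_def\<close>)
  then have "Rep x u"
    by (auto simp: Rep_def)
  moreover have "u \<in> measurable_sections M fib Lb"
  proof (rule wb.measurable_sections_glue)
    have "dom u = space M"
      by (auto simp: u_def split: if_splits)
    then show "is_section M fib u"
      using AE_space[of M] cl by (auto simp: is_section_def u_def)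
  next
    \<comment> \<open>The factor 1 + \<open>nr x\<close> is in general unbounded, so it cannot act
      on \<open>z\<close> within \<open>Ub\<close>. On the set where \<open>nr x\<close> is at most
      \<open>k\<close> it can, and there \<open>u\<close> is a.e. the evaluation of a bounded
      element; these pieces are glued.\<close>
    let ?A = "\<lambda>k::nat. {w\<in>space M. nr x w \<le> real k}"
    let ?a = "\<lambda>k w. complex_of_real (indicator (?A k) w * (1 + nr x w))"
    have ab: "ess_bounded M (?a k)" for k
      unfolding ess_bounded_of_real
    proof (rule ess_bounded_bound[of _ _ "1 + real k"])
      show "AE w in M. norm (indicator (?A k) w * (1 + nr x w)) \<le> 1 + real k"
        by (rule AE_I2) (auto simp: indicator_def n0 abs_of_nonneg)
    qed measurable
    show "sec (act (?a k) z) \<in> measurable_sections M fib Lb" for k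
      using ab[of k] \<open>z \<in> Ub\<close> by (intro wb.L_measurable) (auto simp: Lb_def)
    show "?A k \<in> sets M" for k
      by measurable
    show "AE w in M. \<exists>k. w \<in> ?A k"
      using AE_space by eventually_elim (auto intro: real_arch_simple)
    show "AE w in M. w \<in> ?A k \<longrightarrow> u w = sec (act (?a k) z) w" for k
      using q_act_AE[OF ab[of k] \<open>z \<in> Ub\<close>] by eventually_elim (auto simp: u_def sec_def)
  qed
  ultimately show ?thesis
    by blast
qed


text \<open>Cutting an evaluation to \<open>A\<close> is a.e. the evaluation of the indicator of
  \<open>A\<close> acting on the element, so a whole simple section is one single
  evaluation.\<close>

lemma asimple_q:
  assumes "wb.asimple f"
  shows "\<exists>y\<in>Ub. AE w in M. f w = q w y"
  using assms
proof (induction rule: wb.asimple.induct)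
  case (zero f)
  then have "AE w in M. f w = q w \<zero>"
    using AE_space by eventually_elim (simp add: q_zero)
  then show ?case
    by (intro bexI[of _ "\<zero>"]) auto
next
  case (step f c A g)
  obtain y where y: "y \<in> Ub" "AE w in M. f w = q w y"
    using step.IH by blast
  obtain x where x: "x \<in> Ub" "c = sec x"
    using step.hyps(2) by (auto simp: Lb_def)
  let ?i = "indicator A :: 'a \<Rightarrow> complex"
  have i: "ess_bounded M ?i"
    using step.hyps(3) by (intro ess_bounded_bound[of _ _ 1]) (auto simp: indicator_def)
  have "AE w in M. g w = q w (y \<oplus> act ?i x)"
    using step.hyps(4) y(2) q_act_AE[OF i x(1)] AE_space
  proof eventually_elim
    case (elim w)
    then show ?case
      using x y i by (simp add: sec_def q_add[symmetric] Ub_act)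
  qed
  then show ?case
    using x y i by (intro bexI[of _ "y \<oplus> act ?i x"]) auto
qed

text \<open>\<open>d n\<close> is the supremum of the |e k| with k \<ge> n, which turns convergence
  almost everywhere into the monotone majorants that \<open>seq_complete\<close> demands. Off the
  conull set \<open>S\<close> of points with bounded sequences everything is set to 0, which keeps
  the suprema finite at every point.\<close>

lemma decreasing_majorant:
  fixes e :: "nat \<Rightarrow> 'a \<Rightarrow> real"
  assumes e [measurable]: "\<And>n. e n \<in> borel_measurable M"
    and lim: "AE w in M. (\<lambda>n. e n w) \<longlonglongrightarrow> 0"
  obtains d where "\<And>n. d n \<in> borel_measurable M" "\<And>n w. 0 \<le> d n w"
    "\<And>n m w. n \<le> m \<Longrightarrow> d m w \<le> d n w" "AE w in M. (\<lambda>n. d n w) \<longlonglongrightarrow> 0"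
    "\<And>n m. n \<le> m \<Longrightarrow> AE w in M. e m w \<le> d n w"
proof -
  \<comment> \<open>Bounds range over natural numbers, so that \<open>S\<close> is measurable by
    countable operations.\<close>
  define S where "S = {w\<in>space M. \<exists>K::nat. \<forall>n. \<bar>e n w\<bar> \<le> real K}"
  have S [measurable]: "S \<in> sets M"
    unfolding S_def by measurable
  define e' where "e' n w = indicator S w * \<bar>e n w\<bar>" for n w
  have e'm [measurable]: "e' n \<in> borel_measurable M" for n
    unfolding e'_def by measurable
  have bdd: "bdd_above ((\<lambda>k. e' k w) ` I)" for w I
  proof (cases "w \<in> S")
    case True
    then obtain K :: nat where "\<And>n. \<bar>e n w\<bar> \<le> real K"
      by (auto simp: S_def)
    then show ?thesis
      using True by (intro bdd_aboveI2[of _ _ "real K"]) (simp add: e'_def)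
  qed (intro bdd_aboveI2[of _ _ 0], simp add: e'_def)
  define d where "d n w = (SUP k\<in>{n..}. e' k w)" for n w
  have upper: "e' k w \<le> d n w" if "n \<le> k" for n k w
    unfolding d_def using that by (intro cSUP_upper bdd) auto
  have S_AE: "AE w in M. w \<in> S"
    using lim AE_space
  proof eventually_elim
    case (elim w)
    then have "Bseq (\<lambda>n. e n w)"
      by (auto intro: convergent_imp_Bseq convergentI)
    then obtain K where K: "\<And>n. \<bar>e n w\<bar> \<le> K"
      by (auto simp: Bseq_def)
    obtain N :: nat where "K \<le> real N"
      using real_arch_simple by blast
    with K have "\<forall>n. \<bar>e n w\<bar> \<le> real N"
      by (meson order_trans)
    then show ?case
      using elim by (auto simp: S_def)
  qed
  show ?thesis
  proof (rule that)
    show "d n \<in> borel_measurable M" for n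
      unfolding d_def by (rule borel_measurable_cSUP) (auto intro: bdd)
    show "0 \<le> d n w" for n w
      using upper[of n n w] by (auto simp: e'_def intro: order_trans[rotated])
    show "d m w \<le> d n w" if "n \<le> m" for n m w
      unfolding d_def using that by (intro cSUP_subset_mono bdd) auto
    show "AE w in M. e m w \<le> d n w" if "n \<le> m" for n m
      using S_AE
    proof eventually_elim
      case (elim w)
      then show ?case
        using upper[OF that, of w] by (simp add: e'_def)
    qed
    show "AE w in M. (\<lambda>n. d n w) \<longlonglongrightarrow> 0"
      using S_AE lim
    proof eventually_elim
      case (elim w)
      show ?case
      proof (rule LIMSEQ_I)
        fix r :: real assume r: "0 < r"
        obtain N where N: "\<And>n. n \<ge> N \<Longrightarrow> \<bar>e n w\<bar> < r / 2"
          using LIMSEQ_D[OF elim(2), of "r / 2"] r by auto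
        have "d n w \<le> r / 2" if "N \<le> n" for n
          unfolding d_def using N that elim
          by (intro cSUP_least) (auto simp: e'_def intro: less_imp_le)
        moreover have "0 \<le> d n w" for n
          using upper[of n n w] by (auto simp: e'_def intro: order_trans[rotated])
        ultimately show "\<exists>N. \<forall>n\<ge>N. norm (d n w - 0) < r"
          using r by (intro exI[of _ N]) (force simp: abs_of_nonneg)
      qed
    qed
  qed
qed

text \<open>1/h may be unbounded, so z/h is obtained as a limit of truncations of 1/h acting on
  \<open>z\<close>. Since the norm of \<open>z\<close> is hg, the part still missing has norm at
  most |g| outside \<open>A n\<close>; this majorant belongs to \<open>E\<close> by solidity and is
  eventually 0 at each point.\<close>

lemma Rep_divide:
  assumes z: "z \<in> Ub" and h: "ess_bounded M h" "\<And>w. 0 < h w"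
    and g: "RF g" and nz: "AE w in M. nr z w = h w * g w"
  obtains x where "x \<in> carrier U" "ract h x = z"
proof -
  have [measurable]: "h \<in> borel_measurable M" "g \<in> borel_measurable M"
    using h g by (auto intro: ess_boundedD RF_measurable)
  let ?h = "\<lambda>w. complex_of_real (h w)"
  have zU: "z \<in> carrier U"
    using z by auto
  have hE: "RF h"
    using h by (intro RF_bounded)
  \<comment> \<open>There 1/h is at most \<open>n\<close>. Written without a quotient, the condition
    also makes sense for \<open>n = 0\<close>, where \<open>A 0\<close> is empty.\<close>
  define A where "A n = {w\<in>space M. 1 \<le> real n * h w}" for n :: nat
  have A [measurable]: "A n \<in> sets M" for n
    unfolding A_def by measurable
  have A_mono: "w \<in> A m" if "w \<in> A n" "n \<le> m" for n m w
  proof -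
    have "real n * h w \<le> real m * h w"
      using that(2) h(2)[of w] by (intro mult_right_mono) auto
    then show ?thesis
      using that(1) by (auto simp: A_def)
  qed
  have A_ex: "\<exists>n. w \<in> A n" if "w \<in> space M" for w
    using reals_Archimedean3[OF h(2)[of w]] that by (auto simp: A_def intro: less_imp_le)
  define a where "a n w = (indicator (A n) w / h w :: real)" for n w
  have a_m [measurable]: "a n \<in> borel_measurable M" for n
    unfolding a_def by measurable
  have a: "ess_bounded M (a n)" for n
  proof (rule ess_bounded_bound[OF a_m, of _ "real n"])
    show "AE w in M. norm (a n w) \<le> real n"
      using h(2) by (intro AE_I2) (auto simp: a_def A_def indicator_def divide_simps abs_of_pos less_imp_le[OF h(2)])
  qed
  define x where "x n = ract (a n) z" for n
  have xU: "x n \<in> carrier U" for n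
    unfolding x_def using a[of n] zU by (intro act_closed RF_bounded)
  \<comment> \<open>\<open>g\<close> is nonnegative only almost everywhere, as a consequence of
    \<open>nz\<close>; the absolute value makes the majorant monotone at every point.\<close>
  define f where "f n w = (1 - indicator (A n) w) * \<bar>g w\<bar>" for n w
  have f: "RF (f n)" for n
  proof (rule RF_solid[OF g])
    show "f n \<in> borel_measurable M"
      unfolding f_def by measurable
    show "AE w in M. \<bar>f n w\<bar> \<le> \<bar>g w\<bar>"
      by (intro AE_I2) (auto simp: f_def indicator_def)
  qed
  obtain y where y: "y \<in> carrier U" "\<And>n. AE w in M. nr (y \<ominus> x n) w \<le> f n w"
  proof (rule seq_complete[OF xU f])
    show "AE w in M. f m w \<le> f n w" if "n \<le> m" for n m
      using A_mono[OF _ that] by (intro AE_I2) (auto simp: f_def indicator_def)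
    show "AE w in M. (\<lambda>n. f n w) \<longlonglongrightarrow> 0"
      using AE_space
    proof eventually_elim
      case (elim w)
      then obtain N where N: "w \<in> A N"
        using A_ex by blast
      have "eventually (\<lambda>n. f n w = 0) sequentially"
        using eventually_ge_at_top[of N] by eventually_elim (use N A_mono in \<open>auto simp: f_def\<close>)
      then show ?case
        by (rule tendsto_eventually)
    qed
    show "AE w in M. nr (x n \<ominus> x m) w \<le> f n w" if "n \<le> m" for n m
    proof -
      let ?b = "\<lambda>w. complex_of_real (a n w) - complex_of_real (a m w)"
      have "ess_bounded M (\<lambda>w. complex_of_real (a n w) + - 1 * complex_of_real (a m w))"
        using a by (intro ess_bounded_add ess_bounded_mult) auto
      then have "EF ?b"
        by (intro EF_bounded) simp
      then have "AE w in M. nr (x n \<ominus> x m) w = cmod (?b w) * nr z w"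
        unfolding x_def using act_diff[OF RF_bounded[OF a] RF_bounded[OF a], of z n m] nr_act[of ?b z] zU
        by simp
      then show ?thesis
        using nz
      proof eventually_elim
        case (elim w)
        have "?b w = complex_of_real (a n w - a m w)"
          by simp
        then have b: "cmod (?b w) = \<bar>a n w - a m w\<bar>"
          by (metis norm_of_real)
        have "\<bar>a n w - a m w\<bar> * (h w * \<bar>g w\<bar>) \<le> f n w"
          using A_mono[OF _ that, of w] h(2)[of w] by (auto simp: a_def f_def indicator_def)
        moreover have "nr z w = h w * \<bar>g w\<bar>"
          using elim(2) nr_nonneg[OF zU, of w] h(2)[of w] by (simp add: zero_le_mult_iff)
        ultimately show ?case
          using elim(1) unfolding b by simp
      qed
    qed
  qed auto
  have "act ?h y = z"
  proof (rule nr_minus_eq_0)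
    show "act ?h y \<in> carrier U" "z \<in> carrier U"
      using hE y zU by auto
    \<comment> \<open>On \<open>A n\<close> the majorant \<open>f n\<close> vanishes, so hy agrees
      there with h \<open>x n\<close>, and h \<open>x n\<close> is \<open>z\<close> cut to
      \<open>A n\<close>.\<close>
    have "AE w in M. w \<in> A n \<longrightarrow> nr (act ?h y \<ominus> z) w = 0" for n
    proof -
      have hx: "act ?h (x n) = ract (indicator (A n)) z"
      proof -
        have "act ?h (x n) = act (\<lambda>w. ?h w * complex_of_real (a n w)) z"
          unfolding x_def using hE RF_bounded[OF a] zU by (intro act_act)
        also have "\<dots> = ract (indicator (A n)) z"
          using RF_mult[OF hE RF_bounded[OF a[of n]]] h(2)
          by (intro act_cong RF_bounded ess_bounded_indicator A AE_I2) (auto simp: a_def less_imp_neq[symmetric])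
        finally show ?thesis .
      qed
      have "AE w in M. nr (act ?h y \<ominus> act ?h (x n)) w = h w * nr (y \<ominus> x n) w"
        using nr_act[OF hE, of "y \<ominus> x n"] y xU hE h(2) by (simp add: act_minus abs_of_pos)
      moreover have "AE w in M. nr (act ?h (x n) \<ominus> z) w = cmod (complex_of_real (indicator (A n) w) - 1) * nr z w"
      proof -
        let ?b = "\<lambda>w. complex_of_real (indicator (A n) w) - 1"
        have "ess_bounded M (\<lambda>w. complex_of_real (indicator (A n) w) + - 1)"
          using A by (intro ess_bounded_add) (auto intro: ess_bounded_indicator)
        then have "EF ?b"
          by (intro EF_bounded) simp
        moreover have "RF (indicator (A n))"
          by (intro RF_bounded ess_bounded_indicator A)
        then have "act ?h (x n) \<ominus> z = act ?b z"
          unfolding hx using act_diff[OF _ EF_const, of _ z 1] zU by (simp add: act_one)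
        ultimately show ?thesis
          using nr_act[of ?b z] zU by simp
      qed
      moreover have "AE w in M. nr (act ?h y \<ominus> z) w \<le> nr (act ?h y \<ominus> act ?h (x n)) w + nr (act ?h (x n) \<ominus> z) w"
        using hE y xU zU by (intro nr_minus_triangle) auto
      ultimately show ?thesis
        using y(2)[of n]
      proof eventually_elim
        case (elim w)
        show ?case
        proof
          assume "w \<in> A n"
          moreover have "0 \<le> nr (y \<ominus> x n) w" "0 \<le> nr (act ?h y \<ominus> z) w"
            using y xU zU hE by (auto intro!: nr_nonneg)
          ultimately show "nr (act ?h y \<ominus> z) w = 0"
            using elim by (simp add: f_def)
        qed
      qed
    qed
    then have "AE w in M. \<forall>n. w \<in> A n \<longrightarrow> nr (act ?h y \<ominus> z) w = 0"
      unfolding AE_all_countable by blast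
    then show "AE w in M. nr (act ?h y \<ominus> z) w = 0"
      using AE_space by eventually_elim (use A_ex in blast)
  qed
  then show ?thesis
    using y(1) by (intro that)
qed

text \<open>Simple approximants of \<open>u\<close> are evaluations of bounded elements
  \<open>y n\<close>, but they converge only pointwise and without bounded majorants. A weight
  \<open>h\<close> makes the majorants bounded; the weighted elements then converge to a bounded
  \<open>z\<close> whose evaluation is hu, and division by \<open>h\<close> inside \<open>U\<close>
  produces the element.\<close>

lemma Rep_surj:
  assumes u: "u \<in> measurable_sections M fib Lb"
    and g: "RF g" "AE w in M. g w = sec_norm fib u w"
  shows "\<exists>x\<in>carrier U. Rep x u"
proof -
  note u_AE = wb.AE_section[OF wb.measurable_sections_section[OF u]]
  obtain s where s: "\<And>n. wb.asimple (s n)"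
    and lim_s: "AE w in M. (\<lambda>n. fnorm (fib w) (s n w \<ominus>\<^bsub>fib w\<^esub> the (u w))) \<longlonglongrightarrow> 0"
    using u unfolding wb.measurable_sections_iff by blast
  have "\<exists>y. \<forall>n. y n \<in> Ub \<and> (AE w in M. s n w = q w (y n))"
    using asimple_q[OF s] by (intro choice allI) blast
  then obtain y where y: "\<And>n. y n \<in> Ub" and sy: "\<And>n. AE w in M. s n w = q w (y n)"
    by blast
  have yU: "y n \<in> carrier U" for n
    using y by auto
  define dist where "dist n w = fnorm (fib w) (q w (y n) \<ominus>\<^bsub>fib w\<^esub> the (u w))" for n w
  have "AE w in M. \<forall>n. s n w = q w (y n)"
    using sy by (simp add: AE_all_countable)
  then have lim: "AE w in M. (\<lambda>n. dist n w) \<longlonglongrightarrow> 0"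
    using lim_s by eventually_elim (simp add: dist_def)
  have "AE w in M. nr (y n \<ominus> y m) w = fnorm (fib w) (q w (y n) \<ominus>\<^bsub>fib w\<^esub> q w (y m))" for n m
    using PR_AE[OF Ub_bounded[OF Ub_minus[OF y y]], of n m] AE_space
    by eventually_elim (simp add: q_minus q_norm y Ub_minus)
  then have nr_q: "AE w in M. \<forall>n m. nr (y n \<ominus> y m) w = fnorm (fib w) (q w (y n) \<ominus>\<^bsub>fib w\<^esub> q w (y m))"
    by (simp add: AE_all_countable)
  \<comment> \<open>A measurable stand-in for the distance of \<open>y n\<close> to
    \<open>u\<close>: almost everywhere that distance is the limit over \<open>m\<close> of the
    measurable functions \<open>nr (y n \<ominus> y m)\<close>.\<close>
  define e where "e n w = lim (\<lambda>m. nr (y n \<ominus> y m) w)" for n w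
  have e_m: "e n \<in> borel_measurable M" for n
  proof -
    have [measurable]: "nr (y n \<ominus> y m) \<in> borel_measurable M" for m
      using yU by (intro nr_measurable) auto
    show ?thesis
      unfolding e_def by measurable
  qed
  have e_dist: "AE w in M. \<forall>n. e n w = dist n w"
    using nr_q lim u_AE
  proof eventually_elim
    case (elim w)
    then have w: "w \<in> space M" and uc: "the (u w) \<in> carrier (fib w)"
      by blast+
    interpret f: normed_carrier_alg "fib w"
      using w by (rule fib_normed)
    have qc: "q w (y n) \<in> carrier (fib w)" for n
      using w y by simp
    have "(\<lambda>m. nr (y n \<ominus> y m) w - dist n w) \<longlonglongrightarrow> 0" for n
    proof (rule Lim_null_comparison[OF always_eventually elim(2)], rule allI)
      fix m
      show "norm (nr (y n \<ominus> y m) w - dist n w) \<le> dist m w"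
        using f.s_minus_triangle[OF qc qc uc, of n m] f.s_minus_triangle[OF qc uc qc, of n m]
          f.s_minus_commute[OF uc qc, of m] elim(1)
        by (simp add: dist_def)
    qed
    then have "(\<lambda>m. nr (y n \<ominus> y m) w) \<longlonglongrightarrow> dist n w" for n
      by (simp add: LIM_zero_iff)
    then show ?case
      by (simp add: e_def limI)
  qed
  have "AE w in M. (\<lambda>n. e n w) \<longlonglongrightarrow> 0"
    using lim e_dist by eventually_elim simp
  from decreasing_majorant[OF e_m this] obtain d where
    d_m: "\<And>n. d n \<in> borel_measurable M" and d0: "\<And>n w. 0 \<le> d n w"
    and d_dec: "\<And>n m w. n \<le> m \<Longrightarrow> d m w \<le> d n w" and d_lim: "AE w in M. (\<lambda>n. d n w) \<longlonglongrightarrow> 0"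
    and d_e: "\<And>n m. n \<le> m \<Longrightarrow> AE w in M. e m w \<le> d n w"
    by blast
  note [measurable] = d_m
  \<comment> \<open>Chosen so that h \<open>d n\<close> is at most 1 for all \<open>n\<close>,
    because \<open>d 0\<close> dominates every \<open>d n\<close>.\<close>
  define h where "h w = 1 / (1 + d 0 w)" for w
  have h0: "0 < h w" "h w * d n w \<le> 1" "h w \<le> 1" for w n
    using d0[of 0 w] d_dec[of 0 n w] by (simp_all add: h_def add_pos_nonneg divide_simps)
  have h_m [measurable]: "h \<in> borel_measurable M"
    unfolding h_def by measurable
  have h: "ess_bounded M h"
    using h0 by (intro ess_bounded_bound[of _ _ 1]) (auto simp: abs_of_pos)
  let ?h = "\<lambda>w. complex_of_real (h w)"
  have hE: "RF h"
    using h by (rule RF_bounded)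
  have hyb: "act ?h (y n) \<in> Ub" for n
    using h y by (intro Ub_act) auto
  have hyU: "act ?h (y n) \<in> carrier U" for n
    using hyb by auto
  \<comment> \<open>The factor 2 accounts for the two distances to \<open>u\<close>, of
    \<open>y n\<close> and of a later \<open>y m\<close>; each is at most
    \<open>d n\<close>.\<close>
  define f where "f n w = 2 * (h w * d n w)" for n w
  have f: "ess_bounded M (f n)" for n
  proof (rule ess_bounded_bound[of _ _ 2])
    show "f n \<in> borel_measurable M"
      unfolding f_def by measurable
    show "AE w in M. norm (f n w) \<le> 2"
      using h0 d0 by (intro AE_I2) (simp add: f_def abs_of_nonneg less_imp_le)
  qed
  have f_lim: "AE w in M. (\<lambda>n. f n w) \<longlonglongrightarrow> 0"
    using d_lim
  proof eventually_elim
    case (elim w)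
    have "(\<lambda>n. 2 * (h w * d n w)) \<longlonglongrightarrow> 2 * (h w * 0)"
      by (intro tendsto_intros elim)
    then show ?case by (simp add: f_def)
  qed
  obtain z where z: "z \<in> carrier U" "\<And>n. AE w in M. nr (z \<ominus> act ?h (y n)) w \<le> f n w"
  proof (rule seq_complete[OF hyU RF_bounded[OF f] _ f_lim])
    show "AE w in M. f m w \<le> f n w" if "n \<le> m" for n m
      using d_dec[OF that] h0(1) by (intro AE_I2) (simp add: f_def mult_left_mono less_imp_le)
    show "AE w in M. nr (act ?h (y n) \<ominus> act ?h (y m)) w \<le> f n w" if "n \<le> m" for n m
    proof -
      have "AE w in M. nr (act ?h (y n) \<ominus> act ?h (y m)) w = h w * nr (y n \<ominus> y m) w"
        using nr_act[OF hE, of "y n \<ominus> y m"] yU hE h0 by (simp add: act_minus abs_of_pos)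
      then show ?thesis
        using d_e[OF order_refl, of n] d_e[OF that] nr_q e_dist u_AE
      proof eventually_elim
        case (elim w)
        then have w: "w \<in> space M" and uc: "the (u w) \<in> carrier (fib w)"
          by blast+
        interpret f: normed_carrier_alg "fib w"
          using w by (rule fib_normed)
        have qc: "q w (y n) \<in> carrier (fib w)" for n
          using w y by simp
        have "nr (y n \<ominus> y m) w \<le> dist n w + dist m w"
          using f.s_minus_triangle[OF qc uc qc, of n m] f.s_minus_commute[OF uc qc, of m] elim(4)
          by (simp add: dist_def)
        also have "\<dots> \<le> 2 * d n w"
          using elim(2,3,5) by simp
        finally have "h w * nr (y n \<ominus> y m) w \<le> h w * (2 * d n w)"
          using h0(1)[of w] by (intro mult_left_mono) auto
        then show ?case
          using elim(1) by (simp add: f_def)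
      qed
    qed
  qed auto
  have zb: "z \<in> Ub"
  proof (rule UbI[OF z(1)])
    show "ess_bounded M (\<lambda>w. nr (act ?h (y 0)) w + f 0 w)"
      using f hyb by (intro ess_bounded_add Ub_bounded)
    show "AE w in M. nr z w \<le> nr (act ?h (y 0)) w + f 0 w"
      using nr_le_minus[OF z(1) hyU[of 0]] z(2)[of 0] by eventually_elim simp
  qed
  have zf: "AE w in M. \<forall>n. nr (z \<ominus> act ?h (y n)) w \<le> f n w"
    using z(2) by (simp add: AE_all_countable)
  have "AE w in M. nr (z \<ominus> act ?h (y n)) w = fnorm (fib w) (q w z \<ominus>\<^bsub>fib w\<^esub> q w (act ?h (y n)))" for n
    using PR_AE[OF Ub_bounded[OF Ub_minus[OF zb hyb]], of n] AE_space
    by eventually_elim (simp add: q_minus q_norm zb hyb Ub_minus)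
  then have zq: "AE w in M. \<forall>n. nr (z \<ominus> act ?h (y n)) w = fnorm (fib w) (q w z \<ominus>\<^bsub>fib w\<^esub> q w (act ?h (y n)))"
    by (simp add: AE_all_countable)
  have hq: "AE w in M. \<forall>n. q w (act ?h (y n)) = ?h w \<odot>\<^bsub>fib w\<^esub> q w (y n)"
    using q_act_AE[OF _ y, of ?h] h by (simp add: AE_all_countable)
  \<comment> \<open>Triangle inequality through the weighted \<open>y n\<close>: one distance is at
    most \<open>f n\<close>, the other is h times the distance of \<open>y n\<close> to
    \<open>u\<close>, and both tend to 0.\<close>
  have uz: "AE w in M. ?h w \<odot>\<^bsub>fib w\<^esub> the (u w) = q w z"
    using zf zq hq f_lim lim u_AE
  proof eventually_elim
    case (elim w)
    then have w: "w \<in> space M" and uc: "the (u w) \<in> carrier (fib w)"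
      by blast+
    interpret f: normed_carrier_alg "fib w"
      using w by (rule fib_normed)
    have qc: "q w (y n) \<in> carrier (fib w)" "q w z \<in> carrier (fib w)" for n
      using w y zb by simp_all
    have "fnorm (fib w) (q w z \<ominus>\<^bsub>fib w\<^esub> ?h w \<odot>\<^bsub>fib w\<^esub> the (u w)) \<le> f n w + h w * dist n w" for n
    proof -
      have "?h w \<odot>\<^bsub>fib w\<^esub> q w (y n) \<ominus>\<^bsub>fib w\<^esub> ?h w \<odot>\<^bsub>fib w\<^esub> the (u w) = ?h w \<odot>\<^bsub>fib w\<^esub> (q w (y n) \<ominus>\<^bsub>fib w\<^esub> the (u w))"
        using qc uc by (simp add: f.minus_scale f.scale_add_right f.scale_scale)
      then have "fnorm (fib w) (?h w \<odot>\<^bsub>fib w\<^esub> q w (y n) \<ominus>\<^bsub>fib w\<^esub> ?h w \<odot>\<^bsub>fib w\<^esub> the (u w)) = h w * dist n w"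
        using qc uc h0(1)[of w] by (simp add: f.s_scale dist_def)
      moreover have "fnorm (fib w) (q w z \<ominus>\<^bsub>fib w\<^esub> ?h w \<odot>\<^bsub>fib w\<^esub> q w (y n)) \<le> f n w"
        using elim(1-3) by metis
      ultimately show ?thesis
        using f.s_minus_triangle[of "q w z" "?h w \<odot>\<^bsub>fib w\<^esub> q w (y n)" "?h w \<odot>\<^bsub>fib w\<^esub> the (u w)"] qc uc
        by simp
    qed
    moreover have "(\<lambda>n. f n w + h w * dist n w) \<longlonglongrightarrow> 0 + h w * 0"
      by (intro tendsto_intros elim)
    ultimately have "fnorm (fib w) (q w z \<ominus>\<^bsub>fib w\<^esub> ?h w \<odot>\<^bsub>fib w\<^esub> the (u w)) \<le> 0 + h w * 0"
      by (intro LIMSEQ_le_const[of "\<lambda>n. f n w + h w * dist n w"]) auto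
    then have "fnorm (fib w) (q w z \<ominus>\<^bsub>fib w\<^esub> ?h w \<odot>\<^bsub>fib w\<^esub> the (u w)) = 0"
      using f.s_nonneg[of "q w z \<ominus>\<^bsub>fib w\<^esub> ?h w \<odot>\<^bsub>fib w\<^esub> the (u w)"] qc uc by simp
    then show ?case
      using f.fnorm_minus_eq_0_iff[of "q w z" "?h w \<odot>\<^bsub>fib w\<^esub> the (u w)"] qc uc by simp
  qed
  \<comment> \<open>This is where the norm of \<open>u\<close> being in \<open>E\<close> is used: it
    presents the norm of \<open>z\<close> as h times a function of \<open>E\<close>, which permits
    division by \<open>h\<close>.\<close>
  have nz: "AE w in M. nr z w = h w * g w"
    using uz u_AE g(2) PR_AE[OF Ub_bounded[OF zb]]
  proof eventually_elim
    case (elim w)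
    then have w: "w \<in> space M" and uc: "the (u w) \<in> carrier (fib w)"
      by blast+
    interpret f: normed_carrier_alg "fib w"
      using w by (rule fib_normed)
    have "nr z w = fnorm (fib w) (q w z)"
      using elim(4) zb w by (simp add: q_norm)
    also have "\<dots> = h w * fnorm (fib w) (the (u w))"
      unfolding elim(1)[symmetric] using uc h0(1)[of w] by (simp add: f.s_scale)
    finally show ?case
      using elim(3) by (simp add: sec_norm_def)
  qed
  obtain x where x: "x \<in> carrier U" "act ?h x = z"
    using Rep_divide[OF zb h h0(1) g(1) nz] by blast
  have "AE w in M. rep_at h x u w"
    using u_AE uz unfolding x(2) by eventually_elim blast
  then have "Rep_via h x u"
    using h h0(1) zb by (simp add: Rep_via_def good_def x(2))
  then show ?thesis
    using x(1) by (auto simp: Rep_def)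
qed


section \<open>The isometry onto classes of sections, and the vector-valued lifting\<close>

definition Phi :: "'u \<Rightarrow> ('a \<rightharpoonup> 'u set) set" where
  "Phi x = {u \<in> measurable_sections M fib Lb. Rep x u}"

lemma PhiD: "u \<in> Phi x \<Longrightarrow> u \<in> measurable_sections M fib Lb" "u \<in> Phi x \<Longrightarrow> Rep x u"
  by (simp_all add: Phi_def)

lemma Phi_nonempty: "x \<in> carrier U \<Longrightarrow> \<exists>u. u \<in> Phi x"
  using Rep_exists[of x] by (auto simp: Phi_def)

text \<open>Common pattern for sums, products and scalar multiples of classes: \<open>Phi x\<close>
  is a single a.e. class, so it suffices that every member of \<open>S\<close> is a.e. equal to some
  section of \<open>x\<close> and that \<open>S\<close> contains the class of one of them.\<close>

lemma Phi_eqI: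
  assumes x: "x \<in> carrier U" and u: "Rep x u"
    and S: "S \<subseteq> measurable_sections M fib Lb"
    and S_imp: "\<And>s. s \<in> S \<Longrightarrow> \<exists>v. Rep x v \<and> (AE w in M. s w = v w)"
    and imp_S: "\<And>s. \<lbrakk>s \<in> measurable_sections M fib Lb; AE w in M. s w = u w\<rbrakk> \<Longrightarrow> s \<in> S"
  shows "S = Phi x"
proof (intro equalityI subsetI)
  fix s assume "s \<in> S"
  then show "s \<in> Phi x"
    using S S_imp[of s] Rep_cong unfolding Phi_def by blast
next
  fix s assume "s \<in> Phi x"
  then show "s \<in> S"
    using Rep_unique[OF PhiD(2) u x] by (intro imp_S) (auto dest: PhiD)
qed

lemma Phi_class:
  assumes "u \<in> Phi x" "x \<in> carrier U"
  shows "Phi x = sec_class M fib Lb u"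
  by (rule Phi_eqI[symmetric, OF assms(2) PhiD(2)[OF assms(1)]])
     (use PhiD(2)[OF assms(1)] in \<open>auto simp: sec_class_def\<close>)

lemma Phi_add:
  assumes x: "x \<in> carrier U" and y: "y \<in> carrier U"
  shows "cls_add M fib Lb (Phi x) (Phi y) = Phi (x \<oplus> y)"
proof -
  obtain u v where uv: "u \<in> Phi x" "v \<in> Phi y"
    using Phi_nonempty x y by blast
  note R = Rep_add[OF PhiD(2) PhiD(2) x y]
  show ?thesis
    by (rule Phi_eqI[OF _ R[OF uv]]) (use x y uv R in \<open>auto simp: cls_add_def\<close>)
qed

lemma Phi_mult:
  assumes x: "x \<in> carrier U" and y: "y \<in> carrier U"
  shows "cls_mult M fib Lb (Phi x) (Phi y) = Phi (x \<otimes> y)"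
proof -
  obtain u v where uv: "u \<in> Phi x" "v \<in> Phi y"
    using Phi_nonempty x y by blast
  note R = Rep_mult[OF PhiD(2) PhiD(2) x y]
  show ?thesis
    by (rule Phi_eqI[OF _ R[OF uv]]) (use x y uv R in \<open>auto simp: cls_mult_def mult_closed\<close>)
qed

lemma Phi_act:
  assumes x: "x \<in> carrier U" and f: "EF f"
  shows "cls_scale M fib Lb (L0_class M f) (Phi x) = Phi (act f x)"
proof -
  obtain u where u: "u \<in> Phi x"
    using Phi_nonempty x by blast
  have f_self: "f \<in> L0_class M f"
    using EF_measurable[OF f] by (rule L0_class_self)
  note R = Rep_act[OF PhiD(2) f x]
  show ?thesis
  proof (rule Phi_eqI[OF act_closed[OF f x] R[OF u]])
    fix s assume "s \<in> cls_scale M fib Lb (L0_class M f) (Phi x)"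
    then obtain f' u' where f': "AE w in M. f' w = f w" and u': "u' \<in> Phi x"
      and s: "AE w in M. s w = sec_scale fib f' u' w"
      by (auto simp: cls_scale_def L0_class_def)
    have "AE w in M. s w = sec_scale fib f u' w"
      using f' s by eventually_elim (simp add: sec_scale_def)
    then show "\<exists>v. Rep (act f x) v \<and> (AE w in M. s w = v w)"
      using R[OF u'] by blast
  qed (use u f_self in \<open>auto simp: cls_scale_def\<close>)
qed

lemma Phi_norm:
  assumes x: "x \<in> carrier U"
  shows "cls_norm M fib (Phi x) = vnorm U x"
proof -
  obtain u where u: "u \<in> Phi x"
    using Phi_nonempty x by blast
  have "AE w in M. nr x w = sec_norm fib u w"
    using Rep_norm[OF PhiD(2)[OF u] x] by eventually_elim simp
  from wb.cls_norm_sec_class[OF PhiD(1)[OF u] this] show ?thesis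
    using x by (simp add: Phi_class[OF u x] vnorm_nr)
qed

lemma Phi_bij: "bij_betw Phi (carrier U) (E_sec M E fib Lb)"
proof (rule bij_betwI')
  fix x y assume xy: "x \<in> carrier U" "y \<in> carrier U"
  show "Phi x = Phi y \<longleftrightarrow> x = y"
  proof
    assume eq: "Phi x = Phi y"
    obtain u where "u \<in> Phi x"
      using Phi_nonempty xy by blast
    then show "x = y"
      using eq xy by (intro Rep_inj[of x u y] PhiD(2)) auto
  qed simp
next
  fix x assume x: "x \<in> carrier U"
  obtain u where u: "u \<in> Phi x"
    using Phi_nonempty x by blast
  then have "Phi x \<in> L0_sec M fib Lb"
    using Phi_class[OF u x] PhiD(1)[OF u] by (auto simp: L0_sec_def)
  then show "Phi x \<in> E_sec M E fib Lb"
    using x nr_RF[OF x] by (simp add: E_sec_def Phi_norm vnorm_nr EF_def)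
next
  fix Y assume Y: "Y \<in> E_sec M E fib Lb"
  then obtain u where u: "u \<in> measurable_sections M fib Lb" "Y = sec_class M fib Lb u"
    by (auto simp: E_sec_def L0_sec_def)
  obtain g where g: "g \<in> borel_measurable M" "AE w in M. g w = sec_norm fib u w"
    by (rule wb.measurable_sections_norm[OF u(1)])
  have "cls_norm M fib Y = L0_class M (\<lambda>w. complex_of_real (g w))"
    unfolding u(2) using u(1) g(2) by (rule wb.cls_norm_sec_class)
  then have "RF g"
    using Y g(1) by (simp add: E_sec_def EF_def)
  then obtain x where x: "x \<in> carrier U" "Rep x u"
    using Rep_surj[OF u(1) _ g(2)] by blast
  then have "Y = Phi x"
    using Phi_class[of u x] u by (simp add: Phi_def)
  then show "\<exists>x\<in>carrier U. Y = Phi x"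
    using x by blast
qed

lemma Phi_isometric: "isometrically_isomorphic M E U fib Lb"
  unfolding isometrically_isomorphic_def
proof (intro exI[of _ Phi] conjI ballI)
  fix a x assume "a \<in> E" "x \<in> carrier U"
  then show "Phi (a \<odot> x) = cls_scale M fib Lb a (Phi x)"
    by (elim E_rep) (simp add: Phi_act act_def)
qed (simp_all add: Phi_bij Phi_add Phi_mult Phi_norm)

text \<open>\<open>Phi\<close> is injective, so a class determines its element, and the
  distinguished representative is the evaluation of that element. It is meaningful for classes of
  bounded elements.\<close>

definition lift_sec :: "('a \<rightharpoonup> 'u set) set \<Rightarrow> 'a \<rightharpoonup> 'u set" where
  "lift_sec Y = sec (the_inv_into (carrier U) Phi Y)"

lemma lift_sec_Phi: "x \<in> carrier U \<Longrightarrow> lift_sec (Phi x) = sec x"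
  using Phi_bij by (simp add: lift_sec_def bij_betw_def the_inv_into_f_f)

lemma Linf_sec_eq: "Linf_sec M fib Lb = Phi ` Ub"
  using Phi_bij Phi_norm by (rule Linf_sec_image)

lemma represents_fib: "represents M p E U fib Lb lift_sec"
  unfolding represents_def vector_lifting_def Linf_sec_eq
proof (intro conjI ballI Phi_isometric; (elim imageE)?)
  fix Y x assume Y: "Y = Phi x" and x: "x \<in> Ub"
  have eq: "lift_sec Y = sec x"
    using x by (simp add: Y lift_sec_Phi)
  have m: "sec x \<in> measurable_sections M fib Lb"
    using x by (intro wb.L_measurable) (simp add: Lb_def)
  show "lift_sec Y \<in> Y"
    unfolding eq using m x by (simp add: Y Phi_def Rep_sec)
  show dom: "dom (lift_sec Y) = space M"
    by (simp add: eq dom_sec)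
  show "lift_sec Y \<in> bounded_sections M fib Lb"
  proof -
    have "P (\<lambda>w. complex_of_real (nr x w)) \<in> bounded_measurable M"
      using x by (intro P_bounded_measurable) (simp add: Ub_bounded)
    then obtain C where C: "\<And>w. w \<in> space M \<Longrightarrow> cmod (P (\<lambda>w. complex_of_real (nr x w)) w) \<le> C"
      by (auto simp: bounded_measurable_def)
    have "(\<lambda>w. complex_of_real (sec_norm fib (sec x) w)) \<in> bounded_measurable M"
      using x C sec_norm_measurable[OF x]
      by (auto simp: bounded_measurable_def sec_norm_sec P_of_real Ub_bounded)
    then show ?thesis
      using m dom by (simp add: bounded_sections_def eq)
  qed
  fix w assume w: "w \<in> space M"
  show "complex_of_real (sec_norm fib (lift_sec Y) w) = p (cls_norm M fib Y) w"
    using x w P_of_real[OF Ub_bounded[OF x] w]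
    unfolding eq by (simp add: Y sec_norm_sec Phi_norm vnorm_nr P_def)
next
  fix X Y x y assume *: "X = Phi x" "x \<in> Ub" "Y = Phi y" "y \<in> Ub"
  show "lift_sec (cls_add M fib Lb X Y) = sec_add fib (lift_sec X) (lift_sec Y)"
    using * by (simp add: Phi_add lift_sec_Phi sec_add_sec)
  show "lift_sec (cls_mult M fib Lb X Y) = sec_mult fib (lift_sec X) (lift_sec Y)"
    using * by (simp add: Phi_mult lift_sec_Phi sec_mult_sec mult_closed)
next
  fix a Y x assume a: "a \<in> Linf M" and *: "Y = Phi x" "x \<in> Ub"
  have "a \<in> E"
    using a solid by (auto simp: faithful_solid_subalgebra_def)
  then obtain f where f: "EF f" "a = L0_class M f"
    by (rule E_rep)
  have "ess_bounded M f"
    using a EF_measurable[OF f(1)] by (simp add: f(2) L0_class_in_Linf_iff)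
  then show "lift_sec (cls_scale M fib Lb a Y) = sec_scale fib (p a) (lift_sec Y)"
    using * f sec_scale_sec[of f x] by (simp add: Phi_act lift_sec_Phi P_def)
next
  fix w assume w: "w \<in> space M"
  have eq: "{the (lift_sec x w) |x. x \<in> Phi ` Ub} = carrier (fib w)"
  proof -
    have "{the (lift_sec x w) |x. x \<in> Phi ` Ub} = (\<lambda>x. the (lift_sec (Phi x) w)) ` Ub"
      by blast
    also have "\<dots> = q w ` Ub"
      using w by (intro image_cong) (auto simp: lift_sec_Phi sec_def)
    finally show ?thesis
      using w by (simp add: fib_carrier)
  qed
  then show "{the (lift_sec x w) |x. x \<in> Phi ` Ub} = carrier (fib w)" .
  show "dense_in_alg (fib w) {the (lift_sec x w) |x. x \<in> Phi ` Ub}"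
    unfolding eq using normed_carrier_alg.dense_in_alg_carrier[OF fib_normed[OF w]] .
qed


subsection \<open>An element of norm one\<close>

text \<open>A normalised witness that the norms of \<open>U\<close> reach all of \<open>A\<close>;
  normalised so that sums over disjoint sets are again witnesses.\<close>

definition cov :: "'a set \<Rightarrow> 'u \<Rightarrow> bool" where
  "cov A x \<longleftrightarrow> A \<in> sets M \<and> x \<in> carrier U \<and> (AE w in M. nr x w = indicator A w)"

lemma cov_restrict:
  assumes x: "cov A x" and B: "B \<in> sets M"
  shows "cov (A \<inter> B) (ract (indicator B) x)"
proof -
  have b: "RF (indicator B)"
    using B by (intro RF_bounded ess_bounded_indicator)
  have "AE w in M. nr (ract (indicator B) x) w = indicator (A \<inter> B) w"
    using nr_act[OF b, of x] x unfolding cov_def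
    by (elim conjE) (simp, elim AE_mp, auto simp: indicator_def)
  then show ?thesis
    using b x B by (auto simp: cov_def)
qed

text \<open>The upper bound is the triangle inequality. The lower bounds on \<open>A\<close> and on
  \<open>B\<close> come from writing each summand as the sum minus the other one, which has norm 0
  there.\<close>

lemma cov_disjoint_Un:
  assumes x: "cov A x" and y: "cov B y" and AB: "A \<inter> B = {}"
  shows "cov (A \<union> B) (x \<oplus> y)"
proof -
  have xy: "x \<in> carrier U" "y \<in> carrier U" "x \<oplus> y \<in> carrier U"
    using x y by (auto simp: cov_def)
  have "(y \<oplus> x) \<ominus> x = y" "(x \<oplus> y) \<ominus> y = x"
    using xy by (simp_all add: a_minus_def um.add.m_assoc um.M.r_neg)
  then have eq: "(x \<oplus> y) \<ominus> x = y" "(x \<oplus> y) \<ominus> y = x"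
    using um.add.m_comm[OF xy(1,2)] by simp_all
  have "AE w in M. nr x w = indicator A w" "AE w in M. nr y w = indicator B w"
    using x y by (auto simp: cov_def)
  then have "AE w in M. nr (x \<oplus> y) w = indicator (A \<union> B) w"
    using nr_add[OF xy(1,2)] nr_minus_le[OF xy(3,1)] nr_minus_le[OF xy(3,2)]
    unfolding eq
  proof eventually_elim
    case (elim w)
    have "w \<notin> A \<or> w \<notin> B"
      using AB by blast
    then show ?case
      using elim nr_nonneg[OF xy(3), of w] by (auto simp: indicator_def)
  qed
  then show ?thesis
    using x y by (auto simp: cov_def)
qed

text \<open>The partial sums converge in order: the difference of two of them has as norm the
  indicator of a finite block, hence lies below the indicator of a tail. By disjointness each point
  belongs to only finitely many tails.\<close>

lemma cov_disjoint_UN: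
  fixes A :: "nat \<Rightarrow> 'a set"
  assumes x: "\<And>n. cov (A n) (x n)" and disj: "disjoint_family A"
  shows "\<exists>y. cov (\<Union>n. A n) y"
proof -
  have [measurable]: "A n \<in> sets M" for n
    using x[of n] by (simp add: cov_def)
  have xU: "x n \<in> carrier U" for n
    using x[of n] by (simp add: cov_def)
  have dj: "i = j" if "w \<in> A i" "w \<in> A j" for i j w
    using disjoint_family_onD[OF disj, of i j] that by auto
  define s where "s = rec_nat \<zero> (\<lambda>n y. y \<oplus> x n)"
  have s_0: "s 0 = \<zero>" and s_Suc: "s (Suc n) = s n \<oplus> x n" for n
    by (simp_all add: s_def)
  have cov_s: "cov (\<Union>k<n. A k) (s n)" for n
  proof (induction n)
    case 0
    then show ?case
      using nr_zero by (simp add: s_0 cov_def)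
  next
    case (Suc n)
    have "(\<Union>k<n. A k) \<inter> A n = {}"
      by (auto dest: dj)
    from cov_disjoint_Un[OF Suc x this] show ?case
      by (simp add: s_Suc lessThan_Suc Un_commute)
  qed
  then have sU: "s n \<in> carrier U" for n
    by (simp add: cov_def)
  have tail: "cov (\<Union>j\<in>{n..<n + k}. A j) (s (n + k) \<ominus> s n)" for n k
  proof (induction k)
    case 0
    have "s n \<ominus> s n = \<zero>"
      using sU by (simp add: a_minus_def um.M.r_neg)
    then show ?case
      using nr_zero by (simp add: cov_def)
  next
    case (Suc k)
    have "(\<Union>j\<in>{n..<n + k}. A j) \<inter> A (n + k) = {}"
      by (auto dest: dj)
    from cov_disjoint_Un[OF Suc x this]
    have "cov ((\<Union>j\<in>{n..<n + k}. A j) \<union> A (n + k)) ((s (n + k) \<ominus> s n) \<oplus> x (n + k))" .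
    moreover have "(s (n + k) \<ominus> s n) \<oplus> x (n + k) = s (n + Suc k) \<ominus> s n"
      using sU xU by (simp add: s_Suc a_minus_def um.add.m_ac)
    moreover have "{n..<n + Suc k} = insert (n + k) {n..<n + k}"
      by auto
    ultimately show ?case
      by (simp add: Un_commute)
  qed
  define f where "f n = (indicator (\<Union>j\<in>{n..}. A j) :: 'a \<Rightarrow> real)" for n
  obtain y where y: "y \<in> carrier U" "\<And>n. AE w in M. nr (y \<ominus> s n) w \<le> f n w"
  proof (rule seq_complete[OF sU, of f])
    show "RF (f n)" for n
      unfolding f_def by (intro RF_bounded ess_bounded_indicator) measurable
    show "AE w in M. f m w \<le> f n w" if "n \<le> m" for n m
      using that by (intro AE_I2) (auto simp: f_def indicator_def)
    have "(\<lambda>n. f n w) \<longlonglongrightarrow> 0" for w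
    proof -
      have "eventually (\<lambda>n. f n w = 0) sequentially"
      proof (cases "\<exists>j. w \<in> A j")
        case True
        then obtain j where j: "w \<in> A j" by blast
        show ?thesis
          using eventually_gt_at_top[of j]
          by eventually_elim (use j in \<open>auto simp: f_def indicator_def dest: dj\<close>)
      qed (auto simp: f_def)
      then show ?thesis
        by (rule tendsto_eventually)
    qed
    then show "AE w in M. (\<lambda>n. f n w) \<longlonglongrightarrow> 0"
      by simp
    show "AE w in M. nr (s n \<ominus> s m) w \<le> f n w" if nm: "n \<le> m" for n m
    proof -
      obtain k where m: "m = n + k"
        using le_Suc_ex[OF nm] by blast
      have "AE w in M. nr (s (n + k) \<ominus> s n) w = indicator (\<Union>j\<in>{n..<n + k}. A j) w"
        using tail[of n k] by (simp add: cov_def)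
      then show ?thesis
        using nr_minus_commute[OF sU[of n] sU[of m]] unfolding m
        by eventually_elim (auto simp: f_def indicator_def)
    qed
  qed auto
  have "AE w in M. nr (s n) w = indicator (\<Union>k<n. A k) w" for n
    using cov_s[of n] by (simp add: cov_def)
  then have "AE w in M. \<forall>n. nr (s n) w = indicator (\<Union>k<n. A k) w"
    unfolding AE_all_countable by blast
  moreover have "AE w in M. \<forall>n. nr (y \<ominus> s n) w \<le> f n w"
    using y(2) unfolding AE_all_countable by blast
  moreover have "AE w in M. \<forall>n. nr y w \<le> nr (s n) w + nr (y \<ominus> s n) w"
    using nr_le_minus[OF y(1) sU] unfolding AE_all_countable by blast
  moreover have "AE w in M. nr (s n) w \<le> nr y w + nr (y \<ominus> s n) w" for n
    using nr_le_minus[OF sU[of n] y(1)] nr_minus_commute[OF sU[of n] y(1)] by eventually_elim simp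
  then have "AE w in M. \<forall>n. nr (s n) w \<le> nr y w + nr (y \<ominus> s n) w"
    unfolding AE_all_countable by blast
  ultimately have "AE w in M. nr y w = indicator (\<Union>n. A n) w"
  proof eventually_elim
    case (elim w)
    show ?case
    proof (cases "\<exists>j. w \<in> A j")
      case True
      then obtain j where j: "w \<in> A j" by blast
      \<comment> \<open>\<open>w\<close> lies in \<open>A j\<close> only, so after
        \<open>Suc j\<close> summands the error bound at \<open>w\<close> is already 0 and the
        partial sum has its final norm.\<close>
      then have "f (Suc j) w = 0"
        by (auto simp: f_def indicator_def dest: dj)
      moreover have "nr (s (Suc j)) w = 1"
        using elim(1) j by (auto simp: indicator_def)
      ultimately have "nr y w = 1"
        using elim(2-4)[rule_format, of "Suc j"] by linarith
      then show ?thesis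
        using j by (auto simp: indicator_def)
    next
      case False
      then have "f 0 w = 0" "nr (s 0) w = 0"
        using elim(1) by (auto simp: f_def)
      then have "nr y w = 0"
        using elim(2-3)[rule_format, of 0] nr_nonneg[OF y(1), of w] by linarith
      then show ?thesis
        using False by auto
    qed
  qed
  then have "cov (\<Union>n. A n) y"
    using y(1) by (auto simp: cov_def)
  then show ?thesis ..
qed

lemma cov_UN:
  fixes A :: "nat \<Rightarrow> 'a set"
  assumes "\<And>n. \<exists>x. cov (A n) x"
  shows "\<exists>y. cov (\<Union>n. A n) y"
proof -
  have "\<exists>x. cov (disjointed A n) x" for n
  proof -
    obtain x where x: "cov (A n) x"
      using assms by blast
    have "A k \<in> sets M" for k
      using assms[of k] by (auto simp: cov_def)
    then have "space M - (\<Union>k\<in>{0..<n}. A k) \<in> sets M"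
      by auto
    from cov_restrict[OF x this] have "\<exists>y. cov (A n \<inter> (space M - (\<Union>k\<in>{0..<n}. A k))) y" ..
    also have "A n \<inter> (space M - (\<Union>k\<in>{0..<n}. A k)) = disjointed A n"
      using sets.sets_into_space[of "A n" M] x by (auto simp: disjointed_def cov_def)
    finally show ?thesis .
  qed
  then obtain x where "\<And>n. cov (disjointed A n) (x n)"
    by metis
  from cov_disjoint_UN[OF this disjoint_family_disjointed] show ?thesis
    by (simp add: UN_disjointed_eq)
qed

text \<open>Exhaustion: a set of maximal measure among the supports must be conull, since otherwise
  faithfulness would provide a piece to add.\<close>

lemma norm_one_element:
  assumes faithful: "faithful M (vnorm U ` carrier U)"
  shows "\<exists>x\<in>carrier U. AE w in M. nr x w = 1"
proof -
  define S where "S = {A. \<exists>x. cov A x}"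
  have S_sets: "A \<in> sets M" if "A \<in> S" for A
    using that by (auto simp: S_def cov_def)
  have "{} \<in> S"
    using nr_zero by (auto simp: S_def cov_def intro!: exI[of _ "\<zero>"])
  have bdd: "bdd_above (measure M ` S)"
    by (intro bdd_aboveI2[of _ _ "measure M (space M)"] bounded_measure)
  define m where "m = (SUP A\<in>S. measure M A)"
  have "\<exists>A\<in>S. m - 1 / real (Suc n) < measure M A" for n
    unfolding m_def using \<open>{} \<in> S\<close> bdd by (subst less_cSUP_iff[symmetric]) auto
  then obtain A where A: "\<And>n. A n \<in> S" "\<And>n. m - 1 / real (Suc n) < measure M (A n)"
    by metis
  define B where "B = (\<Union>n. A n)"
  have BS: "B \<in> S"
    unfolding B_def using cov_UN[of A] A(1) by (auto simp: S_def)
  then obtain b where b: "cov B b"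
    by (auto simp: S_def)
  have B: "B \<in> sets M"
    using BS by (rule S_sets)
  have mB: "m \<le> measure M B"
  proof (rule LIMSEQ_le_const2[of "\<lambda>n. m - 1 / real (Suc n)"])
    have "(\<lambda>n. m - 1 / real (Suc n)) \<longlonglongrightarrow> m - 0"
      by (intro tendsto_intros LIMSEQ_inverse_real_of_nat[unfolded inverse_eq_divide])
    then show "(\<lambda>n. m - 1 / real (Suc n)) \<longlonglongrightarrow> m" by simp
    have "measure M (A n) \<le> measure M B" for n
      using B by (intro finite_measure_mono) (auto simp: B_def)
    then show "\<exists>N. \<forall>n\<ge>N. m - 1 / real (Suc n) \<le> measure M B"
      using A(2) by (meson less_imp_le order_trans)
  qed
  have maximal: "measure M D = 0" if D: "D \<in> S" "D \<inter> B = {}" for D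
  proof -
    obtain d where "cov D d"
      using D by (auto simp: S_def)
    then have "B \<union> D \<in> S"
      using cov_disjoint_Un[OF b, of D d] D(2) by (auto simp: S_def)
    then have "measure M (B \<union> D) \<le> m"
      unfolding m_def using bdd by (rule cSUP_upper)
    moreover have "measure M (B \<union> D) = measure M B + measure M D"
      using B S_sets[OF D(1)] D(2) by (intro finite_measure_Union) auto
    ultimately show ?thesis
      using mB measure_nonneg[of M D] by linarith
  qed
  define C where "C = space M - B"
  have C: "C \<in> sets M"
    using B by (simp add: C_def)
  let ?c = "\<lambda>w. complex_of_real (indicator C w)"
  have cm: "?c \<in> borel_measurable M"
    using C by measurable
  \<comment> \<open>Every norm vanishes almost everywhere on the uncovered set \<open>C\<close>, so
    its indicator is disjoint from all norms and faithfulness makes \<open>C\<close> null.\<close>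
  have "L0_disjoint M (L0_class M ?c) y" if y: "y \<in> vnorm U ` carrier U" for y
  proof -
    obtain x where x: "x \<in> carrier U" "y = vnorm U x"
      using y by blast
    note [measurable] = nr_measurable[OF x(1)] C
    have "AE w in M. w \<in> C \<longrightarrow> nr x w \<le> 1 / real (Suc k)" for k
    proof -
      \<comment> \<open>On \<open>D\<close> the norm is bounded away from 0, so \<open>x\<close> may
        be divided by it with a bounded coefficient. The result witnesses \<open>D\<close>, which is
        disjoint from \<open>B\<close> and hence null by maximality.\<close>
      define D where "D = {w\<in>space M. w \<in> C \<and> 1 / real (Suc k) < nr x w}"
      have D [measurable]: "D \<in> sets M"
        unfolding D_def by measurable
      have pos: "0 < nr x w" "1 / nr x w \<le> real (Suc k)" if "w \<in> D" for w
      proof -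
        have *: "1 / real (Suc k) < nr x w" "0 < 1 / real (Suc k)"
          using that by (simp_all add: D_def)
        then show "0 < nr x w"
          by linarith
        with * show "1 / nr x w \<le> real (Suc k)"
          by (simp add: divide_simps mult.commute split: if_splits)
      qed
      let ?a = "\<lambda>w. indicator D w / nr x w"
      have a: "ess_bounded M ?a"
      proof (rule ess_bounded_bound[of _ _ "real (Suc k)"])
        show "AE w in M. norm (?a w) \<le> real (Suc k)"
          using pos by (intro AE_I2) (auto simp: indicator_def abs_of_pos)
      qed measurable
      have "AE w in M. nr (ract ?a x) w = indicator D w"
        using nr_act[OF RF_bounded[OF a] x(1)]
        by eventually_elim (use pos(1) in \<open>force simp: indicator_def norm_divide abs_of_pos\<close>)
      then have "D \<in> S"
        using D RF_bounded[OF a] x(1) by (auto simp: S_def cov_def)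
      moreover have "D \<inter> B = {}"
        by (auto simp: D_def C_def)
      ultimately have "measure M D = 0"
        by (rule maximal)
      then have "D \<in> null_sets M"
        using D by (simp add: null_sets_def emeasure_eq_measure)
      from AE_not_in[OF this] AE_space show ?thesis
        by eventually_elim (auto simp: D_def not_less)
    qed
    then have "AE w in M. \<forall>k. w \<in> C \<longrightarrow> nr x w \<le> 1 / real (Suc k)"
      unfolding AE_all_countable by blast
    then have "AE w in M. complex_of_real (min (cmod (?c w)) (cmod (complex_of_real (nr x w)))) = 0"
    proof eventually_elim
      case (elim w)
      show ?case
      proof (cases "w \<in> C")
        case True
        have "(\<lambda>k. 1 / real (Suc k)) \<longlonglongrightarrow> 0"
          using LIMSEQ_inverse_real_of_nat by (simp add: inverse_eq_divide)
        then have "nr x w \<le> 0"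
          by (rule LIMSEQ_le_const) (use elim True in blast)
        then show ?thesis
          using nr_nonneg[OF x(1), of w] by simp
      qed simp
    qed
    then have "L0_class M (\<lambda>w. complex_of_real (min (cmod (?c w)) (cmod (complex_of_real (nr x w))))) = L0_class M (\<lambda>_. 0)"
      using cm by (subst L0_class_eq_iff) auto
    then show ?thesis
      unfolding L0_disjoint_def x(2) vnorm_nr[OF x(1)] L0_zero
      using cm by (subst L0_lift2_class) auto
  qed
  moreover have "L0_class M ?c \<in> carrier (L0 M)"
    using cm by (simp add: L0_carrier)
  ultimately have "L0_class M ?c = \<zero>\<^bsub>L0 M\<^esub>"
    using faithful by (simp add: faithful_def)
  then have "AE w in M. ?c w = 0"
    using cm by (simp add: L0_zero L0_class_eq_iff)
  moreover have "AE w in M. nr b w = indicator B w"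
    using b by (simp add: cov_def)
  ultimately have "AE w in M. nr b w = 1"
    using AE_space by eventually_elim (auto simp: C_def indicator_def split: if_splits)
  then show ?thesis
    using b by (auto simp: cov_def)
qed

end

subsection \<open>Arbitrary representing bundles\<close>

locale BK_repr = BK M p E U + weak_bundle M X L
  for M :: "'a measure" and p :: "'a L0_elem \<Rightarrow> 'a \<Rightarrow> complex" and E :: "'a L0_elem set"
    and U :: "('a L0_elem, 'u) vnormed_alg" (structure)
    and X :: "'a \<Rightarrow> 'b normed_alg" and L :: "('a \<rightharpoonup> 'b) set" +
  fixes l :: "('a \<rightharpoonup> 'b) set \<Rightarrow> ('a \<rightharpoonup> 'b)"
  assumes rep: "represents M p E U X L l"
begin

definition iso :: "'u \<Rightarrow> ('a \<rightharpoonup> 'b) set" where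
  "iso = (SOME \<Phi>. bij_betw \<Phi> (carrier U) (E_sec M E X L) \<and>
        (\<forall>x\<in>carrier U. \<forall>y\<in>carrier U.
           \<Phi> (x \<oplus> y) = cls_add M X L (\<Phi> x) (\<Phi> y) \<and>
           \<Phi> (x \<otimes> y) = cls_mult M X L (\<Phi> x) (\<Phi> y)) \<and>
        (\<forall>a\<in>E. \<forall>x\<in>carrier U. \<Phi> (a \<odot> x) = cls_scale M X L a (\<Phi> x)) \<and>
        (\<forall>x\<in>carrier U. cls_norm M X (\<Phi> x) = vnorm U x))"

lemma iso_props:
  shows iso_bij: "bij_betw iso (carrier U) (E_sec M E X L)"
    and iso_add: "\<lbrakk>x \<in> carrier U; y \<in> carrier U\<rbrakk> \<Longrightarrow> iso (x \<oplus> y) = cls_add M X L (iso x) (iso y)"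
    and iso_mult: "\<lbrakk>x \<in> carrier U; y \<in> carrier U\<rbrakk> \<Longrightarrow> iso (x \<otimes> y) = cls_mult M X L (iso x) (iso y)"
    and iso_scale: "\<lbrakk>a \<in> E; x \<in> carrier U\<rbrakk> \<Longrightarrow> iso (a \<odot> x) = cls_scale M X L a (iso x)"
    and iso_norm: "x \<in> carrier U \<Longrightarrow> cls_norm M X (iso x) = vnorm U x"
proof -
  have "isometrically_isomorphic M E U X L"
    using rep by (simp add: represents_def)
  then have "bij_betw iso (carrier U) (E_sec M E X L) \<and>
        (\<forall>x\<in>carrier U. \<forall>y\<in>carrier U.
           iso (x \<oplus> y) = cls_add M X L (iso x) (iso y) \<and>
           iso (x \<otimes> y) = cls_mult M X L (iso x) (iso y)) \<and>
        (\<forall>a\<in>E. \<forall>x\<in>carrier U. iso (a \<odot> x) = cls_scale M X L a (iso x)) \<and>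
        (\<forall>x\<in>carrier U. cls_norm M X (iso x) = vnorm U x)"
    unfolding isometrically_isomorphic_def iso_def by (rule someI_ex)
  then show "bij_betw iso (carrier U) (E_sec M E X L)"
    "\<lbrakk>x \<in> carrier U; y \<in> carrier U\<rbrakk> \<Longrightarrow> iso (x \<oplus> y) = cls_add M X L (iso x) (iso y)"
    "\<lbrakk>x \<in> carrier U; y \<in> carrier U\<rbrakk> \<Longrightarrow> iso (x \<otimes> y) = cls_mult M X L (iso x) (iso y)"
    "\<lbrakk>a \<in> E; x \<in> carrier U\<rbrakk> \<Longrightarrow> iso (a \<odot> x) = cls_scale M X L a (iso x)"
    "x \<in> carrier U \<Longrightarrow> cls_norm M X (iso x) = vnorm U x"
    by simp_all
qed

lemma Linf_sec_iso: "Linf_sec M X L = iso ` Ub"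
  using iso_bij iso_norm by (rule Linf_sec_image)

definition r :: "'a \<Rightarrow> 'u \<Rightarrow> 'b" where
  "r w x = the (l (iso x) w)"

lemma vlift: "vector_lifting M p X L l"
  using rep by (simp add: represents_def)

lemma l_iso:
  assumes "x \<in> Ub"
  shows l_iso_measurable: "l (iso x) \<in> measurable_sections M X L"
    and l_iso_in: "l (iso x) \<in> iso x" and l_iso_dom: "dom (l (iso x)) = space M"
proof -
  have "iso x \<in> Linf_sec M X L"
    using assms by (simp add: Linf_sec_iso)
  then show "l (iso x) \<in> measurable_sections M X L" "l (iso x) \<in> iso x" "dom (l (iso x)) = space M"
    using vlift by (auto simp: vector_lifting_def bounded_sections_def)
qed

lemma l_iso_r: "\<lbrakk>x \<in> Ub; w \<in> space M\<rbrakk> \<Longrightarrow> l (iso x) w = Some (r w x)"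
  using l_iso_dom[of x] unfolding r_def by (metis domD option.sel)

lemma r_image:
  assumes "w \<in> space M"
  shows "r w ` Ub = carrier (X w)"
proof -
  have "{the (l x w) |x. x \<in> Linf_sec M X L} = carrier (X w)"
    using rep assms by (simp add: represents_def)
  moreover have "{the (l x w) |x. x \<in> Linf_sec M X L} = r w ` Ub"
    unfolding Linf_sec_iso r_def by blast
  ultimately show ?thesis by simp
qed

lemma r_closed [simp, intro]: "\<lbrakk>x \<in> Ub; w \<in> space M\<rbrakk> \<Longrightarrow> r w x \<in> carrier (X w)"
  using r_image by blast

lemma r_add:
  assumes "x \<in> Ub" "y \<in> Ub" "w \<in> space M"
  shows "r w (x \<oplus> y) = r w x \<oplus>\<^bsub>X w\<^esub> r w y"
proof -
  have "l (iso (x \<oplus> y)) = sec_add X (l (iso x)) (l (iso y))"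
    using vlift assms by (simp add: vector_lifting_def Linf_sec_iso iso_add)
  then show ?thesis
    using assms by (simp add: r_def sec_add_def l_iso_dom)
qed

lemma r_mult:
  assumes "x \<in> Ub" "y \<in> Ub" "w \<in> space M"
  shows "r w (x \<otimes> y) = r w x \<otimes>\<^bsub>X w\<^esub> r w y"
proof -
  have "l (iso (x \<otimes> y)) = sec_mult X (l (iso x)) (l (iso y))"
    using vlift assms by (simp add: vector_lifting_def Linf_sec_iso iso_mult)
  then show ?thesis
    using assms by (simp add: r_def sec_mult_def l_iso_dom)
qed

lemma r_scale:
  assumes "x \<in> Ub" "w \<in> space M"
  shows "r w (act (\<lambda>_. c) x) = c \<odot>\<^bsub>X w\<^esub> r w x"
proof -
  have "L0_class M (\<lambda>_. c) \<in> Linf M" "L0_class M (\<lambda>_. c) \<in> E"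
    using EF_const[of c] unfolding EF_def by (auto intro: bounded_in_Linf)
  then have "l (iso (act (\<lambda>_. c) x)) = sec_scale X (P (\<lambda>_. c)) (l (iso x))"
    using vlift assms by (simp add: vector_lifting_def Linf_sec_iso iso_scale act_def P_def)
  then show ?thesis
    using assms by (simp add: r_def sec_scale_def l_iso_dom P_const)
qed

lemma r_norm:
  assumes "x \<in> Ub" "w \<in> space M"
  shows "fnorm (X w) (r w x) = PR (nr x) w"
proof -
  have "complex_of_real (sec_norm X (l (iso x)) w) = p (vnorm U x) w"
    using vlift assms by (simp add: vector_lifting_def Linf_sec_iso iso_norm)
  also have "\<dots> = complex_of_real (PR (nr x) w)"
    using P_of_real[OF Ub_bounded[OF assms(1)] assms(2)] assms(1) by (simp add: vnorm_nr P_def)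
  finally show ?thesis
    by (simp add: sec_norm_def r_def)
qed

text \<open>The kernel of the evaluation depends only on \<open>U\<close> and \<open>p\<close>, not
  on the bundle. This is what makes the comparison map between two bundles well defined and
  injective.\<close>

lemma r_eq_iff:
  assumes "x \<in> Ub" "y \<in> Ub" "w \<in> space M"
  shows "r w x = r w y \<longleftrightarrow> PR (nr (x \<ominus> y)) w = 0"
proof -
  interpret f: normed_carrier_alg "X w"
    using assms(3) by (rule fibre)
  have "r w x \<ominus>\<^bsub>X w\<^esub> r w y = r w (x \<ominus> y)"
    using assms by (simp add: f.minus_scale minus_act r_add r_scale Ub_act)
  then show ?thesis
    using f.fnorm_minus_eq_0_iff[of "r w x" "r w y"] assms by (simp add: r_norm Ub_minus)
qed

text \<open>Norm 1 almost everywhere becomes norm 1 at every point, because the lifting sends the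
  class of 1 to 1. This excludes zero fibres and normalises the unit of each fibre.\<close>

lemma PR_nr_one:
  assumes "x \<in> carrier U" "AE w in M. nr x w = 1" "w \<in> space M"
  shows "x \<in> Ub" "PR (nr x) w = 1"
proof -
  show "x \<in> Ub"
    using assms by (intro UbI[of _ "\<lambda>_. 1"]) (auto elim: AE_mp)
  have "PR (nr x) = PR (\<lambda>_. 1)"
    using assms by (intro PR_cong) auto
  then show "PR (nr x) w = 1"
    using assms by (simp add: PR_const)
qed

lemma measurable_bundle_if_faithful:
  assumes "faithful M (vnorm U ` carrier U)"
  shows "measurable_bundle M X L"
  unfolding measurable_bundle_def
proof (intro conjI ballI weak_bundle)
  fix w assume w: "w \<in> space M"
  interpret f: normed_carrier_alg "X w"
    using w by (rule fibre)
  obtain x where x: "x \<in> carrier U" "AE w in M. nr x w = 1"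
    using norm_one_element[OF assms] by blast
  then have "fnorm (X w) (r w x) = 1" "r w x \<in> carrier (X w)"
    using PR_nr_one[OF x w] w by (auto simp: r_norm)
  then show "carrier (X w) \<noteq> {\<zero>\<^bsub>X w\<^esub>}"
    using f.s_zero by auto
qed

text \<open>Evaluation at a point is multiplicative and onto the fibre, so it carries the unit of
  \<open>U\<close> to a unit of the fibre.\<close>

lemma unital_fibre:
  assumes "unital_BK_algebra M E U" "w \<in> space M"
  shows "unital_banach_alg (X w)"
proof -
  obtain e where e: "algebra_unit U e" "vnorm U e = \<one>\<^bsub>L0 M\<^esub>"
    using assms by (auto simp: unital_BK_algebra_def)
  then have eU: "e \<in> carrier U"
    by (simp add: algebra_unit_def)
  have "AE w in M. nr e w = 1"
    using e(2) vnorm_eq_iff[OF eU, of "\<lambda>_. 1"] by (simp add: L0_one)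
  note e1 = PR_nr_one[OF eU this assms(2)]
  have "algebra_unit (X w) (r w e)"
    unfolding algebra_unit_def r_image[OF assms(2), symmetric]
    using e(1) e1(1) assms(2) by (auto simp: algebra_unit_def simp flip: r_mult)
  moreover have "fnorm (X w) (r w e) = 1"
    using e1 assms(2) by (simp add: r_norm)
  moreover have "banach_alg (X w)"
    using weak_bundle assms(2) by (simp add: weak_measurable_bundle_def)
  ultimately show ?thesis
    by (auto simp: unital_banach_alg_def)
qed

text \<open>Truncated to the set where its norm is at most \<open>k\<close>, a section has a bounded
  class, which is the image of an element of \<open>Ub\<close>; the lifted section of that element
  is another representative of the same class.\<close>

lemma section_local:
  assumes u: "u \<in> measurable_sections M X L"
  shows "\<exists>A x. (\<forall>k::nat. A k \<in> sets M \<and> x k \<in> Ub \<and> (AE w in M. w \<in> A k \<longrightarrow> u w = l (iso (x k)) w)) \<and>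
    (AE w in M. \<exists>k. w \<in> A k)"
proof -
  obtain g where g [measurable]: "g \<in> borel_measurable M" and g0: "\<And>w. 0 \<le> g w"
    and g_AE: "AE w in M. g w = sec_norm X u w"
    using measurable_sections_norm[OF u] by blast
  define A where "A k = {w\<in>space M. g w \<le> real k}" for k :: nat
  have A [measurable]: "A k \<in> sets M" for k
    unfolding A_def by measurable
  define u' where "u' k = (\<lambda>w. if w \<in> A k then u w else if w \<in> space M then Some \<zero>\<^bsub>X w\<^esub> else None)" for k
  have u': "u' k \<in> measurable_sections M X L" for k
    unfolding u'_def using u A by (rule measurable_sections_restrict)
  have "\<exists>x\<in>Ub. iso x = sec_class M X L (u' k)" for k
  proof -
    let ?g = "\<lambda>w. indicator (A k) w * g w"
    have norm: "AE w in M. sec_norm X (u' k) w = ?g w"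
      using g_AE AE_space
    proof eventually_elim
      case (elim w)
      interpret f: normed_carrier_alg "X w"
        using elim(2) by (rule fibre)
      show ?case
        using elim by (auto simp: sec_norm_def u'_def f.s_zero)
    qed
    have "cls_norm M X (sec_class M X L (u' k)) = L0_class M (\<lambda>w. complex_of_real (?g w))"
      using norm by (intro cls_norm_sec_class[OF u']) (auto simp: eq_commute)
    moreover have "ess_bounded M ?g"
    proof (rule ess_bounded_bound[of _ _ "real k"])
      show "AE w in M. norm (?g w) \<le> real k"
        using g0 by (intro AE_I2) (auto simp: A_def indicator_def)
    qed measurable
    then have "L0_class M (\<lambda>w. complex_of_real (?g w)) \<in> Linf M"
      by (intro bounded_in_Linf) (simp only: ess_bounded_of_real)
    ultimately have "cls_norm M X (sec_class M X L (u' k)) \<in> Linf M"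
      by (rule ssubst)
    then have "sec_class M X L (u' k) \<in> Linf_sec M X L"
      using u'[of k] by (auto simp: E_sec_def L0_sec_def)
    then show ?thesis
      unfolding Linf_sec_iso by auto
  qed
  then obtain x where x: "\<And>k. x k \<in> Ub" "\<And>k. iso (x k) = sec_class M X L (u' k)"
    by metis
  have "AE w in M. w \<in> A k \<longrightarrow> u w = l (iso (x k)) w" for k
  proof -
    have "AE w in M. l (iso (x k)) w = u' k w"
      using l_iso_in[OF x(1)[of k]] unfolding x(2) by (simp add: sec_class_def)
    then show ?thesis
      by eventually_elim (simp add: u'_def)
  qed
  moreover have "AE w in M. \<exists>k. w \<in> A k"
    using AE_space by eventually_elim (auto simp: A_def intro: real_arch_simple)
  ultimately show ?thesis
    using A x(1) by (intro exI[of _ A] exI[of _ x]) blast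
qed

end

section \<open>Comparison of two representing bundles\<close>

locale BK_repr2 = A: BK_repr M p E U X L l + B: BK_repr M p E U Y K m
  for M :: "'a measure" and p :: "'a L0_elem \<Rightarrow> 'a \<Rightarrow> complex" and E :: "'a L0_elem set"
    and U :: "('a L0_elem, 'u) vnormed_alg"
    and X :: "'a \<Rightarrow> 'b normed_alg" and L :: "('a \<rightharpoonup> 'b) set" and l
    and Y :: "'a \<Rightarrow> 'c normed_alg" and K :: "('a \<rightharpoonup> 'c) set" and m
begin

text \<open>Sends the value of an element of \<open>Ub\<close> in one bundle to the value of the
  same element in the other; the choice of the element is immaterial by \<open>r_eq_iff\<close> in
  both bundles.\<close>

definition H :: "'a \<Rightarrow> 'b \<Rightarrow> 'c" where
  "H w \<xi> = B.r w (SOME x. x \<in> A.Ub \<and> A.r w x = \<xi>)"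

lemma H_r:
  assumes "x \<in> A.Ub" "w \<in> space M"
  shows "H w (A.r w x) = B.r w x"
proof -
  define x' where "x' = (SOME y. y \<in> A.Ub \<and> A.r w y = A.r w x)"
  have x': "x' \<in> A.Ub \<and> A.r w x' = A.r w x"
    unfolding x'_def by (rule someI[of _ x]) (use assms in simp)
  then have "B.r w x' = B.r w x"
    using assms A.r_eq_iff[of x' x w] B.r_eq_iff[of x' x w] by simp
  then show ?thesis
    by (simp add: H_def x'_def)
qed

lemma H_hom:
  assumes w: "w \<in> space M"
  shows "banach_alg_hom (X w) (Y w) (H w)" "inj_on (H w) (carrier (X w))"
proof -
  \<comment> \<open>Both norms equal \<open>PR (nr x) w\<close>, so \<open>H w\<close> is isometric
    and the constant 1 bounds it.\<close>
  have "\<forall>\<xi>\<in>A.r w ` A.Ub. fnorm (Y w) (H w \<xi>) \<le> 1 * fnorm (X w) \<xi>"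
    using w by (auto simp: H_r A.r_norm B.r_norm)
  then show "banach_alg_hom (X w) (Y w) (H w)"
    unfolding banach_alg_hom_def A.r_image[OF w, symmetric] using w
    by (auto simp: H_r A.Ub_add A.Ub_mult A.Ub_act B.r_add B.r_mult B.r_scale
        simp flip: A.r_add A.r_mult A.r_scale intro!: exI[of _ 1])
  show "inj_on (H w) (carrier (X w))"
    unfolding A.r_image[OF w, symmetric] using w
    by (auto simp: inj_on_def H_r A.r_eq_iff B.r_eq_iff)
qed

text \<open>Where \<open>u\<close> is a.e. the evaluation of \<open>x k\<close>, its image under
  \<open>H\<close> is a.e. the evaluation of the same \<open>x k\<close> in the other bundle; these
  evaluations are measurable and are glued.\<close>

lemma H_measurable:
  assumes u: "u \<in> measurable_sections M X L"
  shows "(\<lambda>w. map_option (H w) (u w)) \<in> measurable_sections M Y K"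
proof -
  obtain A x where A: "\<And>k::nat. A k \<in> sets M" "\<And>k. x k \<in> A.Ub"
    and eq: "\<And>k. AE w in M. w \<in> A k \<longrightarrow> u w = l (A.iso (x k)) w"
    and cover: "AE w in M. \<exists>k. w \<in> A k"
    using A.section_local[OF u] by blast
  note sec = A.measurable_sections_section[OF u]
  show ?thesis
  proof (rule B.measurable_sections_glue[of _ "\<lambda>k. m (B.iso (x k))" A])
    have "dom (\<lambda>w. map_option (H w) (u w)) = dom u"
      by (auto simp: dom_def)
    moreover have "the (map_option (H w) (u w)) \<in> carrier (Y w)" if "w \<in> dom u" for w
    proof -
      have "w \<in> space M" "the (u w) \<in> carrier (X w)"
        using sec that by (auto simp: is_section_def)
      then have "H w (the (u w)) \<in> carrier (Y w)"
        using H_hom(1)[of w] unfolding banach_alg_hom_def by blast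
      then show ?thesis
        using that by (auto simp: dom_def)
    qed
    ultimately show "is_section M Y (\<lambda>w. map_option (H w) (u w))"
      using sec unfolding is_section_def by simp
    show "AE w in M. w \<in> A k \<longrightarrow> map_option (H w) (u w) = m (B.iso (x k)) w" for k
      using eq[of k] AE_space
      by eventually_elim (use A(2)[of k] in \<open>auto simp: A.l_iso_r B.l_iso_r H_r\<close>)
  qed (use A cover B.l_iso_measurable in auto)
qed

end

text \<open>The inclusion still missing says that every measurable section of the second bundle is
  an image. Exchanging the two bundles yields the inverse family, which preserves measurability for
  the same reason.\<close>

lemma (in BK_repr2) bundle_isomorphic: "bundle_isomorphic M X L Y K"
proof -
  interpret inv: BK_repr2 M p E U Y K m X L l
    by unfold_locales
  have H_inv: "H w (inv.H w \<eta>) = \<eta>" if \<eta>: "\<eta> \<in> carrier (Y w)" and w: "w \<in> space M" for \<eta> w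
  proof -
    obtain y where "y \<in> A.Ub" "\<eta> = B.r w y"
      using B.r_image[OF w] \<eta> by blast
    then show ?thesis
      using w by (simp add: inv.H_r H_r)
  qed
  have "{(\<lambda>w. map_option (H w) (u w)) |u. u \<in> measurable_sections M X L} = measurable_sections M Y K"
  proof (intro equalityI subsetI)
    fix v assume v: "v \<in> measurable_sections M Y K"
    let ?u = "\<lambda>w. map_option (inv.H w) (v w)"
    have "map_option (H w) (?u w) = v w" for w
    proof (cases "v w")
      case (Some \<eta>)
      then have "w \<in> space M" "\<eta> \<in> carrier (Y w)"
        using B.measurable_sections_section[OF v] by (force simp: is_section_def)+
      then show ?thesis
        using Some H_inv by simp
    qed simp
    moreover have "?u \<in> measurable_sections M X L"
      using v by (rule inv.H_measurable)
    ultimately show "v \<in> {(\<lambda>w. map_option (H w) (u w)) |u. u \<in> measurable_sections M X L}"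
      by (intro CollectI exI[of _ ?u]) auto
  qed (use H_measurable in auto)
  then show ?thesis
    unfolding bundle_isomorphic_def using H_hom by (intro exI[of _ H]) auto
qed

lemma BK_reprI:
  assumes "finite_measure M" "is_lifting M p" "faithful_solid_subalgebra M E" "BK_algebra M E U"
    and "weak_measurable_bundle M X L" "represents M p E U X L l"
  shows "BK_repr M p E U X L l"
  using assms
  by (intro BK_repr.intro BK.intro lifting.intro BK_axioms.intro weak_bundle.intro BK_repr_axioms.intro)

text \<open>The fibres that are constructed have type \<open>'u set\<close>, being sets of cosets of
  bounded elements; uniqueness and the statements on units and nonzero fibres range over
  representing bundles with arbitrary fibre types.\<close>

theorem theorem2p2:
  fixes M :: "'a measure"
    and p :: "'a L0_elem \<Rightarrow> 'a \<Rightarrow> complex"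
    and E :: "'a L0_elem set"
    and U :: "('a L0_elem, 'u) vnormed_alg"
  assumes "finite_measure M"
    and "is_lifting M p"
    and "faithful_solid_subalgebra M E"
    and "BK_algebra M E U"
  shows
    "(\<exists>(X :: 'a \<Rightarrow> 'u set normed_alg) L l.
        weak_measurable_bundle M X L \<and> represents M p E U X L l \<and>
        (faithful M (vnorm U ` carrier U) \<longrightarrow> measurable_bundle M X L) \<and>
        (unital_BK_algebra M E U \<longrightarrow> (\<forall>\<omega>\<in>space M. unital_banach_alg (X \<omega>)))) \<and>
     (\<forall>(X :: 'a \<Rightarrow> 'b normed_alg) L l (Y :: 'a \<Rightarrow> 'c normed_alg) K m.
        weak_measurable_bundle M X L \<and> represents M p E U X L l \<and>
        weak_measurable_bundle M Y K \<and> represents M p E U Y K m \<longrightarrow>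
        bundle_isomorphic M X L Y K) \<and>
     (\<forall>(X :: 'a \<Rightarrow> 'b normed_alg) L l.
        weak_measurable_bundle M X L \<and> represents M p E U X L l \<longrightarrow>
        (faithful M (vnorm U ` carrier U) \<longrightarrow> measurable_bundle M X L) \<and>
        (unital_BK_algebra M E U \<longrightarrow> (\<forall>\<omega>\<in>space M. unital_banach_alg (X \<omega>))))"
proof (intro conjI allI impI ballI)
  note as = assms
  interpret BK M p E U
    using assms by (intro BK.intro lifting.intro BK_axioms.intro)
  interpret BK_repr M p E U fib Lb lift_sec
    using as weak_bundle_fib represents_fib by (rule BK_reprI)
  show "\<exists>(X :: 'a \<Rightarrow> 'u set normed_alg) L l.
        weak_measurable_bundle M X L \<and> represents M p E U X L l \<and>
        (faithful M (vnorm U ` carrier U) \<longrightarrow> measurable_bundle M X L) \<and>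
        (unital_BK_algebra M E U \<longrightarrow> (\<forall>\<omega>\<in>space M. unital_banach_alg (X \<omega>)))"
    using weak_bundle_fib represents_fib measurable_bundle_if_faithful unital_fibre by blast
next
  fix X :: "'a \<Rightarrow> 'b normed_alg" and L l and Y :: "'a \<Rightarrow> 'c normed_alg" and K m
  assume "weak_measurable_bundle M X L \<and> represents M p E U X L l \<and>
        weak_measurable_bundle M Y K \<and> represents M p E U Y K m"
  then have "BK_repr M p E U X L l" "BK_repr M p E U Y K m"
    using assms by (auto intro: BK_reprI)
  then show "bundle_isomorphic M X L Y K"
    by (intro BK_repr2.bundle_isomorphic BK_repr2.intro)
next
  fix X :: "'a \<Rightarrow> 'b normed_alg" and L l
  assume "weak_measurable_bundle M X L \<and> represents M p E U X L l"
  then interpret BK_repr M p E U X L l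
    using assms by (intro BK_reprI) auto
  show "faithful M (vnorm U ` carrier U) \<Longrightarrow> measurable_bundle M X L"
    by (rule measurable_bundle_if_faithful)
  show "unital_BK_algebra M E U \<Longrightarrow> \<omega> \<in> space M \<Longrightarrow> unital_banach_alg (X \<omega>)" for \<omega>
    by (rule unital_fibre)
qed

end
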